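(* The multivariable Bessel polynomials $Y_\lambda$ satisfy the system of differential equations $$D^B_dY_\lambda=e^B_d(\lambda)Y_\lambda,\qquad d=1,2,\ldots,$$ with eigenvalues $e^B_d(\lambda)$ that are polynomials in $\lambda_1,\ldots,\lambda_n$ of the form $$e^B_d(\lambda)=\lambda_1^{2d}+\cdots+\lambda_n^{2d}+\text{(terms of lower degree)}.$$ Moreover, the differential operators $D^B_d$ with $d=1,\ldots,n$ are algebraically independent.
   Context: Let $n\ge 1$ and let $a,\kappa$ be real parameters. Partitions are integer sequences $\lambda=(\lambda_1\ge\cdots\ge\lambda_n\ge 0)$, $|\lambda|=\sum_i\lambda_i$; $\mu\subseteq\lambda$ means $\mu_i\le\lambda_i$ for all $i$, and $\mu\subset\lambda$ means $\mu\subseteq\lambda$, $\mu\ne\lambda$. Dominance order: $\mu\le\lambda$ iff $|\mu|=|\lambda|$ and $\mu_1+\cdots+\mu_i\le\lambda_1+\cdots+\lambda_i$ for all $i$. $m_\lambda=\sum_{\alpha\in S_n\lambda}x^\alpha$. Jack polynomials: $P_\lambda=P_\lambda(x;\kappa)$ is the unique symmetric polynomial of the form $m_\lambda+\sum_{\mu<\lambda}c_{\lambda\mu}m_\mu$ that is an eigenfunction of $\sum_i x_i\partial_{x_i}$ and of $D_2=\sum_{i}x_i^2\partial_{x_i}^2+2\kappa\sum_{i\ne j}\frac{x_i^2}{x_i-x_j}\partial_{x_i}$; $D_2P_\lambda=d_\lambda P_\lambda$ with $d_\lambda=\sum_{i}\lambda_i(\lambda_i-1+2\kappa(n-i))$.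 Bessel polynomials: let $D^B=D_2+\sum_i(ax_i+2)\partial_{x_i}$ and $e_\lambda=d_\lambda+a|\lambda|$. If $e_\mu\ne e_\lambda$ for all partitions $\mu\subset\lambda$, then $Y_\lambda$ is the unique symmetric polynomial of the form $P_\lambda+\sum_{\mu\subset\lambda}u_{\lambda\mu}P_\mu$ that is an eigenfunction of $D^B$. Standing assumption: $a,\kappa$ are such that the polynomials $Y_\lambda$ in question are well-defined in this sense. Higher order operators: define differential operators $D^B_{d,\pm i}$ ($d\in\{0,1,2,\ldots\}$, $i=1,\ldots,n$) by $D^B_{0,\pm i}=1$ and, for $d>0$, $$D^B_{d,\pm i}=\pm x_i\frac{\partial}{\partial x_i}D^B_{d-1,\pm i}\pm\tfrac12(a-1+2x_i^{-1})\left(D^B_{d-1,\pm i}-D^B_{d-1,\mp i}\right)\pm\frac{\kappa}{2}\sum_{j\ne i}\frac{x_i+x_j}{x_i-x_j}\left(D^B_{d-1,\pm i}-D^B_{d-1,\pm j}\right)\pm\frac{\kappa}{2}\sum_{j\ne i}\left(D^B_{d-1,\pm i}-D^B_{d-1,\mp j}\right),$$ and set $D^B_d=\frac12\sum_{\epsilon=\pm1}\sum_{i=1}^nD^B_{2d,\epsilon i}$. (One has $D^B_1=D^B$.) *)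

theory Defs
  imports
    Complex_Main
    "HOL-Library.Poly_Mapping"
    "HOL-Computational_Algebra.Fraction_Field"
begin

text \<open>
  The variables are indexed by a finite linearly ordered type \<open>'n\<close> in the role of the ordered
  set \<open>{1, \<dots>, n}\<close>, so \<open>n = card (UNIV :: 'n set) \<ge> 1\<close>. Polynomials and rational functions in \<open>x\<^sub>1, \<dots>, x\<^sub>n\<close>
  have real coefficients, and a differential operator with rational coefficients is identified
  with the map that it induces on the field of rational functions.
\<close>

type_synonym 'n mpoly = "('n \<Rightarrow>\<^sub>0 nat) \<Rightarrow>\<^sub>0 real"

type_synonym 'n ratfun = "'n mpoly fract"

definition mvar :: "'n \<Rightarrow> 'n mpoly" where
  "mvar i = Poly_Mapping.single (Poly_Mapping.single i 1) 1"

definition mconst :: "real \<Rightarrow> 'n mpoly" where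
  "mconst c = Poly_Mapping.single 0 c"

definition meval :: "('n::finite \<Rightarrow> real) \<Rightarrow> 'n mpoly \<Rightarrow> real" where
  "meval v p =
     (\<Sum>k\<in>Poly_Mapping.keys p.
        Poly_Mapping.lookup p k * (\<Prod>i\<in>UNIV. v i ^ Poly_Mapping.lookup k i))"

text \<open>
  Partial derivative of polynomials. If \<open>x\<^sub>i\<close> does not occur in the monomial \<open>k\<close>, the truncated
  exponent \<open>k - 1\<close> is harmless since the coefficient vanishes.
\<close>

definition mderiv :: "'n \<Rightarrow> 'n mpoly \<Rightarrow> 'n mpoly" where
  "mderiv i p =
     (\<Sum>k\<in>Poly_Mapping.keys p.
        Poly_Mapping.single (k - Poly_Mapping.single i 1)
          (of_nat (Poly_Mapping.lookup k i) * Poly_Mapping.lookup p k))"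

lemma mderiv_superset:
  assumes "finite A" "Poly_Mapping.keys p \<subseteq> A"
  shows "mderiv i p =
     (\<Sum>k\<in>A. Poly_Mapping.single (k - Poly_Mapping.single i 1)
          (of_nat (Poly_Mapping.lookup k i) * Poly_Mapping.lookup p k))"
  unfolding mderiv_def
  by (rule sum.mono_neutral_left) (use assms in \<open>auto simp: in_keys_iff\<close>)

lemma mderiv_add: "mderiv i (p + q) = mderiv i p + mderiv i q"
proof -
  let ?A = "Poly_Mapping.keys p \<union> Poly_Mapping.keys q"
  have *: "finite ?A" "Poly_Mapping.keys p \<subseteq> ?A" "Poly_Mapping.keys q \<subseteq> ?A"
    "Poly_Mapping.keys (p + q) \<subseteq> ?A"
    using keys_add[of p q] by auto
  show ?thesis
    unfolding mderiv_superset[OF *(1,2)] mderiv_superset[OF *(1,3)] mderiv_superset[OF *(1,4)]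
    by (simp add: lookup_add single_add distrib_left sum.distrib)
qed

lemma mderiv_0 [simp]: "mderiv i 0 = 0"
  by (simp add: mderiv_def)

lemma mderiv_sum: "mderiv i (sum f A) = (\<Sum>x\<in>A. mderiv i (f x))"
  by (induction A rule: infinite_finite_induct) (auto simp: mderiv_add)

lemma mderiv_single:
  "mderiv i (Poly_Mapping.single k c) =
     Poly_Mapping.single (k - Poly_Mapping.single i 1) (of_nat (Poly_Mapping.lookup k i) * c)"
  by (subst mderiv_superset[where A = "{k}"]) auto

lemma mpoly_sum_monomials:
  "p = (\<Sum>k\<in>Poly_Mapping.keys p. Poly_Mapping.single k (Poly_Mapping.lookup p k))"
  by (rule poly_mapping_eqI)
    (auto simp: lookup_sum lookup_single when_def in_keys_iff sum.delta)

lemma mderiv_mult_single: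
  "mderiv i (Poly_Mapping.single k c * Poly_Mapping.single l d) =
     mderiv i (Poly_Mapping.single k c) * Poly_Mapping.single l d +
     Poly_Mapping.single k c * mderiv i (Poly_Mapping.single l d)"
proof -
  let ?e = "Poly_Mapping.single i (1::nat)"
  have shift: "a - ?e + b = a + b - ?e" if "Poly_Mapping.lookup a i \<noteq> 0"
    for a b :: "'a \<Rightarrow>\<^sub>0 nat"
    by (rule poly_mapping_eqI) (use that in \<open>auto simp: lookup_add lookup_minus lookup_single when_def\<close>)
  have 1: "Poly_Mapping.single (k - ?e + l) (of_nat (Poly_Mapping.lookup k i) * c * d) =
        Poly_Mapping.single (k + l - ?e) (of_nat (Poly_Mapping.lookup k i) * c * d)"
    using shift[of k l] by (cases "Poly_Mapping.lookup k i = 0") auto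
  have 2: "Poly_Mapping.single (k + (l - ?e)) (c * (of_nat (Poly_Mapping.lookup l i) * d)) =
        Poly_Mapping.single (k + l - ?e) (c * (of_nat (Poly_Mapping.lookup l i) * d))"
    using shift[of l k] by (cases "Poly_Mapping.lookup l i = 0") (auto simp: add.commute)
  show ?thesis
    unfolding mderiv_single mult_single 1 2
    by (simp add: lookup_add single_add[symmetric] algebra_simps)
qed

lemma mderiv_mult: "mderiv i (p * q) = mderiv i p * q + p * mderiv i q"
proof -
  let ?m = "\<lambda>p k. Poly_Mapping.single k (Poly_Mapping.lookup p k)"
  let ?P = "Poly_Mapping.keys p" and ?Q = "Poly_Mapping.keys q"
  have pq: "p = sum (?m p) ?P" "q = sum (?m q) ?Q"
    by (rule mpoly_sum_monomials)+
  have "mderiv i (sum (?m p) ?P * sum (?m q) ?Q) =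
     mderiv i (sum (?m p) ?P) * sum (?m q) ?Q + sum (?m p) ?P * mderiv i (sum (?m q) ?Q)"
    by (simp only: sum_product mderiv_sum mderiv_mult_single sum.distrib)
  then show ?thesis
    using pq by simp
qed

lift_definition rderiv :: "'n::linorder \<Rightarrow> 'n ratfun \<Rightarrow> 'n ratfun"
  is "\<lambda>i (p, q). (mderiv i p * q - p * mderiv i q, q * q)"
proof (clarsimp)
  fix i :: 'n and p q p' q' :: "'n mpoly"
  assume q: "q \<noteq> 0" "q' \<noteq> 0" and eq: "p * q' = p' * q"
  have "mderiv i (p * q') = mderiv i (p' * q)"
    by (simp add: eq)
  then have d: "mderiv i p * q' + p * mderiv i q' = mderiv i p' * q + p' * mderiv i q"
    by (simp add: mderiv_mult)
  have "(mderiv i p * q - p * mderiv i q) * (q' * q') =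
      (mderiv i p * q' + p * mderiv i q') * (q * q') - p * q' * (mderiv i q' * q + mderiv i q * q')"
    by (simp add: algebra_simps)
  also have "\<dots> = (mderiv i p' * q + p' * mderiv i q) * (q * q')
      - p' * q * (mderiv i q' * q + mderiv i q * q')"
    by (simp only: d eq)
  also have "\<dots> = (mderiv i p' * q' - p' * mderiv i q') * (q * q)"
    by (simp add: algebra_simps)
  finally show "(mderiv i p * q - p * mderiv i q) * (q' * q') =
      (mderiv i p' * q' - p' * mderiv i q') * (q * q)" .
qed

lemma rderiv_Fract:
  assumes "q \<noteq> 0"
  shows "rderiv i (Fract p q) = Fract (mderiv i p * q - p * mderiv i q) (q * q)"
  using assms by (simp add: rderiv.abs_eq Fract.abs_eq eq_onp_def)

definition rpoly :: "'n::linorder mpoly \<Rightarrow> 'n ratfun" where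
  "rpoly p = Fract p 1"

definition rconst :: "real \<Rightarrow> 'n::linorder ratfun" where
  "rconst c = rpoly (mconst c)"

definition rvar :: "'n::linorder \<Rightarrow> 'n ratfun" where
  "rvar i = rpoly (mvar i)"

definition eigenfunction ::
    "('n::linorder ratfun \<Rightarrow> 'n ratfun) \<Rightarrow> 'n mpoly \<Rightarrow> bool" where
  "eigenfunction T p \<longleftrightarrow> p \<noteq> 0 \<and> (\<exists>c. T (rpoly p) = rconst c * rpoly p)"


subsection \<open>Partitions\<close>

text \<open>
  Inclusion \<open>\<mu> \<subseteq> \<lambda>\<close> and proper inclusion \<open>\<mu> \<subset> \<lambda>\<close> of partitions are the pointwise orders
  \<open>\<mu> \<le> \<lambda>\<close> and \<open>\<mu> < \<lambda>\<close> on functions.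
\<close>

definition is_partition :: "('n::linorder \<Rightarrow> nat) \<Rightarrow> bool" where
  "is_partition l \<longleftrightarrow> antimono l"

definition dominated :: "('n::{finite,linorder} \<Rightarrow> nat) \<Rightarrow> ('n \<Rightarrow> nat) \<Rightarrow> bool" where
  "dominated m l \<longleftrightarrow> sum m UNIV = sum l UNIV \<and> (\<forall>i. sum m {..i} \<le> sum l {..i})"

definition monomial_sym :: "('n::finite \<Rightarrow> nat) \<Rightarrow> 'n mpoly" where
  "monomial_sym l = (\<Sum>\<alpha> \<in> {l \<circ> \<sigma> | \<sigma>. bij \<sigma>}. \<Prod>i\<in>UNIV. mvar i ^ \<alpha> i)"


subsection \<open>Jack polynomials\<close>

definition euler_op :: "'n::{finite,linorder} ratfun \<Rightarrow> 'n ratfun" where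
  "euler_op f = (\<Sum>i\<in>UNIV. rvar i * rderiv i f)"

definition D2_op :: "real \<Rightarrow> 'n::{finite,linorder} ratfun \<Rightarrow> 'n ratfun" where
  "D2_op \<kappa> f =
     (\<Sum>i\<in>UNIV. rvar i ^ 2 * rderiv i (rderiv i f)) +
     rconst (2 * \<kappa>) * (\<Sum>i\<in>UNIV. \<Sum>j\<in>UNIV - {i}. rvar i ^ 2 / (rvar i - rvar j) * rderiv i f)"

text \<open>The number \<open>n - i\<close> is the number of indices above \<open>i\<close>.\<close>

definition d_eig :: "real \<Rightarrow> ('n::{finite,linorder} \<Rightarrow> nat) \<Rightarrow> real" where
  "d_eig \<kappa> l =
     (\<Sum>i\<in>UNIV. real (l i) * (real (l i) - 1 + 2 * \<kappa> * real (card {i<..})))"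

text \<open>Symmetry of \<open>p\<close> is implied by its expansion in monomial symmetric polynomials.\<close>

definition is_jack :: "real \<Rightarrow> ('n::{finite,linorder} \<Rightarrow> nat) \<Rightarrow> 'n mpoly \<Rightarrow> bool" where
  "is_jack \<kappa> l p \<longleftrightarrow>
     (\<exists>c. p = monomial_sym l +
            (\<Sum>m | is_partition m \<and> dominated m l \<and> m \<noteq> l. mconst (c m) * monomial_sym m)) \<and>
     eigenfunction euler_op p \<and> eigenfunction (D2_op \<kappa>) p"

definition jack :: "real \<Rightarrow> ('n::{finite,linorder} \<Rightarrow> nat) \<Rightarrow> 'n mpoly" where
  "jack \<kappa> l = (THE p. is_jack \<kappa> l p)"


subsection \<open>Bessel polynomials\<close>

definition DB_op :: "real \<Rightarrow> real \<Rightarrow> 'n::{finite,linorder} ratfun \<Rightarrow> 'n ratfun" where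
  "DB_op a \<kappa> f = D2_op \<kappa> f + (\<Sum>i\<in>UNIV. (rconst a * rvar i + 2) * rderiv i f)"

definition e_eig :: "real \<Rightarrow> real \<Rightarrow> ('n::{finite,linorder} \<Rightarrow> nat) \<Rightarrow> real" where
  "e_eig a \<kappa> l = d_eig \<kappa> l + a * real (sum l UNIV)"

definition is_bessel ::
    "real \<Rightarrow> real \<Rightarrow> ('n::{finite,linorder} \<Rightarrow> nat) \<Rightarrow> 'n mpoly \<Rightarrow> bool" where
  "is_bessel a \<kappa> l p \<longleftrightarrow>
     (\<exists>u. p = jack \<kappa> l + (\<Sum>m | is_partition m \<and> m < l. mconst (u m) * jack \<kappa> m)) \<and>
     eigenfunction (DB_op a \<kappa>) p"

definition bessel :: "real \<Rightarrow> real \<Rightarrow> ('n::{finite,linorder} \<Rightarrow> nat) \<Rightarrow> 'n mpoly" where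
  "bessel a \<kappa> l = (THE p. is_bessel a \<kappa> l p)"

text \<open>
  The standing assumption for \<open>Y\<^sub>\<lambda>\<close>. The first clause is needed because the parameter \<open>\<kappa>\<close> is an
  arbitrary real number: the Jack polynomials entering the definition of \<open>Y\<^sub>\<lambda>\<close> have to exist and
  to be unique, which can fail for negative \<open>\<kappa>\<close>.
\<close>

definition bessel_defined :: "real \<Rightarrow> real \<Rightarrow> ('n::{finite,linorder} \<Rightarrow> nat) \<Rightarrow> bool" where
  "bessel_defined a \<kappa> l \<longleftrightarrow>
     (\<forall>m. is_partition m \<and> m \<le> l \<longrightarrow> (\<exists>!p. is_jack \<kappa> m p)) \<and>
     (\<forall>m. is_partition m \<and> m < l \<longrightarrow> e_eig a \<kappa> m \<noteq> e_eig a \<kappa> l)"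


subsection \<open>Higher order operators\<close>

text \<open>\<open>DB_part a \<kappa> d s i\<close> is the operator with index \<open>(d, s i)\<close>, for a sign \<open>s \<in> {1, -1}\<close>.\<close>

fun DB_part ::
    "real \<Rightarrow> real \<Rightarrow> nat \<Rightarrow> int \<Rightarrow> 'n::{finite,linorder} \<Rightarrow> 'n ratfun \<Rightarrow> 'n ratfun" where
  "DB_part a \<kappa> 0 s i f = f"
| "DB_part a \<kappa> (Suc d) s i f =
     of_int s *
       (rvar i * rderiv i (DB_part a \<kappa> d s i f)
        + rconst (1 / 2) * (rconst (a - 1) + 2 * inverse (rvar i))
            * (DB_part a \<kappa> d s i f - DB_part a \<kappa> d (- s) i f)
        + rconst (\<kappa> / 2) * (\<Sum>j\<in>UNIV - {i}.
            (rvar i + rvar j) / (rvar i - rvar j)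
            * (DB_part a \<kappa> d s i f - DB_part a \<kappa> d s j f))
        + rconst (\<kappa> / 2) * (\<Sum>j\<in>UNIV - {i}.
            DB_part a \<kappa> d s i f - DB_part a \<kappa> d (- s) j f))"

definition DB_higher ::
    "real \<Rightarrow> real \<Rightarrow> nat \<Rightarrow> 'n::{finite,linorder} ratfun \<Rightarrow> 'n ratfun" where
  "DB_higher a \<kappa> d f =
     rconst (1 / 2) * (\<Sum>s\<in>{1, -1}. \<Sum>i\<in>UNIV. DB_part a \<kappa> (2 * d) s i f)"


subsection \<open>Algebraic independence of operators\<close>

fun op_word :: "(nat \<Rightarrow> 'a \<Rightarrow> 'a) \<Rightarrow> nat list \<Rightarrow> 'a \<Rightarrow> 'a" where
  "op_word T [] f = f"
| "op_word T (d # ds) f = T d (op_word T ds f)"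

text \<open>
  No nonzero real polynomial \<open>p\<close> in indeterminates \<open>t\<^sub>d\<close> (\<open>d \<in> I\<close>) vanishes at the operators \<open>T d\<close>.
  For commuting operators \<open>p(T)\<close> does not depend on the order of the factors in the monomials.
  So as not to build a choice of order into the definition, nonvanishing is required for every
  way \<open>w\<close> of writing each monomial \<open>k\<close> of \<open>p\<close> as a word \<open>w k\<close>.
\<close>

definition alg_independent_ops ::
    "nat set \<Rightarrow> (nat \<Rightarrow> 'n::linorder ratfun \<Rightarrow> 'n ratfun) \<Rightarrow> bool" where
  "alg_independent_ops I T \<longleftrightarrow>
     (\<forall>(p :: nat mpoly) (w :: (nat \<Rightarrow>\<^sub>0 nat) \<Rightarrow> nat list).
        p \<noteq> 0 \<and>
        (\<forall>k\<in>Poly_Mapping.keys p. Poly_Mapping.keys k \<subseteq> I) \<and>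
        (\<forall>k\<in>Poly_Mapping.keys p. \<forall>d. count_list (w k) d = Poly_Mapping.lookup k d)
        \<longrightarrow> (\<lambda>f. \<Sum>k\<in>Poly_Mapping.keys p.
               rconst (Poly_Mapping.lookup p k) * op_word T (w k) f) \<noteq> (\<lambda>f. 0))"

end

theory Submission
  imports
    Defs
    "HOL-Combinatorics.Transposition"
    "HOL-Computational_Algebra.Polynomial_FPS"
    "HOL-Analysis.Continuum_Not_Denumerable"
begin

text \<open>
  The sums and differences of \<open>D\<^sup>B\<^bsub>d,\<plusminus>i\<^esub>\<close> turn the recursion into powers of an operator on tuples: \<open>D\<^sup>B\<^sub>d\<close> is
  \<open>\<one>\<^sup>T K\<^sup>d \<one>\<close> with \<open>K = (L + b + \<kappa> J + 2 X\<^sup>-\<^sup>1) L\<close>, where \<open>L\<close> is the Lax matrix of type A, \<open>J\<close> is the all-ones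
  matrix and \<open>b = a - 1 - \<kappa>\<close>. In the Lax equation the companion matrix annihilates \<open>\<one>\<close> from both
  sides, so \<open>D\<^sup>B\<close> commutes with every \<open>D\<^sup>B\<^sub>d\<close>. On symmetric polynomials \<open>D\<^sup>B\<^sub>d\<close> is triangular in the monomials
  ordered by \<open>\<Sum>k\<^sub>i\<^sup>2\<close>, with eigenvalue \<open>\<one>\<^sup>T ((T + b + \<kappa> J) T)\<^sup>d \<one>\<close> for a triangular matrix \<open>T\<close> whose
  diagonal entries have the form \<open>\<lambda>\<^sub>i + const\<close>.

  To see that \<open>Y\<^sub>\<lambda>\<close> is an eigenfunction, one needs that \<open>E = \<Sum>\<partial>\<^sub>i\<close> maps \<open>P\<^sub>\<lambda>\<close> into the span of the \<open>P\<^sub>\<mu>\<close>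
  with \<open>\<mu>\<close> obtained from \<open>\<lambda>\<close> by removing a box. For irrational \<open>\<kappa>\<close> this follows by comparing the
  generating functions \<open>\<Prod>(1 - z (r\<^sub>i + \<kappa>)) / (1 - z r\<^sub>i)\<close> of the Jack eigenvalues, \<open>r\<^sub>i = \<lambda>\<^sub>i + \<kappa> (n - i)\<close>, and
  it extends to all \<open>\<kappa>\<close> by continuity. Up to a scalar, \<open>Y\<^sub>\<lambda>\<close> is \<open>\<Prod>(D\<^sup>B - e\<^sub>\<mu>) P\<^sub>\<lambda>\<close> over \<open>\<mu> \<subset> \<lambda>\<close>. For generic
  \<open>a\<close> commutation with \<open>D\<^sup>B\<close> and uniqueness make it an eigenfunction of \<open>D\<^sup>B\<^sub>d\<close>, and continuity in \<open>a\<close> does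
  the rest.

  A polynomial relation between the \<open>D\<^sup>B\<^sub>d\<close> would, applied to symmetric polynomials with leading monomial
  \<open>\<lambda>\<close> and after scaling \<open>\<lambda>\<close> to infinity, give one between the power sums \<open>\<Sum>\<lambda>\<^sub>i\<^bsup>2d\<^esup>\<close>, \<open>d = 1, \<dots>, n\<close>.
\<close>

text \<open>The hypothesis on \<open>a\<close> separates \<open>e_eig\<close> at \<open>l\<close>
  only from its values at partitions contained in \<open>l\<close>. Triangularity of D^B_d is
  coarser: a priori its image may involve partitions of smaller degree that are not contained in
  \<open>l\<close> but have the same eigenvalue of D^B. Commutation and uniqueness alone therefore
  settle only generic \<open>a\<close>. Irrational \<kappa> plays a similar role for Jack
  polynomials: it rules out coincidences of eigenvalues within a support, and it lets each r_i
  determine its index. To make the two limits possible, the products \<open>Jp\<close> and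
  \<open>Zp\<close> are left unnormalised. They are continuous in the parameter even where their
  leading factor vanishes, and are divided by this factor only at the parameter in question. The
  matrices have denominators x_i - x_j. These disappear on equivariant tuples, where the
  transposition of i and j carries the i-th component into the j-th one, so that L becomes a
  polynomial operator built from divided differences.\<close>

abbreviation (input) "lookup \<equiv> Poly_Mapping.lookup"
abbreviation (input) "single \<equiv> Poly_Mapping.single"
abbreviation (input) "keys \<equiv> Poly_Mapping.keys"

section \<open>The Lax equation\<close>

locale lax =
  fixes x :: "'n::finite \<Rightarrow> 'a::field"
    and th :: "'n \<Rightarrow> 'a \<Rightarrow> 'a"
    and K :: 'a
  assumes th_add: "th i (u + v) = th i u + th i v"
    and th_mult: "th i (u * v) = th i u * v + u * th i v"
    and th_comm: "th i (th j u) = th j (th i u)"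
    and th_x: "th i (x j) = (if i = j then x j else 0)"
    and th_K [simp]: "th i K = 0"
    and x_nz [simp]: "x i \<noteq> 0"
    and x_inj [simp]: "x i = x j \<longleftrightarrow> i = j"
begin

lemma th_0 [simp]: "th i 0 = 0"
  using th_add[of i 0 0] by (metis add.right_neutral add_left_cancel)

lemma th_1 [simp]: "th i 1 = 0"
  using th_mult[of i 1 1] by (metis add.right_neutral add_left_cancel mult_1 mult_1_right)

lemma th_minus: "th i (- u) = - th i u"
  using th_add[of i u "- u"] by (simp add: eq_neg_iff_add_eq_0 add.commute)

lemma th_diff: "th i (u - v) = th i u - th i v"
  using th_add[of i u "- v"] by (simp add: th_minus)

lemma th_sum: "th i (sum f A) = (\<Sum>j\<in>A. th i (f j))"
  by (induction A rule: infinite_finite_induct) (auto simp: th_add)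

lemma th_K_mult: "th i (K * u) = K * th i u"
  by (simp add: th_mult)

lemma th_of_nat [simp]: "th i (of_nat m) = 0"
  by (induction m) (auto simp: th_add)

lemma th_2 [simp]: "th i 2 = 0"
  using th_of_nat[of i 2] by simp

lemma th_divide:
  assumes "v \<noteq> 0"
  shows "th i (u / v) = (th i u * v - u * th i v) / (v * v)"
proof -
  have "th i u = th i (u / v * v)"
    using assms by simp
  also have "\<dots> = th i (u / v) * v + u / v * th i v"
    by (rule th_mult)
  finally have "th i (u / v) * v = th i u - u / v * th i v"
    by simp
  then have "th i (u / v) = (th i u - u / v * th i v) / v"
    using assms by (simp add: field_simps)
  then show ?thesis
    using assms by (simp add: field_simps)
qed

text \<open>For \<open>i = j\<close> the following three coefficients vanish because of division by zero, so that
  sums over \<open>j \<noteq> i\<close> may be extended to all \<open>j\<close>.\<close>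

definition phi :: "'n \<Rightarrow> 'n \<Rightarrow> 'a" where "phi i j = x i / (x i - x j)"
definition rho :: "'n \<Rightarrow> 'n \<Rightarrow> 'a" where "rho i j = (x i + x j) / (x i - x j)"
definition wt :: "'n \<Rightarrow> 'n \<Rightarrow> 'a" where "wt i j = x i * x j / ((x i - x j) * (x i - x j))"

lemma coeff_diag [simp]: "phi i i = 0" "rho i i = 0" "wt i i = 0"
  by (simp_all add: phi_def rho_def wt_def)

lemma th_phi: "th k (phi i j) = (if k = i then - wt i j else 0) + (if k = j then wt i j else 0)"
proof (cases "i = j")
  case False
  then show ?thesis
    by (auto simp: phi_def wt_def th_divide th_diff th_x right_diff_distrib left_diff_distrib)
qed simp

lemma th_wt: "th k (wt i j) = (if k = i then - rho i j * wt i j else 0) + (if k = j then rho i j * wt i j else 0)"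
proof (cases "i = j")
  case False
  then have "x i - x j \<noteq> 0" "x j - x i \<noteq> 0" by simp_all
  with False show ?thesis
    apply (auto simp: rho_def wt_def th_divide th_diff th_x th_mult)
    by (simp_all add: divide_simps) (simp_all add: algebra_simps)
qed simp

lemma th_rho: "th k (rho i j) = (if k = i then - wt i j - wt i j else 0) + (if k = j then wt i j + wt i j else 0)"
proof (cases "i = j")
  case False
  then have "x i - x j \<noteq> 0" "x j - x i \<noteq> 0" by simp_all
  with False show ?thesis
    apply (auto simp: rho_def wt_def th_divide th_diff th_x th_add)
    by (simp_all add: divide_simps) (simp_all add: algebra_simps)
qed simp

lemma wt_sym: "wt i j = wt j i"
proof (cases "i = j")
  case False
  then have "x i - x j \<noteq> 0" "x j - x i \<noteq> 0" by simp_all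
  then show ?thesis by (simp add: wt_def divide_simps) (simp add: algebra_simps)?
qed simp

lemma rho_anti: "rho i j = - rho j i"
proof (cases "i = j")
  case False
  then have "x i - x j \<noteq> 0" "x j - x i \<noteq> 0" by simp_all
  then show ?thesis by (simp add: rho_def divide_simps) (simp add: algebra_simps)
qed simp

lemma phi_swap: "i \<noteq> j \<Longrightarrow> phi i j + phi j i = 1"
  "i \<noteq> j \<Longrightarrow> phi i j - phi j i = rho i j"
proof -
  assume "i \<noteq> j"
  then have "x i - x j \<noteq> 0" "x j - x i \<noteq> 0" by simp_all
  then show "phi i j + phi j i = 1" "phi i j - phi j i = rho i j"
    by (simp_all add: rho_def phi_def divide_simps) (simp_all add: algebra_simps)
qed

text \<open>\<open>Lx\<close> is the Lax matrix and \<open>Hs\<close> the trigonometric Calogero-Sutherland operator, which for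
  \<open>th i = x\<^sub>i \<partial>\<^sub>i\<close> equals \<open>D\<^sub>2\<close> up to a multiple of the Euler operator \<open>Es\<close>. The correction in \<open>Hx\<close> is the
  companion matrix; its row and column sums vanish.\<close>

definition Lx :: "('n \<Rightarrow> 'a) \<Rightarrow> 'n \<Rightarrow> 'a" where
  "Lx g i = th i (g i) + K * (\<Sum>j\<in>UNIV. phi i j * (g i - g j))"

definition Hs :: "'a \<Rightarrow> 'a" where
  "Hs f = (\<Sum>i\<in>UNIV. th i (th i f)) + K * (\<Sum>i\<in>UNIV. \<Sum>j\<in>UNIV. rho i j * th i f)"

definition Hx :: "('n \<Rightarrow> 'a) \<Rightarrow> 'n \<Rightarrow> 'a" where
  "Hx g i = Hs (g i) - K * (\<Sum>j\<in>UNIV. (wt i j + wt i j) * (g i - g j))"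

definition Es :: "'a \<Rightarrow> 'a" where "Es f = (\<Sum>i\<in>UNIV. th i f)"
definition Em :: "'a \<Rightarrow> 'a" where "Em f = (\<Sum>i\<in>UNIV. th i f / x i)"

lemma Hs_add: "Hs (u + v) = Hs u + Hs v"
  by (simp add: Hs_def th_add sum.distrib distrib_left)

lemma Hs_0 [simp]: "Hs 0 = 0"
  by (simp add: Hs_def)

lemma Hs_diff: "Hs (u - v) = Hs u - Hs v"
  using Hs_add[of "u - v" v] by simp

lemma Hs_sum: "Hs (sum f A) = (\<Sum>j\<in>A. Hs (f j))"
  by (induction A rule: infinite_finite_induct) (auto simp: Hs_add)

lemma Hs_K: "Hs (K * u) = K * Hs u"
  by (simp add: Hs_def th_K_mult sum_distrib_left distrib_left mult.left_commute)

lemma Hs_mult: "Hs (u * v) = Hs u * v + u * Hs v + (\<Sum>k\<in>UNIV. th k u * th k v + th k u * th k v)"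
proof -
  have 1: "(\<Sum>i\<in>UNIV. th i (th i (u * v))) =
     (\<Sum>i\<in>UNIV. th i (th i u)) * v + u * (\<Sum>i\<in>UNIV. th i (th i v)) + (\<Sum>k\<in>UNIV. th k u * th k v + th k u * th k v)"
    by (simp add: th_mult th_add sum.distrib sum_distrib_left sum_distrib_right algebra_simps)
  have 2: "(\<Sum>i\<in>UNIV. \<Sum>j\<in>UNIV. rho i j * th i (u * v)) =
    (\<Sum>i\<in>UNIV. \<Sum>j\<in>UNIV. rho i j * th i u) * v + u * (\<Sum>i\<in>UNIV. \<Sum>j\<in>UNIV. rho i j * th i v)"
    by (simp add: th_mult sum.distrib sum_distrib_left sum_distrib_right algebra_simps)
  show ?thesis
    unfolding Hs_def 1 2 by (simp add: algebra_simps)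
qed

lemma Hs_phi:
  "Hs (phi i j) = rho i j * wt i j + rho i j * wt i j + K * (\<Sum>k\<in>UNIV. wt i j * (rho j k - rho i k))"
proof (cases "i = j")
  case False
  have 1: "(\<Sum>k\<in>UNIV. th k (th k (phi i j))) = rho i j * wt i j + rho i j * wt i j"
  proof -
    have "th k (th k (phi i j)) = (if k = i then rho i j * wt i j else 0) + (if k = j then rho i j * wt i j else 0)" for k
      using False by (auto simp: th_phi th_wt th_minus)
    then show ?thesis by (simp add: sum.distrib)
  qed
  have 2: "(\<Sum>l\<in>UNIV. \<Sum>k\<in>UNIV. rho l k * th l (phi i j)) = (\<Sum>k\<in>UNIV. wt i j * (rho j k - rho i k))"
  proof -
    have "(\<Sum>k\<in>UNIV. rho l k * th l (phi i j)) =
       (if l = i then \<Sum>k\<in>UNIV. - wt i j * rho i k else 0) + (if l = j then \<Sum>k\<in>UNIV. wt i j * rho j k else 0)" for l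
      using False by (auto simp: th_phi sum_distrib_left mult.commute intro!: sum.cong)
    then show ?thesis
      by (simp add: sum.distrib[symmetric] sum.distrib right_diff_distrib sum_subtractf sum_negf)
  qed
  show ?thesis unfolding Hs_def 1 2 ..
qed (simp add: Hs_def)

text \<open>Only the coefficients \<open>rho\<close> fail to commute with \<open>th i\<close>. Their
  derivatives produce exactly the weights of the correction in \<open>Hx\<close>, which therefore
  cancels this commutator on the tuple of derivatives of one \<open>f\<close>.\<close>

lemma Hs_th: "Hs (th i f) - th i (Hs f) =
   K * (\<Sum>j\<in>UNIV. (wt i j + wt i j) * (th i f - th j f))"
proof -
  have 1: "(\<Sum>k\<in>UNIV. th k (th k (th i f))) = (\<Sum>k\<in>UNIV. th i (th k (th k f)))"
    by (simp add: th_comm[of _ i])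
  have "(\<Sum>k\<in>UNIV. \<Sum>l\<in>UNIV. rho k l * th i (th k f)) - (\<Sum>k\<in>UNIV. \<Sum>l\<in>UNIV. th i (rho k l * th k f))
     = (\<Sum>k\<in>UNIV. \<Sum>l\<in>UNIV. - th i (rho k l) * th k f)"
    by (simp add: sum_subtractf[symmetric] th_mult)
  also have "\<dots> = (\<Sum>k\<in>UNIV. \<Sum>l\<in>UNIV. (if i = k then (wt k l + wt k l) * th k f else 0)
       + (if i = l then - (wt k l + wt k l) * th k f else 0))"
    by (intro sum.cong refl) (simp add: th_rho algebra_simps)
  also have "\<dots> = (\<Sum>l\<in>UNIV. (wt i l + wt i l) * th i f) + (\<Sum>k\<in>UNIV. - (wt k i + wt k i) * th k f)"
  proof -
    have "(\<Sum>k\<in>UNIV. \<Sum>l\<in>UNIV. (if i = k then (wt k l + wt k l) * th k f else 0)) = (\<Sum>l\<in>UNIV. (wt i l + wt i l) * th i f)"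
      by (subst sum.swap) (simp add: sum.delta)
    then show ?thesis by (simp only: sum.distrib) (simp add: sum.delta)
  qed
  also have "\<dots> = (\<Sum>j\<in>UNIV. (wt i j + wt i j) * (th i f - th j f))"
    by (simp add: sum.distrib[symmetric] wt_sym[of _ i] algebra_simps)
  finally have 2: "(\<Sum>k\<in>UNIV. \<Sum>l\<in>UNIV. rho k l * th i (th k f)) - (\<Sum>k\<in>UNIV. \<Sum>l\<in>UNIV. th i (rho k l * th k f))
     = (\<Sum>j\<in>UNIV. (wt i j + wt i j) * (th i f - th j f))" .
  have "Hs (th i f) - th i (Hs f) = K * ((\<Sum>k\<in>UNIV. \<Sum>l\<in>UNIV. rho k l * th i (th k f)) - (\<Sum>k\<in>UNIV. \<Sum>l\<in>UNIV. th i (rho k l * th k f)))"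
    unfolding Hs_def by (simp add: 1 th_add th_K_mult th_sum th_comm[of _ i] algebra_simps)
  then show ?thesis using 2 by simp
qed

text \<open>The index \<open>i\<close> is split off from both sums. Its row and its column are
  grouped with the diagonal, and the remaining pairs cancel by antisymmetry.\<close>

lemma pair_sum:
  fixes S :: "'n \<Rightarrow> 'n \<Rightarrow> 'a"
  assumes "S i i = 0" "\<And>j. j \<noteq> i \<Longrightarrow> S j j + S j i + S i j = 0"
    "\<And>j k. j \<noteq> i \<Longrightarrow> k \<noteq> i \<Longrightarrow> j \<noteq> k \<Longrightarrow> S j k = - S k j"
  shows "(\<Sum>j\<in>UNIV. \<Sum>k\<in>UNIV. S j k) = 0"
proof -
  let ?A = "UNIV - {i}"
  have ins: "(\<Sum>k\<in>UNIV. f k) = f i + (\<Sum>k\<in>?A. f k)" for f :: "'n \<Rightarrow> 'a"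
    by (simp add: sum.remove)
  have "(\<Sum>j\<in>UNIV. \<Sum>k\<in>UNIV. S j k) = (\<Sum>j\<in>?A. S j i + S i j) + (\<Sum>j\<in>?A. \<Sum>k\<in>?A. S j k)"
    by (simp add: ins assms(1) sum.distrib)
  also have "(\<Sum>j\<in>?A. \<Sum>k\<in>?A. S j k) = (\<Sum>j\<in>?A. S j j) + (\<Sum>j\<in>?A. \<Sum>k\<in>?A - {j}. S j k)"
    by (simp add: sum.distrib[symmetric] sum.remove)
  also have "(\<Sum>j\<in>?A. \<Sum>k\<in>?A - {j}. S j k) = 0"
  proof -
    have "finite B \<Longrightarrow> B \<subseteq> ?A \<Longrightarrow> (\<Sum>j\<in>B. \<Sum>k\<in>B - {j}. S j k) = 0" for B
    proof (induction B rule: finite_induct)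
      case (insert b B)
      have "(\<Sum>j\<in>insert b B. \<Sum>k\<in>insert b B - {j}. S j k)
         = (\<Sum>k\<in>B. S b k) + (\<Sum>j\<in>B. \<Sum>k\<in>insert b (B - {j}). S j k)"
        using insert.hyps by (simp add: insert_Diff_if) (rule sum.cong, auto)
      also have "(\<Sum>j\<in>B. \<Sum>k\<in>insert b (B - {j}). S j k) = (\<Sum>j\<in>B. S j b + (\<Sum>k\<in>B - {j}. S j k))"
        using insert.hyps by (intro sum.cong refl) auto
      also have "\<dots> = (\<Sum>j\<in>B. S j b)"
        using insert by (simp add: sum.distrib)
      also have "(\<Sum>k\<in>B. S b k) = (\<Sum>k\<in>B. - S k b)"
        using insert by (intro sum.cong refl assms(3)) auto
      finally show ?case by (simp add: sum_negf)
    qed simp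
    then show ?thesis by simp
  qed
  finally have "(\<Sum>j\<in>UNIV. \<Sum>k\<in>UNIV. S j k) = (\<Sum>j\<in>?A. S j j + S j i + S i j)"
    by (simp add: sum.distrib algebra_simps)
  also have "\<dots> = 0"
    using assms(2) by simp
  finally show ?thesis .
qed

text \<open>The interaction part of the Lax equation. Its summand is antisymmetric in \<open>j, k\<close> off the
  diagonals; the terms with \<open>k = j\<close>, \<open>k = i\<close> or \<open>j = i\<close> cancel among themselves.\<close>

lemma lax_interaction:
  "(\<Sum>j\<in>UNIV. \<Sum>k\<in>UNIV. wt i j * (rho j k - rho i k) * (g i - g j)
     - (wt i j + wt i j) * (phi i k * (g i - g k) - phi j k * (g j - g k))
     + phi i j * ((wt i k + wt i k) * (g i - g k) - (wt j k + wt j k) * (g j - g k))) = 0"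
proof (rule pair_sum[of _ i], goal_cases)
  case (2 j)
  define p where "p = phi i j"
  have e: "phi i j = p" "phi j i = 1 - p" "rho i j = p + p - 1" "rho j i = 1 - p - p" "wt j i = wt i j"
    using 2 phi_swap[of i j] rho_anti[of j i] wt_sym[of i j] by (simp_all add: p_def algebra_simps)
  show ?case
    unfolding e coeff_diag by (simp add: algebra_simps)
next
  case (3 j k)
  then have ne: "x i - x j \<noteq> 0" "x j - x i \<noteq> 0" "x i - x k \<noteq> 0" "x k - x i \<noteq> 0" "x j - x k \<noteq> 0" "x k - x j \<noteq> 0"
    by simp_all
  have e: "x k - x j = - (x j - x k)" "x j - x i = - (x i - x j)" "x k - x i = - (x i - x k)"
    by simp_all
  \<comment> \<open>Two of the three differences determine the third, which keeps the common
    denominator small.\<close>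
  define u v where "u = x i - x j" and "v = x i - x k"
  have uv: "x j = x i - u" "x k = x i - v" by (simp_all add: u_def v_def)
  have ne: "u \<noteq> 0" "v \<noteq> 0" "v - u \<noteq> 0" "u - v \<noteq> 0"
    using ne by (simp_all add: u_def v_def)
  show ?case
    unfolding phi_def rho_def wt_def uv
    using ne apply (simp add: divide_simps)
    apply (simp add: algebra_simps)
    done
qed simp

lemma lax_equation: "Hx (Lx g) i = Lx (Hx g) i"
proof -
  define d where "d j k = g j - g k" for j k
  let ?W = "\<lambda>j k. wt j k + wt j k"
  let ?base = "th i (Hs (g i)) + K * (\<Sum>j\<in>UNIV. phi i j * Hs (d i j))"
  \<comment> \<open>The terms of \<open>Hx (Lx g)\<close> (letter A) and \<open>Lx (Hx g)\<close>
    (letter B) beyond the common \<open>?base\<close>, sorted by explicit powers of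
    \<open>K\<close>: index 1 for \<open>K\<close>, index 2 for \<open>K * K\<close>.\<close>
  let ?A1 = "\<lambda>j. ?W i j * (th i (g i) - th j (g i)) + (rho i j * wt i j + rho i j * wt i j) * d i j
      + ?W i j * (th j (d i j) - th i (d i j)) - ?W i j * (th i (g i) - th j (g j))"
  let ?A2 = "\<lambda>j k. wt i j * (rho j k - rho i k) * d i j - ?W i j * (phi i k * d i k - phi j k * d j k)"
  let ?B1 = "\<lambda>j. (rho i j * wt i j + rho i j * wt i j) * d i j - ?W i j * th i (d i j)"
  let ?B2 = "\<lambda>j k. phi i j * (?W i k * d i k - ?W j k * d j k)"
  have Hphi: "Hs (phi i j * d i j) = (rho i j * wt i j + rho i j * wt i j) * d i j
      + K * (\<Sum>k\<in>UNIV. wt i j * (rho j k - rho i k) * d i j) + phi i j * Hs (d i j)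
      + ?W i j * (th j (d i j) - th i (d i j))" for j
  proof (cases "i = j")
    case False
    have "th k (phi i j) * th k (d i j) + th k (phi i j) * th k (d i j)
      = (if k = i then - (?W i j * th i (d i j)) else 0) + (if k = j then ?W i j * th j (d i j) else 0)" for k
      using False by (auto simp: th_phi algebra_simps)
    then have "(\<Sum>k\<in>UNIV. th k (phi i j) * th k (d i j) + th k (phi i j) * th k (d i j))
       = ?W i j * (th j (d i j) - th i (d i j))"
      by (simp add: sum.distrib right_diff_distrib)
    then show ?thesis
      unfolding Hs_mult Hs_phi by (simp add: distrib_right sum_distrib_right mult.assoc)
  qed (simp add: d_def)
  have "Hx (Lx g) i = Hs (th i (g i)) + K * (\<Sum>j\<in>UNIV. Hs (phi i j * d i j)) - K * (\<Sum>j\<in>UNIV. ?W i j * (Lx g i - Lx g j))"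
    by (simp add: Hx_def Lx_def Hs_add Hs_K Hs_sum d_def)
  also have "Hs (th i (g i)) = th i (Hs (g i)) + K * (\<Sum>j\<in>UNIV. ?W i j * (th i (g i) - th j (g i)))"
    using Hs_th[of i "g i"] by (simp add: algebra_simps)
  also have "(\<Sum>j\<in>UNIV. ?W i j * (Lx g i - Lx g j)) = (\<Sum>j\<in>UNIV. ?W i j * (th i (g i) - th j (g j)))
     + K * (\<Sum>j\<in>UNIV. \<Sum>k\<in>UNIV. ?W i j * (phi i k * d i k - phi j k * d j k))"
    by (simp add: Lx_def d_def sum_distrib_left right_diff_distrib distrib_left sum.distrib sum_subtractf mult.left_commute)
       (simp add: algebra_simps sum.distrib sum_subtractf)?
  finally have L: "Hx (Lx g) i = ?base + K * (\<Sum>j\<in>UNIV. ?A1 j) + K * (K * (\<Sum>j\<in>UNIV. \<Sum>k\<in>UNIV. ?A2 j k))"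
    unfolding Hphi by (simp only: sum.distrib sum_subtractf distrib_left right_diff_distrib sum_distrib_left[symmetric])
      (simp add: algebra_simps)
  have R: "Lx (Hx g) i = ?base + K * (\<Sum>j\<in>UNIV. ?B1 j) - K * (K * (\<Sum>j\<in>UNIV. \<Sum>k\<in>UNIV. ?B2 j k))"
  proof -
    have "th i (Hx g i) = th i (Hs (g i)) - K * (\<Sum>j\<in>UNIV. th i (?W i j * d i j))"
      by (simp add: Hx_def th_diff th_K_mult th_sum d_def)
    also have "(\<Sum>j\<in>UNIV. th i (?W i j * d i j)) = (\<Sum>j\<in>UNIV. - ?B1 j)"
    proof (intro sum.cong refl)
      fix j
      have "th i (wt i j) = - (rho i j * wt i j)"
        by (simp add: th_wt)
      then show "th i (?W i j * d i j) = - ?B1 j"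
        by (simp add: th_mult th_add algebra_simps)
    qed
    finally have 1: "th i (Hx g i) = th i (Hs (g i)) + K * (\<Sum>j\<in>UNIV. ?B1 j)"
      by (simp only: sum_negf) simp
    have "(\<Sum>j\<in>UNIV. phi i j * (Hx g i - Hx g j)) =
        (\<Sum>j\<in>UNIV. phi i j * Hs (d i j) - K * (\<Sum>k\<in>UNIV. ?B2 j k))"
      by (intro sum.cong refl)
        (simp add: Hx_def d_def Hs_diff sum_subtractf right_diff_distrib sum_distrib_left mult.left_commute)
    then show ?thesis
      unfolding Lx_def[of "Hx g"] 1
      by (simp only: sum_subtractf sum_distrib_left[symmetric]) (simp add: algebra_simps)
  qed
  have "(\<Sum>j\<in>UNIV. ?A1 j) = (\<Sum>j\<in>UNIV. ?B1 j)"
    by (intro sum.cong refl) (simp add: d_def th_diff algebra_simps)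
  moreover have "(\<Sum>j\<in>UNIV. \<Sum>k\<in>UNIV. ?A2 j k) = - (\<Sum>j\<in>UNIV. \<Sum>k\<in>UNIV. ?B2 j k)"
    unfolding eq_neg_iff_add_eq_0
    using lax_interaction[of i g] by (simp add: d_def sum.distrib[symmetric])
  ultimately show ?thesis
    unfolding L R by (simp only: mult_minus_right diff_conv_add_uminus)
qed

text \<open>The commutator of L with the diagonal matrix X^-1. The \<open>-1\<close> comes from
  differentiating 1/x_i. The last sum is a rank-one term, which the all-ones matrix in
  \<open>Qx\<close> is going to cancel.\<close>

lemma Lx_inverse:
  "Lx (\<lambda>j. g j / x j) i = Lx g i / x i + (K - 1) * (g i / x i) - K * (\<Sum>j\<in>UNIV. g j / x j)"
proof -
  have "phi i j * (g i / x i - g j / x j) = phi i j * (g i - g j) / x i - (if j = i then 0 else g j / x j)" for j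
  proof (cases "i = j")
    case False
    then have "x i - x j \<noteq> 0" "x j - x i \<noteq> 0" by simp_all
    then show ?thesis using False by (simp add: phi_def divide_simps) (simp add: algebra_simps)?
  qed simp
  then have "(\<Sum>j\<in>UNIV. phi i j * (g i / x i - g j / x j)) =
     (\<Sum>j\<in>UNIV. phi i j * (g i - g j)) / x i - ((\<Sum>j\<in>UNIV. g j / x j) - g i / x i)"
    by (simp add: sum_subtractf sum_divide_distrib sum.If_cases sum.remove[of UNIV i] Diff_eq)
  moreover have "th i (g i / x i) = th i (g i) / x i - g i / x i"
    by (simp add: th_divide th_x field_simps)
  ultimately show ?thesis
    unfolding Lx_def by (simp only:) (simp add: algebra_simps add_divide_distrib diff_divide_distrib)
qed

lemma th_inverse_x: "th k (1 / x i) = (if k = i then - (1 / x i) else 0)"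
  by (simp add: th_divide th_x)

text \<open>The second derivatives of 1/x_i contribute the \<open>1\<close> and each index other
  than \<open>i\<close> contributes \<open>K\<close>. The first-order terms and the interaction
  combine to \<open>Lx g i\<close>.\<close>

lemma Hx_inverse:
  "Hx (\<lambda>j. g j / x j) i = Hx g i / x i - 2 * (Lx g i / x i) + (1 + K * (of_nat (card (UNIV :: 'n set)) - 1)) * (g i / x i)"
proof -
  have "(\<Sum>l\<in>UNIV. \<Sum>k\<in>UNIV. rho l k * th l (1 / x i)) = (\<Sum>l\<in>UNIV. if l = i then - (\<Sum>k\<in>UNIV. rho l k) / x i else 0)"
    by (intro sum.cong refl) (simp add: th_inverse_x sum_divide_distrib sum_negf)
  then have h1: "Hs (1 / x i) = 1 / x i - K * (\<Sum>j\<in>UNIV. rho i j) / x i"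
    unfolding Hs_def by (simp add: th_inverse_x th_minus if_distrib[of "th _"] cong: if_cong)
  have "th k (g i) * th k (1 / x i) + th k (g i) * th k (1 / x i) = (if k = i then - 2 * (th i (g i) / x i) else 0)" for k
    by (simp add: th_inverse_x)
  then have "Hs (g i * (1 / x i)) = Hs (g i) / x i + g i * (1 / x i - K * (\<Sum>j\<in>UNIV. rho i j) / x i) - 2 * (th i (g i) / x i)"
    unfolding Hs_mult h1 by simp
  then have h2: "Hs (g i / x i) = Hs (g i) / x i + g i * (1 / x i - K * (\<Sum>j\<in>UNIV. rho i j) / x i) - 2 * (th i (g i) / x i)"
    by simp
  have "- (rho i j * g i / x i) - (wt i j + wt i j) * (g i / x i - g j / x j) =
      - ((wt i j + wt i j) * (g i - g j) / x i) - 2 * (phi i j * (g i - g j) / x i) + (if j = i then 0 else g i / x i)" for j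
  proof (cases "i = j")
    case False
    define d where "d = x i - x j"
    have d: "x i = x j + d" and nz: "d \<noteq> 0" "x j + d \<noteq> 0"
      using False x_nz[of i] by (simp_all add: d_def)
    show ?thesis using False nz
      by (simp add: phi_def wt_def rho_def d divide_simps) (simp add: algebra_simps)?
  qed simp
  then have "(\<Sum>j\<in>UNIV. - (rho i j * g i / x i) - (wt i j + wt i j) * (g i / x i - g j / x j)) =
    (\<Sum>j\<in>UNIV. - ((wt i j + wt i j) * (g i - g j) / x i) - 2 * (phi i j * (g i - g j) / x i) + (if j = i then 0 else g i / x i))"
    by simp
  also have "\<dots> = - ((\<Sum>j\<in>UNIV. (wt i j + wt i j) * (g i - g j)) / x i) - 2 * ((\<Sum>j\<in>UNIV. phi i j * (g i - g j)) / x i)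
      + (of_nat (card (UNIV :: 'n set)) - 1) * (g i / x i)"
  proof -
    have "(\<Sum>j\<in>UNIV. if j = i then 0 else g i / x i) = of_nat (card (UNIV - {i})) * (g i / x i)"
      by (simp add: sum.remove[of UNIV i])
    also have "of_nat (card (UNIV - {i})) = (of_nat (card (UNIV :: 'n set)) - 1 :: 'a)"
      by (simp add: of_nat_diff Suc_le_eq card_gt_0_iff)
    finally show ?thesis
      by (simp add: sum.distrib sum_subtractf sum_negf sum_divide_distrib sum_distrib_left)
  qed
  finally have "- ((\<Sum>j\<in>UNIV. rho i j) * g i / x i) - (\<Sum>j\<in>UNIV. (wt i j + wt i j) * (g i / x i - g j / x j)) =
     - ((\<Sum>j\<in>UNIV. (wt i j + wt i j) * (g i - g j)) / x i) - 2 * ((\<Sum>j\<in>UNIV. phi i j * (g i - g j)) / x i)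
      + (of_nat (card (UNIV :: 'n set)) - 1) * (g i / x i)"
    by (simp only: sum_subtractf sum_negf sum_distrib_right sum_divide_distrib)
  then have e: "(\<Sum>j\<in>UNIV. (wt i j + wt i j) * (g i / x i - g j / x j)) = 
     - ((\<Sum>j\<in>UNIV. rho i j) * g i / x i) + ((\<Sum>j\<in>UNIV. (wt i j + wt i j) * (g i - g j)) / x i) + 2 * ((\<Sum>j\<in>UNIV. phi i j * (g i - g j)) / x i)
      - (of_nat (card (UNIV :: 'n set)) - 1) * (g i / x i)"
    by algebra
  show ?thesis
    unfolding Hx_def Lx_def e h2
    by (simp add: algebra_simps add_divide_distrib diff_divide_distrib)
qed

section \<open>Commutators with the lowering operator \<open>Em\<close> and the Euler operator
  \<open>Es\<close>\<close>

lemma Em_add: "Em (u + v) = Em u + Em v"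
  by (simp add: Em_def th_add sum.distrib add_divide_distrib)

lemma Em_0 [simp]: "Em 0 = 0"
  by (simp add: Em_def)

lemma Em_mult: "Em (u * v) = Em u * v + u * Em v"
  by (simp add: Em_def th_mult sum.distrib add_divide_distrib sum_distrib_left sum_distrib_right algebra_simps)

lemma Em_K [simp]: "Em K = 0"
  by (simp add: Em_def)

lemma Em_diff: "Em (u - v) = Em u - Em v"
  using Em_add[of "u - v" v] by simp

lemma Em_sum: "Em (sum f A) = (\<Sum>j\<in>A. Em (f j))"
  by (induction A rule: infinite_finite_induct) (auto simp: Em_add)

lemma Em_th: "Em (th i u) = th i (Em u) + th i u / x i"
proof -
  have "th i (th k u / x k) = th k (th i u) / x k - (if k = i then th i u / x i else 0)" for k
    by (simp add: th_divide th_x th_comm[of i k] field_simps)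
  then show ?thesis
    unfolding Em_def by (simp add: th_sum sum_subtractf)
qed

lemma Em_phi: "Em (phi i j) = phi i j / x i"
proof (cases "i = j")
  case False
  have "th k (phi i j) / x k = (if k = i then - wt i j / x i else 0) + (if k = j then wt i j / x j else 0)" for k
    using False by (auto simp: th_phi)
  then have "Em (phi i j) = - wt i j / x i + wt i j / x j"
    unfolding Em_def by (simp add: sum.distrib)
  also have "\<dots> = phi i j / x i"
  proof -
    define d where "d = x i - x j"
    have d: "x i = x j + d" and nz: "d \<noteq> 0" "x j + d \<noteq> 0"
      using False x_nz[of i] by (simp_all add: d_def)
    show ?thesis using False nz
      by (simp add: phi_def wt_def d divide_simps) (simp add: algebra_simps)?
  qed
  finally show ?thesis .
qed simp

text \<open>Commuting \<open>Em\<close> past \<open>th i\<close> and applying it to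
  \<open>phi i j\<close> both give the same factor 1/x_i, so the extra terms assemble to L
  again.\<close>

lemma Em_Lx: "Em (Lx g i) = Lx (\<lambda>j. Em (g j)) i + Lx g i / x i"
  by (simp add: Lx_def Em_add Em_mult Em_sum Em_th Em_phi Em_diff sum.distrib distrib_left add_divide_distrib)
    (simp only: sum_divide_distrib[symmetric] times_divide_eq_right)

lemma Es_add: "Es (u + v) = Es u + Es v"
  by (simp add: Es_def th_add sum.distrib)

lemma Es_mult: "Es (u * v) = Es u * v + u * Es v"
  by (simp add: Es_def th_mult sum.distrib sum_distrib_left sum_distrib_right algebra_simps)

lemma Es_diff: "Es (u - v) = Es u - Es v"
  using Es_add[of "u - v" v] by simp

lemma Es_sum: "Es (sum f A) = (\<Sum>j\<in>A. Es (f j))"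
  by (induction A rule: infinite_finite_induct) (auto simp: Es_add, auto simp: Es_def)

lemma Es_Lx: "Es (Lx g i) = Lx (\<lambda>j. Es (g j)) i"
proof -
  have 1: "Es (phi i j) = 0" for j
    by (cases "i = j") (auto simp: Es_def th_phi sum.distrib)
  have 2: "Es (th i (g i)) = th i (Es (g i))"
    by (simp add: Es_def th_sum th_comm[of i])
  have 3: "Es K = 0" by (simp add: Es_def)
  show ?thesis
    by (simp add: Lx_def Es_add Es_mult Es_sum Es_diff 1 2 3)
qed

lemma Es_inverse: "Es (u / x i) = Es u / x i - u / x i"
proof -
  have "Es (1 / x i) = - (1 / x i)"
    by (simp add: Es_def th_inverse_x)
  then show ?thesis
    using Es_mult[of u "1 / x i"] by simp
qed

lemma Em_inverse: "Em (u / x i) = Em u / x i - u / x i / x i"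
proof -
  have "th k (1 / x i) / x k = (if k = i then - (1 / x i / x i) else 0)" for k
    by (simp add: th_inverse_x)
  then have "Em (1 / x i) = - (1 / x i / x i)"
    by (simp add: Em_def)
  then show ?thesis
    using Em_mult[of u "1 / x i"] by simp
qed

lemma sum_Hx: "(\<Sum>i\<in>UNIV. Hx g i) = Hs (\<Sum>i\<in>UNIV. g i)"
proof -
  have "(\<Sum>i\<in>UNIV. \<Sum>j\<in>UNIV. (wt i j + wt i j) * g j) = (\<Sum>i\<in>UNIV. \<Sum>j\<in>UNIV. (wt i j + wt i j) * g i)"
    by (subst sum.swap) (simp add: wt_sym)
  then have "(\<Sum>i\<in>UNIV. \<Sum>j\<in>UNIV. (wt i j + wt i j) * (g i - g j)) = 0"
    by (simp only: right_diff_distrib sum_subtractf) simp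
  then show ?thesis
    unfolding Hx_def Hs_sum sum_subtractf sum_distrib_left[symmetric] by simp
qed

lemma Hx_const: "Hx (\<lambda>_. f) i = Hs f"
  by (simp add: Hx_def)

section \<open>Constants of the derivations, and commutation of D^B with the matrix K\<close>

definition const :: "'a \<Rightarrow> bool" where "const c \<longleftrightarrow> (\<forall>i. th i c = 0)"

lemma const_simps [simp]: "const K" "const 0" "const 1" "const (of_nat m)"
  by (auto simp: const_def)

lemma const_arith [simp]:
  "const u \<Longrightarrow> const v \<Longrightarrow> const (u + v)"
  "const u \<Longrightarrow> const v \<Longrightarrow> const (u - v)"
  "const u \<Longrightarrow> const v \<Longrightarrow> const (u * v)"
  by (auto simp: const_def th_add th_diff th_mult)

lemma Lx_add: "Lx (\<lambda>j. g j + h j) i = Lx g i + Lx h i"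
  by (simp add: Lx_def th_add algebra_simps sum.distrib sum_subtractf)

lemma Lx_diff: "Lx (\<lambda>j. g j - h j) i = Lx g i - Lx h i"
  using Lx_add[of "\<lambda>j. g j - h j" h i] by simp

lemma Lx_scale: "const c \<Longrightarrow> Lx (\<lambda>j. c * g j) i = c * Lx g i"
  by (simp add: Lx_def th_mult const_def algebra_simps sum_distrib_left)

lemma Lx_sum: "Lx (\<lambda>j. \<Sum>m\<in>A. g m j) i = (\<Sum>m\<in>A. Lx (g m) i)"
  by (induction A rule: infinite_finite_induct) (auto simp: Lx_add, auto simp: Lx_def)

lemma Hs_scale: "const c \<Longrightarrow> Hs (c * u) = c * Hs u"
  by (simp add: Hs_mult const_def) (simp add: Hs_def const_def)

lemma Em_scale: "const c \<Longrightarrow> Em (c * u) = c * Em u"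
  by (simp add: Em_mult const_def) (simp add: Em_def)

lemma Es_scale: "const c \<Longrightarrow> Es (c * u) = c * Es u"
  by (simp add: Es_mult const_def) (simp add: Es_def)

lemma Hx_add: "Hx (\<lambda>j. g j + h j) i = Hx g i + Hx h i"
  by (simp add: Hx_def Hs_add algebra_simps sum.distrib sum_subtractf)

lemma Hx_scale: "const c \<Longrightarrow> Hx (\<lambda>j. c * g j) i = c * Hx g i"
  by (simp add: Hx_def Hs_scale algebra_simps sum_distrib_left)

definition Qx :: "'a \<Rightarrow> ('n \<Rightarrow> 'a) \<Rightarrow> 'n \<Rightarrow> 'a" where
  "Qx b g i = Lx g i + b * g i + K * (\<Sum>j\<in>UNIV. g j) + 2 * (g i / x i)"

text \<open>D^B in the notation of the locale, for the value of \<open>c\<close> in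
  \<open>DB_op_eq\<close>. \<open>Bx\<close> acts on tuples and contains the companion
  matrix.\<close>

definition Bs :: "'a \<Rightarrow> 'a \<Rightarrow> 'a" where
  "Bs c f = Hs f + c * Es f + 2 * Em f"

definition Bx :: "'a \<Rightarrow> ('n \<Rightarrow> 'a) \<Rightarrow> 'n \<Rightarrow> 'a" where
  "Bx c g i = Hx g i + c * Es (g i) + 2 * Em (g i)"

lemma const_2 [simp]: "const 2"
  using const_simps(4)[of 2] by simp

lemma Bx_Lx:
  assumes "const c"
  shows "Bx c (Lx g) i = Lx (Bx c g) i + 2 * (Lx g i / x i)"
proof -
  have "Lx (Bx c g) i = Lx (Hx g) i + c * Lx (\<lambda>j. Es (g j)) i + 2 * Lx (\<lambda>j. Em (g j)) i"
    unfolding Bx_def[abs_def] by (simp add: Lx_add Lx_scale assms)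
  then show ?thesis
    by (simp add: Bx_def lax_equation Em_Lx Es_Lx algebra_simps)
qed

text \<open>The coefficient \<open>K * n + b\<close> of \<open>Es\<close> is the one that balances
  the terms in \<open>h i / x i\<close>. The rank-one terms from \<open>Lx_inverse\<close> cancel
  against those from the all-ones part of \<open>Qx\<close>.\<close>

lemma Bx_Qx:
  assumes b: "const b"
  shows "Bx (K * of_nat (card (UNIV :: 'n set)) + b) (Qx b h) i =
    Qx b (\<lambda>j. Bx (K * of_nat (card (UNIV :: 'n set)) + b) h j - 2 * (h j / x j)) i"
proof -
  let ?n = "of_nat (card (UNIV :: 'n set)) :: 'a"
  define c where "c = K * ?n + b"
  have c: "const c" by (simp add: c_def b)
  have Hx1: "Hx (Qx b h) i = Hx (Lx h) i + b * Hx h i + K * Hs (\<Sum>j\<in>UNIV. h j) + 2 * Hx (\<lambda>j. h j / x j) i"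
    unfolding Qx_def[abs_def] by (simp add: Hx_add Hx_scale Hx_const Hs_scale b del: times_divide_eq_right)
  have "Bx c (Qx b h) i = Bx c (Lx h) i + b * Bx c h i + K * Bs c (\<Sum>j\<in>UNIV. h j)
     + 2 * (Hx (\<lambda>j. h j / x j) i + c * Es (h i / x i) + 2 * Em (h i / x i))"
    unfolding Bx_def Hx1 Bs_def
    by (simp add: Qx_def Es_add Em_add Es_scale Em_scale b algebra_simps del: times_divide_eq_right times_divide_eq_left)
  also have "Bs c (\<Sum>j\<in>UNIV. h j) = (\<Sum>j\<in>UNIV. Bx c h j)"
    by (simp add: Bs_def Bx_def sum.distrib sum_Hx Es_sum Em_sum sum_distrib_left)
  finally have L: "Bx c (Qx b h) i = Lx (Bx c h) i + 2 * (Lx h i / x i) + b * Bx c h i + K * (\<Sum>j\<in>UNIV. Bx c h j)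
     + 2 * (Hx h i / x i - 2 * (Lx h i / x i) + (1 + K * (?n - 1)) * (h i / x i) + c * (Es (h i) / x i - h i / x i)
       + 2 * (Em (h i) / x i - h i / x i / x i))"
    by (simp only: Bx_Lx[OF c] Hx_inverse Es_inverse Em_inverse)
  have R: "Qx b (\<lambda>j. Bx c h j - 2 * (h j / x j)) i = Lx (Bx c h) i
     - 2 * (Lx h i / x i + (K - 1) * (h i / x i) - K * (\<Sum>j\<in>UNIV. h j / x j))
     + b * (Bx c h i - 2 * (h i / x i)) + K * ((\<Sum>j\<in>UNIV. Bx c h j) - 2 * (\<Sum>j\<in>UNIV. h j / x j))
     + 2 * ((Bx c h i - 2 * (h i / x i)) / x i)"
    unfolding Qx_def by (simp add: Lx_diff Lx_scale Lx_inverse sum_subtractf sum_distrib_left del: times_divide_eq_right)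
  have "Bx c (Qx b h) i - Qx b (\<lambda>j. Bx c h j - 2 * (h j / x j)) i = 0"
    unfolding L R by (simp add: Bx_def c_def algebra_simps add_divide_distrib diff_divide_distrib)
  then show ?thesis
    by (simp add: c_def)
qed

definition Kx :: "'a \<Rightarrow> ('n \<Rightarrow> 'a) \<Rightarrow> 'n \<Rightarrow> 'a" where
  "Kx b g = Qx b (Lx g)"

text \<open>\<open>Bx_Lx\<close> produces an extra 2 X^-1 L, and \<open>Bx_Qx\<close> takes it away
  again.\<close>

lemma Bx_Kx:
  assumes b: "const b"
  shows "Bx (K * of_nat (card (UNIV :: 'n set)) + b) (Kx b g) = Kx b (Bx (K * of_nat (card (UNIV :: 'n set)) + b) g)"
proof
  fix i
  have "const (K * of_nat (card (UNIV :: 'n set)) + b)"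
    by (simp add: b)
  from Bx_Lx[OF this] show "Bx (K * of_nat (card (UNIV :: 'n set)) + b) (Kx b g) i = Kx b (Bx (K * of_nat (card (UNIV :: 'n set)) + b) g) i"
    unfolding Kx_def Bx_Qx[OF b] by simp
qed

lemma Bs_commute:
  assumes b: "const b"
  defines "c \<equiv> K * of_nat (card (UNIV :: 'n set)) + b"
  shows "Bs c (\<Sum>i\<in>UNIV. (Kx b ^^ d) (\<lambda>_. f) i) = (\<Sum>i\<in>UNIV. (Kx b ^^ d) (\<lambda>_. Bs c f) i)"
proof -
  have "Bx c ((Kx b ^^ d) g) = (Kx b ^^ d) (Bx c g)" for g
    by (induction d) (simp_all add: Bx_Kx[OF b] c_def)
  moreover have "Bx c (\<lambda>_. f) = (\<lambda>_. Bs c f)"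
    by (simp add: Bx_def[abs_def] Bs_def Hx_const)
  moreover have "Bs c (\<Sum>i\<in>UNIV. h i) = (\<Sum>i\<in>UNIV. Bx c h i)" for h
    by (simp add: Bs_def Bx_def sum.distrib sum_Hx Es_sum Em_sum sum_distrib_left)
  ultimately show ?thesis by simp
qed

section \<open>Moments of the Lax matrix and their commutators\<close>

lemma Hx_Lx_pow: "Hx ((Lx ^^ k) g) = (Lx ^^ k) (Hx g)"
  by (induction k) (auto simp: lax_equation)

lemma Hs_moment: "Hs (\<Sum>i\<in>UNIV. (Lx ^^ k) (\<lambda>_. f) i) = (\<Sum>i\<in>UNIV. (Lx ^^ k) (\<lambda>_. Hs f) i)"
proof -
  have "Hx (\<lambda>_. f) = (\<lambda>_. Hs f)"
    by (rule ext) (simp add: Hx_def)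
  then show ?thesis
    by (simp add: sum_Hx[symmetric] Hx_Lx_pow)
qed

text \<open>The operators 1^T L^k X^-1 L^m 1. They arise when \<open>Em\<close> is commuted past a
  moment of L, see \<open>Em_moment\<close>.\<close>

definition Mx :: "nat \<Rightarrow> nat \<Rightarrow> 'a \<Rightarrow> 'a" where
  "Mx k m f = (\<Sum>i\<in>UNIV. (Lx ^^ k) (\<lambda>j. (Lx ^^ m) (\<lambda>_. f) j / x j) i)"

lemma Lx_pow_add: "(Lx ^^ k) (\<lambda>j. g j + h j) i = (Lx ^^ k) g i + (Lx ^^ k) h i"
proof (induction k arbitrary: i)
  case (Suc k)
  have "(Lx ^^ k) (\<lambda>j. g j + h j) = (\<lambda>i. (Lx ^^ k) g i + (Lx ^^ k) h i)"
    using Suc by auto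
  then show ?case by (simp add: Lx_add)
qed simp

lemma Lx_pow_scale: "const c \<Longrightarrow> (Lx ^^ k) (\<lambda>j. c * g j) i = c * (Lx ^^ k) g i"
proof (induction k arbitrary: i)
  case (Suc k)
  then have "(Lx ^^ k) (\<lambda>j. c * g j) = (\<lambda>i. c * (Lx ^^ k) g i)"
    by auto
  with Suc show ?case by (simp add: Lx_scale)
qed simp

lemma const_uminus [simp]: "const u \<Longrightarrow> const (- u)"
  by (auto simp: const_def th_minus)

text \<open>One factor L is moved across X^-1. The all-ones matrix in \<open>Lx_inverse\<close> cuts
  the product into a moment of L applied to \<open>Mx 0 m f\<close>.\<close>

lemma Mx_Suc:
  "Mx (Suc k) m f = Mx k (Suc m) f + (K - 1) * Mx k m f - K * (\<Sum>i\<in>UNIV. (Lx ^^ k) (\<lambda>_. Mx 0 m f) i)"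
proof -
  let ?g = "(Lx ^^ m) (\<lambda>_. f)"
  have "Lx (\<lambda>j. ?g j / x j) = (\<lambda>i. (Lx ?g i / x i + (K - 1) * (?g i / x i)) + (- K) * (\<Sum>j\<in>UNIV. ?g j / x j))"
    by (auto simp: Lx_inverse)
  then have "(Lx ^^ Suc k) (\<lambda>j. ?g j / x j) i = (Lx ^^ k) (\<lambda>j. Lx ?g j / x j) i
      + (K - 1) * (Lx ^^ k) (\<lambda>j. ?g j / x j) i + (- K) * (Lx ^^ k) (\<lambda>_. \<Sum>j\<in>UNIV. ?g j / x j) i" for i
    by (simp only: funpow_Suc_right o_apply Lx_pow_add Lx_pow_scale const_uminus const_arith const_simps)
  then show ?thesis
    unfolding Mx_def by (simp add: sum.distrib sum_subtractf sum_distrib_left sum_negf del: funpow.simps(2)) simp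
qed

text \<open>To be read as a recursion for \<open>Mx 0 (Suc m)\<close>: commutators with
  \<open>Hs\<close> generate these operators from \<open>Em\<close>, which is
  \<open>Mx 0 1\<close>.\<close>

lemma Hs_Mx:
  "Hs (Mx 0 m f) = Mx 0 m (Hs f) - 2 * Mx 0 (Suc m) f + (1 + K * (of_nat (card (UNIV :: 'n set)) - 1)) * Mx 0 m f"
proof -
  have e: "Hx (\<lambda>_. f) = (\<lambda>_. Hs f)"
    by (rule ext) (simp add: Hx_def)
  show ?thesis
    by (simp add: Mx_def sum_Hx[symmetric] Hx_inverse Hx_Lx_pow e sum.distrib sum_subtractf sum_distrib_left)
qed

text \<open>The product rule for L^k: by \<open>Em_Lx\<close> each factor L in turn becomes X^-1
  L.\<close>

lemma Em_moment:
  "Em (\<Sum>i\<in>UNIV. (Lx ^^ k) (\<lambda>_. f) i) = (\<Sum>i\<in>UNIV. (Lx ^^ k) (\<lambda>_. Em f) i) + (\<Sum>j<k. Mx j (k - j) f)"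
proof -
  let ?X = "\<lambda>g j. g j / x j"
  have "Em ((Lx ^^ k) h i) = (Lx ^^ k) (\<lambda>j. Em (h j)) i + (\<Sum>j<k. (Lx ^^ j) (?X ((Lx ^^ (k - j)) h)) i)" for h i
  proof (induction k arbitrary: i)
    case (Suc k)
    have IH: "(\<lambda>i. Em ((Lx ^^ k) h i)) = (\<lambda>i. (Lx ^^ k) (\<lambda>j. Em (h j)) i + (\<Sum>j<k. (Lx ^^ j) (?X ((Lx ^^ (k - j)) h)) i))"
      using Suc by auto
    have "Em ((Lx ^^ Suc k) h i) = Lx (\<lambda>j. Em ((Lx ^^ k) h j)) i + (Lx ^^ Suc k) h i / x i"
      by (simp add: Em_Lx)
    also have "\<dots> = (Lx ^^ Suc k) (\<lambda>j. Em (h j)) i + (\<Sum>j<k. (Lx ^^ Suc j) (?X ((Lx ^^ (k - j)) h)) i) + (Lx ^^ Suc k) h i / x i"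
      unfolding IH by (simp add: Lx_add Lx_sum)
    finally show ?case
      by (simp only: sum.lessThan_Suc_shift diff_Suc_Suc) simp
  qed simp
  then show ?thesis
    unfolding Em_sum Mx_def by (simp add: sum.distrib) (rule sum.swap)
qed

lemma Lx_const: "Lx (\<lambda>_. f) i = th i f"
  by (simp add: Lx_def)

lemma Em_eq_Mx: "Em f = Mx 0 1 f"
  by (simp add: Em_def Mx_def Lx_const)

lemma Es_moment: "Es f = (\<Sum>i\<in>UNIV. Lx (\<lambda>_. f) i)"
  by (simp add: Es_def Lx_const)

text \<open>Interchanging the summation indices replaces \<open>phi i j\<close> by
  \<open>phi i j - phi j i\<close>, which is \<open>rho i j\<close>.\<close>

lemma Hs_moment2: "Hs f = (\<Sum>i\<in>UNIV. Lx (Lx (\<lambda>_. f)) i)"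
proof -
  have "(\<Sum>i\<in>UNIV. \<Sum>j\<in>UNIV. phi i j * (th i f - th j f)) =
     (\<Sum>i\<in>UNIV. \<Sum>j\<in>UNIV. phi i j * th i f) - (\<Sum>i\<in>UNIV. \<Sum>j\<in>UNIV. phi i j * th j f)"
    by (simp add: right_diff_distrib sum_subtractf)
  also have "(\<Sum>i\<in>UNIV. \<Sum>j\<in>UNIV. phi i j * th j f) = (\<Sum>i\<in>UNIV. \<Sum>j\<in>UNIV. phi j i * th i f)"
    by (rule sum.swap)
  also have "(\<Sum>i\<in>UNIV. \<Sum>j\<in>UNIV. phi i j * th i f) - (\<Sum>i\<in>UNIV. \<Sum>j\<in>UNIV. phi j i * th i f)
      = (\<Sum>i\<in>UNIV. \<Sum>j\<in>UNIV. rho i j * th i f)"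
  proof -
    have "phi i j - phi j i = rho i j" for i j
      using phi_swap(2)[of i j] by (cases "i = j") auto
    then show ?thesis
      by (simp add: sum_subtractf[symmetric] left_diff_distrib[symmetric])
  qed
  finally have e: "(\<Sum>i\<in>UNIV. \<Sum>j\<in>UNIV. phi i j * (th i f - th j f)) = (\<Sum>i\<in>UNIV. \<Sum>j\<in>UNIV. rho i j * th i f)" .
  have "(\<Sum>i\<in>UNIV. Lx (Lx (\<lambda>_. f)) i) = (\<Sum>i\<in>UNIV. th i (th i f)) + K * (\<Sum>i\<in>UNIV. \<Sum>j\<in>UNIV. phi i j * (th i f - th j f))"
    by (simp add: Lx_def[of "Lx _"] Lx_const sum.distrib sum_distrib_left)
  then show ?thesis
    unfolding e Hs_def by simp
qed

end

section \<open>Constants, polynomials and derivations in the field of rational functions\<close>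

lemma rconst_add: "rconst (c + d) = rconst c + rconst d"
  by (simp add: rconst_def rpoly_def mconst_def single_add)

lemma rpoly_add: "rpoly (p + q) = rpoly p + rpoly q"
  by (simp add: rpoly_def)

lemma rpoly_mult: "rpoly (p * q) = rpoly p * rpoly q"
  by (simp add: rpoly_def)

lemma rpoly_diff: "rpoly (p - q) = rpoly p - rpoly q"
  by (simp add: rpoly_def)

lemma rpoly_0 [simp]: "rpoly 0 = 0"
  by (simp add: rpoly_def Zero_fract_def)

lemma rpoly_1 [simp]: "rpoly 1 = 1"
  by (simp add: rpoly_def One_fract_def)

lemma rpoly_eq_iff [simp]: "rpoly p = rpoly q \<longleftrightarrow> p = q"
  by (simp add: rpoly_def eq_fract)

lemma rpoly_eq_0_iff [simp]: "rpoly p = 0 \<longleftrightarrow> p = 0"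
  using rpoly_eq_iff[of p 0] by simp

lemma rpoly_sum: "rpoly (sum f A) = (\<Sum>i\<in>A. rpoly (f i))"
  by (induction A rule: infinite_finite_induct) (auto simp: rpoly_add)

lemma mconst_mult: "mconst (c * d) = mconst c * mconst d"
  by (simp add: mconst_def mult_single)

lemma mconst_add: "mconst (c + d) = mconst c + mconst d"
  by (simp add: mconst_def single_add)

lemma mconst_diff: "mconst (c - d) = mconst c - mconst d"
  by (simp add: mconst_def single_diff)

lemma mconst_0 [simp]: "mconst 0 = 0" and mconst_1 [simp]: "mconst 1 = 1"
  by (simp_all add: mconst_def)

lemma mconst_eq_0 [simp]: "mconst c = 0 \<longleftrightarrow> c = 0"
  by (metis mconst_def lookup_single_eq lookup_zero single_zero)

lemma rconst_mult: "rconst (c * d) = rconst c * rconst d"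
  by (simp add: rconst_def mconst_mult rpoly_mult)

lemma rconst_diff: "rconst (c - d) = rconst c - rconst d"
  by (simp add: rconst_def mconst_diff rpoly_diff)

lemma rconst_0 [simp]: "rconst 0 = 0" and rconst_1 [simp]: "rconst 1 = 1"
  by (simp_all add: rconst_def)

lemma rconst_of_nat: "rconst (of_nat m) = of_nat m"
  by (induction m) (auto simp: rconst_add)

lemma rconst_2 [simp]: "rconst 2 = 2"
  using rconst_of_nat[of 2] by simp

lemma rderiv_add: "rderiv i (u + v) = rderiv i u + rderiv i v"
proof -
  obtain p q where u: "u = Fract p q" "q \<noteq> 0" by (rule Fract_cases)
  obtain r s where v: "v = Fract r s" "s \<noteq> 0" by (rule Fract_cases)
  show ?thesis
    using u(2) v(2) by (simp add: u(1) v(1) rderiv_Fract mderiv_add mderiv_mult eq_fract) (simp add: algebra_simps)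
qed

lemma rderiv_mult: "rderiv i (u * v) = rderiv i u * v + u * rderiv i v"
proof -
  obtain p q where u: "u = Fract p q" "q \<noteq> 0" by (rule Fract_cases)
  obtain r s where v: "v = Fract r s" "s \<noteq> 0" by (rule Fract_cases)
  show ?thesis
    using u(2) v(2) by (simp add: u(1) v(1) rderiv_Fract mderiv_add mderiv_mult eq_fract) (simp add: algebra_simps)
qed

lemma mderiv_comm: "mderiv i (mderiv j p) = mderiv j (mderiv i p)"
proof -
  have *: "mderiv i (mderiv j (single k c)) = mderiv j (mderiv i (single k c))" for k and c :: real
  proof (cases "i = j")
    case False
    have "k - single j (1::nat) - single i 1 = k - single i 1 - single j 1"
      by (rule poly_mapping_eqI) (simp add: lookup_minus)
    with False show ?thesis
      by (simp add: mderiv_single lookup_minus lookup_single when_def mult.left_commute)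
  qed simp
  show ?thesis
    by (subst (1 2) mpoly_sum_monomials[of p]) (simp add: mderiv_sum *)
qed

lemma mderiv_one [simp]: "mderiv i 1 = 0"
  using mderiv_single[of i 0 "1::real"] by simp

lemma mderiv_mconst [simp]: "mderiv i (mconst c) = 0"
  by (simp add: mconst_def mderiv_single)

lemma mderiv_mvar: "mderiv i (mvar j) = (if i = j then 1 else 0)"
  by (simp add: mvar_def mderiv_single lookup_single when_def)

lemma mderiv_diff: "mderiv i (p - q) = mderiv i p - mderiv i q"
  using mderiv_add[of i "p - q" q] by simp

lemma rderiv_rpoly: "rderiv i (rpoly p) = rpoly (mderiv i p)"
  by (simp add: rpoly_def rderiv_Fract)

lemma rderiv_comm: "rderiv i (rderiv j u) = rderiv j (rderiv i u)"
proof -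
  obtain p q where u: "u = Fract p q" "q \<noteq> 0" by (rule Fract_cases)
  then show ?thesis
    by (simp add: rderiv_Fract mderiv_diff mderiv_mult eq_fract mderiv_comm[of j i]) (simp add: algebra_simps)
qed

lemma rderiv_rconst [simp]: "rderiv i (rconst c) = 0"
  by (simp add: rconst_def rderiv_rpoly)

lemma rderiv_rvar: "rderiv i (rvar j) = (if i = j then 1 else 0)"
  by (simp add: rvar_def rderiv_rpoly mderiv_mvar)

lemma mvar_eq_iff [simp]: "mvar i = mvar j \<longleftrightarrow> i = j"
proof
  assume "mvar i = mvar j"
  then have "mderiv i (mvar i) = mderiv i (mvar j)"
    by simp
  then show "i = j"
    by (simp add: mderiv_mvar split: if_splits)
qed simp

lemma mvar_nz [simp]: "mvar i \<noteq> 0"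
  using mderiv_mvar[of i i] by auto

lemma rvar_eq_iff [simp]: "rvar i = rvar j \<longleftrightarrow> i = j"
  by (simp add: rvar_def)

lemma rvar_nz [simp]: "rvar i \<noteq> 0"
  by (simp add: rvar_def)

section \<open>The operators as matrix moments\<close>

interpretation lx: lax "rvar :: 'n::{finite,linorder} \<Rightarrow> 'n ratfun" "\<lambda>i f. rvar i * rderiv i f" "rconst \<kappa>" for \<kappa>
proof
  fix i j :: 'n and u v :: "'n ratfun"
  show "rvar i * rderiv i (u + v) = rvar i * rderiv i u + rvar i * rderiv i v"
    by (simp add: rderiv_add algebra_simps)
  show "rvar i * rderiv i (u * v) = rvar i * rderiv i u * v + u * (rvar i * rderiv i v)"
    by (simp add: rderiv_mult algebra_simps)
  show "rvar i * rderiv i (rvar j * rderiv j u) = rvar j * rderiv j (rvar i * rderiv i u)"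
    by (cases "i = j") (simp_all add: rderiv_mult rderiv_rvar rderiv_comm[of i j] algebra_simps)
  show "rvar i * rderiv i (rvar j) = (if i = j then rvar j else 0)"
    by (simp add: rderiv_rvar)
qed simp_all

text \<open>The \<open>-1\<close> comes from rewriting the second derivatives through x_i d/dx_i,
  and \<kappa>(n - 1) from 2 x_i / (x_i - x_j) = \<open>rho i j\<close> + 1.\<close>

lemma D2_op_eq:
  "D2_op \<kappa> f = lx.Hs \<kappa> f + rconst (\<kappa> * (real (card (UNIV :: 'n set)) - 1) - 1) * lx.Es f"
  for f :: "'n::{finite,linorder} ratfun"
proof -
  let ?t = "\<lambda>i. rvar i * rderiv i f"
  have 1: "rvar i ^ 2 * rderiv i (rderiv i f) = rvar i * rderiv i (?t i) - ?t i" for i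
    by (simp add: rderiv_mult rderiv_rvar power2_eq_square algebra_simps)
  have "2 * (rvar i ^ 2 / (rvar i - rvar j) * rderiv i f) = lx.rho i j * ?t i + ?t i" if "j \<in> UNIV - {i}" for i j
  proof -
    have "rvar i - rvar j \<noteq> 0"
      using that by auto
    then show ?thesis
      by (simp add: lx.rho_def field_simps power2_eq_square)
  qed
  then have "2 * (\<Sum>j\<in>UNIV - {i}. rvar i ^ 2 / (rvar i - rvar j) * rderiv i f)
     = (\<Sum>j\<in>UNIV - {i}. lx.rho i j * ?t i + ?t i)" for i
    by (simp add: sum_distrib_left)
  also have "(\<Sum>j\<in>UNIV - {i}. lx.rho i j * ?t i + ?t i) = (\<Sum>j\<in>UNIV. lx.rho i j * ?t i) + (of_nat (card (UNIV :: 'n set)) - 1) * ?t i" for i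
  proof -
    have "(\<Sum>j\<in>UNIV - {i}. ?t i) = of_nat (card (UNIV - {i})) * ?t i"
      by simp
    also have "of_nat (card (UNIV - {i})) = (of_nat (card (UNIV :: 'n set)) - 1 :: 'n ratfun)"
      by (simp add: of_nat_diff Suc_le_eq card_gt_0_iff)
    finally show ?thesis
      by (simp add: sum.distrib sum.remove[of UNIV i "\<lambda>j. lx.rho i j * ?t i"])
  qed
  finally have 2: "2 * (\<Sum>j\<in>UNIV - {i}. rvar i ^ 2 / (rvar i - rvar j) * rderiv i f) =
    (\<Sum>j\<in>UNIV. lx.rho i j * ?t i) + (of_nat (card (UNIV :: 'n set)) - 1) * ?t i" for i .
  have "D2_op \<kappa> f = (\<Sum>i\<in>UNIV. rvar i * rderiv i (?t i)) - (\<Sum>i\<in>UNIV. ?t i) +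
     rconst \<kappa> * (\<Sum>i\<in>UNIV. 2 * (\<Sum>j\<in>UNIV - {i}. rvar i ^ 2 / (rvar i - rvar j) * rderiv i f))"
    unfolding D2_op_def 1 by (simp add: rconst_mult sum_subtractf sum_distrib_left mult_ac)
  also have "\<dots> = lx.Hs \<kappa> f + rconst (\<kappa> * (real (card (UNIV :: 'n set)) - 1) - 1) * lx.Es f"
    unfolding 2 lx.Hs_def lx.Es_def
    by (simp add: rconst_mult rconst_diff rconst_add rconst_of_nat sum.distrib sum_distrib_left algebra_simps sum_subtractf)
  finally show ?thesis .
qed

text \<open>The shift by \<kappa> appears because the sums of the recursion omit
  \<open>j = i\<close>, whereas the all-ones matrix in \<open>Qx\<close> includes it.\<close>

definition b_par :: "real \<Rightarrow> real \<Rightarrow> real" where "b_par a \<kappa> = a - 1 - \<kappa>"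

lemma DB_op_eq:
  "DB_op a \<kappa> f = lx.Bs \<kappa> (rconst \<kappa> * of_nat (card (UNIV :: 'n set)) + rconst (b_par a \<kappa>)) f"
  for f :: "'n::{finite,linorder} ratfun"
proof -
  have "(\<Sum>i\<in>UNIV. (rconst a * rvar i + 2) * rderiv i f) = rconst a * lx.Es f + 2 * lx.Em f"
    by (simp add: lx.Es_def lx.Em_def sum.distrib sum_distrib_left algebra_simps)
  then show ?thesis
    by (simp add: DB_op_def D2_op_eq lx.Bs_def b_par_def rconst_add rconst_diff rconst_mult rconst_of_nat algebra_simps)
qed

text \<open>The sums \<open>g\<^bsub>+i\<^esub> + g\<^bsub>-i\<^esub>\<close> and differences \<open>g\<^bsub>+i\<^esub> - g\<^bsub>-i\<^esub>\<close> of the auxiliary operators decouple: one step of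
  the recursion turns differences into sums by \<open>Qx\<close> and sums into differences by \<open>Lx\<close>.\<close>

lemma DB_part_sum_diff:
  fixes f :: "'n::{finite,linorder} ratfun" and a \<kappa> :: real
  defines "s \<equiv> \<lambda>d i. DB_part a \<kappa> d 1 i f + DB_part a \<kappa> d (- 1) i f"
    and "r \<equiv> \<lambda>d i. DB_part a \<kappa> d 1 i f - DB_part a \<kappa> d (- 1) i f"
  shows "s (Suc d) i = lx.Qx \<kappa> (rconst (b_par a \<kappa>)) (r d) i" (is ?A)
    and "r (Suc d) i = lx.Lx \<kappa> (s d) i" (is ?B)
proof -
  define p where "p = (\<lambda>i. DB_part a \<kappa> d 1 i f)"
  define m where "m = (\<lambda>i. DB_part a \<kappa> d (- 1) i f)"
  let ?I = "UNIV - {i}"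
  define P where "P = (\<Sum>j\<in>?I. (rvar i + rvar j) / (rvar i - rvar j) * (p i - p j))"
  define M where "M = (\<Sum>j\<in>?I. (rvar i + rvar j) / (rvar i - rvar j) * (m i - m j))"
  define N :: "'n ratfun" where "N = of_nat (card ?I)"
  define SP where "SP = (\<Sum>j\<in>?I. p j)"
  define SM where "SM = (\<Sum>j\<in>?I. m j)"
  define h :: "'n ratfun" where "h = rconst (1 / 2)"
  have half: "h * 2 = 1" and halfk: "rconst (\<kappa> / 2) = h * rconst \<kappa>"
    using rconst_mult[of "1/2" 2] rconst_mult[of "1/2" \<kappa>] by (simp_all add: h_def)
  have S1: "(\<Sum>j\<in>?I. p i - m j) = N * p i - SM" "(\<Sum>j\<in>?I. m i - p j) = N * m i - SP"
    by (simp_all add: SP_def SM_def N_def sum_subtractf)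
  have pm0: "DB_part a \<kappa> d 1 j f = p j" "DB_part a \<kappa> d (- 1) j f = m j" for j
    by (simp_all add: p_def m_def)
  have p1: "DB_part a \<kappa> (Suc d) 1 i f = rvar i * rderiv i (p i) + h * (rconst (a - 1) + 2 / rvar i) * (p i - m i)
      + h * rconst \<kappa> * P + h * rconst \<kappa> * (N * p i - SM)"
    unfolding DB_part.simps pm0 P_def[symmetric] M_def[symmetric] S1 halfk h_def[symmetric] inverse_eq_divide by simp
  have m1: "DB_part a \<kappa> (Suc d) (- 1) i f = - (rvar i * rderiv i (m i) + h * (rconst (a - 1) + 2 / rvar i) * (m i - p i)
      + h * rconst \<kappa> * M + h * rconst \<kappa> * (N * m i - SP))"
    unfolding DB_part.simps pm0 minus_minus P_def[symmetric] M_def[symmetric] S1 halfk h_def[symmetric] inverse_eq_divide by simp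
  have phi: "lx.phi i j * (u - v) = h * ((rvar i + rvar j) / (rvar i - rvar j) * (u - v)) + h * (u - v)" if "j \<in> ?I" for j u v
  proof -
    have nz: "rvar i - rvar j \<noteq> 0"
      using that by auto
    have "h * ((rvar i + rvar j) / (rvar i - rvar j)) + h = (h * 2) * (rvar i / (rvar i - rvar j))"
      using nz by (simp add: field_simps)
    then have "lx.phi i j = h * ((rvar i + rvar j) / (rvar i - rvar j)) + h"
      using half by (simp add: lx.phi_def)
    then show ?thesis
      by (simp add: algebra_simps)
  qed
  have L: "lx.Lx \<kappa> g i = rvar i * rderiv i (g i) + rconst \<kappa> * h * (\<Sum>j\<in>?I. (rvar i + rvar j) / (rvar i - rvar j) * (g i - g j))
     + rconst \<kappa> * h * (N * g i - (\<Sum>j\<in>?I. g j))" for g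
  proof -
    have "(\<Sum>j\<in>UNIV. lx.phi i j * (g i - g j)) = (\<Sum>j\<in>?I. lx.phi i j * (g i - g j))"
      by (simp add: sum.remove[of UNIV i])
    also have "\<dots> = h * (\<Sum>j\<in>?I. (rvar i + rvar j) / (rvar i - rvar j) * (g i - g j)) + h * (\<Sum>j\<in>?I. g i - g j)"
      unfolding sum_distrib_left sum.distrib[symmetric] by (intro sum.cong refl phi) auto
    also have "(\<Sum>j\<in>?I. g i - g j) = N * g i - (\<Sum>j\<in>?I. g j)"
      by (simp add: sum_subtractf N_def)
    finally have e: "(\<Sum>j\<in>UNIV. lx.phi i j * (g i - g j)) = h * (\<Sum>j\<in>?I. (rvar i + rvar j) / (rvar i - rvar j) * (g i - g j)) + h * (N * g i - (\<Sum>j\<in>?I. g j))" .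
    show ?thesis
      unfolding lx.Lx_def e by (simp only: distrib_left mult.assoc add.assoc)
  qed
  have pm: "(\<Sum>j\<in>?I. (rvar i + rvar j) / (rvar i - rvar j) * ((p i - m i) - (p j - m j))) = P - M"
    "(\<Sum>j\<in>?I. (rvar i + rvar j) / (rvar i - rvar j) * ((p i + m i) - (p j + m j))) = P + M"
    unfolding P_def M_def sum_subtractf[symmetric] sum.distrib[symmetric]
    by (intro sum.cong refl; simp only: right_diff_distrib distrib_left; simp)+
  have sp: "(\<Sum>j\<in>?I. p j - m j) = SP - SM" "(\<Sum>j\<in>?I. p j + m j) = SP + SM"
     "(\<Sum>j\<in>UNIV. p j - m j) = SP - SM + (p i - m i)"
    by (simp_all add: SP_def SM_def sum_subtractf sum.distrib sum.remove[of UNIV i])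
  have rs: "r d = (\<lambda>i. p i - m i)" "s d = (\<lambda>i. p i + m i)"
    by (simp_all add: r_def s_def p_def m_def fun_eq_iff)
  have ab: "rconst (a - 1) = rconst (b_par a \<kappa>) + rconst \<kappa>"
    by (simp add: b_par_def rconst_add[symmetric])
  show ?B
    using lx.th_add[of i "p i" "m i"]
    unfolding rs L pm sp r_def p1 m1 by (simp add: algebra_simps add_divide_distrib diff_divide_distrib)
  have "s (Suc d) i - lx.Qx \<kappa> (rconst (b_par a \<kappa>)) (r d) i = 0"
  proof -
    have "s (Suc d) i - lx.Qx \<kappa> (rconst (b_par a \<kappa>)) (r d) i =
       (h * 2 - 1) * (rconst (b_par a \<kappa>) * (p i - m i) + 2 * (p i - m i) / rvar i + rconst \<kappa> * (p i - m i) + rconst \<kappa> * (SP - SM))"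
      unfolding s_def p1 m1 lx.Qx_def rs L pm sp ab
      using lx.th_diff[of i "p i" "m i"]
      by (simp add: algebra_simps add_divide_distrib diff_divide_distrib)
    then show ?thesis using half by simp
  qed
  then show ?A by simp
qed

text \<open>Two steps of the recursion send sums to sums through \<open>Kx\<close>. The initial sum
  is \<open>2 * f\<close>, and this factor cancels the 1/2 in the definition.\<close>

lemma DB_higher_eq:
  fixes f :: "'n::{finite,linorder} ratfun"
  shows "DB_higher a \<kappa> d f = (\<Sum>i\<in>UNIV. (lx.Kx \<kappa> (rconst (b_par a \<kappa>)) ^^ d) (\<lambda>_. f) i)"
proof -
  let ?K = "lx.Kx \<kappa> (rconst (b_par a \<kappa>))"
  let ?s = "\<lambda>d i. DB_part a \<kappa> d 1 i f + DB_part a \<kappa> d (- 1) i f"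
  let ?r = "\<lambda>d i. DB_part a \<kappa> d 1 i f - DB_part a \<kappa> d (- 1) i f"
  have K2: "?K (\<lambda>j. 2 * g j) i = 2 * ?K g i" for g :: "'n \<Rightarrow> 'n ratfun" and i
  proof -
    have e: "lx.Lx \<kappa> (\<lambda>j. 2 * g j) = (\<lambda>j. 2 * lx.Lx \<kappa> g j)" for g :: "'n \<Rightarrow> 'n ratfun"
      by (rule ext) (simp add: lx.Lx_scale)
    show ?thesis
      unfolding lx.Kx_def e lx.Qx_def by (simp add: sum_distrib_left[symmetric] algebra_simps)
  qed
  have "?s (2 * d) i = 2 * (?K ^^ d) (\<lambda>_. f) i" for i
  proof (induction d arbitrary: i)
    case (Suc d)
    have "?r (Suc (2 * d)) = lx.Lx \<kappa> (?s (2 * d))"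
      by (rule ext, rule DB_part_sum_diff(2))
    then have "?s (Suc (Suc (2 * d))) i = ?K (?s (2 * d)) i"
      unfolding lx.Kx_def by (subst DB_part_sum_diff(1)) simp
    also have "?s (2 * d) = (\<lambda>i. 2 * (?K ^^ d) (\<lambda>_. f) i)"
      using Suc by auto
    finally show ?case
      by (simp only: K2 mult_Suc_right add_2_eq_Suc funpow.simps o_apply)
  qed simp
  moreover have "DB_higher a \<kappa> d f = rconst (1 / 2) * (\<Sum>i\<in>UNIV. ?s (2 * d) i)"
    by (simp add: DB_higher_def sum.distrib)
  moreover have "rconst (1 / 2) * (2 * u) = (u :: 'n ratfun)" for u
  proof -
    have "rconst (1 / 2) * 2 = (1 :: 'n ratfun)"
      using rconst_mult[of "1/2" 2] by (metis rconst_2 rconst_1 divide_self_if nonzero_eq_divide_eq zero_neq_numeral)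
    then show ?thesis
      by (simp add: mult.assoc[symmetric])
  qed
  ultimately show ?thesis
    by (simp add: sum_distrib_left[symmetric])
qed

lemma DB_commute:
  fixes f :: "'n::{finite,linorder} ratfun"
  shows "DB_op a \<kappa> (DB_higher a \<kappa> d f) = DB_higher a \<kappa> d (DB_op a \<kappa> f)"
  unfolding DB_op_eq DB_higher_eq by (rule lx.Bs_commute) simp

lemma lookup_mconst_mult [simp]: "lookup (mconst c * p) k = c * lookup p k"
  unfolding mconst_def mult_map_scale_conv_mult[symmetric] by (simp add: Poly_Mapping.map.rep_eq when_def)

lemma keys_mconst_mult: "keys (mconst c * p) \<subseteq> keys p"
  by (auto simp: in_keys_iff)

section \<open>Divided differences and symmetric polynomials\<close>

definition mlin :: "('n mpoly \<Rightarrow> 'm mpoly) \<Rightarrow> bool" where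
  "mlin A \<longleftrightarrow> (\<forall>p q. A (p + q) = A p + A q) \<and> (\<forall>c p. A (mconst c * p) = mconst c * A p)"

lemma mlin_add: "mlin A \<Longrightarrow> A (p + q) = A p + A q"
  and mlin_scale: "mlin A \<Longrightarrow> A (mconst c * p) = mconst c * A p"
  by (auto simp: mlin_def)

lemma mlin_0: "mlin A \<Longrightarrow> A 0 = 0"
  using mlin_scale[of A 0 0] by simp

lemma mlin_sum: "mlin A \<Longrightarrow> A (sum f B) = (\<Sum>x\<in>B. A (f x))"
  by (induction B rule: infinite_finite_induct) (auto simp: mlin_add mlin_0)

lemma mlin_diff: "mlin A \<Longrightarrow> A (p - q) = A p - A q"
  using mlin_add[of A "p - q" q] by simp

lemma mpoly_expand:
  assumes "finite S" "keys p \<subseteq> S"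
  shows "p = (\<Sum>k\<in>S. mconst (lookup p k) * single k 1)"
proof -
  have "p = (\<Sum>k\<in>S. single k (lookup p k))"
    using assms by (subst mpoly_sum_monomials, intro sum.mono_neutral_left) (auto simp: in_keys_iff)
  then show ?thesis
    by (simp add: mconst_def mult_single)
qed

lemma mlin_expand:
  assumes "mlin A" "finite S" "keys p \<subseteq> S"
  shows "A p = (\<Sum>k\<in>S. mconst (lookup p k) * A (single k 1))"
  by (subst mpoly_expand[OF assms(2,3)]) (simp only: mlin_sum[OF assms(1)] mlin_scale[OF assms(1)])

lemma mlin_eqI:
  assumes "mlin A" "mlin B" "\<And>k. A (single k 1) = B (single k 1)"
  shows "A p = B p"
  using mlin_expand[OF assms(1) finite_keys order.refl, of p] mlin_expand[OF assms(2) finite_keys order.refl, of p]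
  by (simp only: assms(3))

lemma mlin_keys:
  assumes "mlin A" "\<And>k. k \<in> keys p \<Longrightarrow> keys (A (single k 1)) \<subseteq> S"
  shows "keys (A p) \<subseteq> S"
proof -
  have "keys (A p) \<subseteq> (\<Union>k\<in>keys p. keys (mconst (lookup p k) * A (single k 1)))"
    by (subst mlin_expand[OF assms(1) finite_keys order.refl, of p]) (rule keys_sum)
  also have "\<dots> \<subseteq> S"
    using keys_mconst_mult assms(2) by blast
  finally show ?thesis .
qed

lemma mlin_lookup:
  assumes "mlin A"
  shows "lookup (A p) l = (\<Sum>k\<in>keys p. lookup p k * lookup (A (single k 1)) l)"
  by (simp only: mlin_expand[OF assms finite_keys order.refl, of p] lookup_sum lookup_mconst_mult)

definition lin :: "(('n \<Rightarrow>\<^sub>0 nat) \<Rightarrow> 'm mpoly) \<Rightarrow> 'n mpoly \<Rightarrow> 'm mpoly" where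
  "lin F p = (\<Sum>k\<in>keys p. mconst (lookup p k) * F k)"

lemma lin_superset:
  assumes "finite S" "keys p \<subseteq> S"
  shows "lin F p = (\<Sum>k\<in>S. mconst (lookup p k) * F k)"
  unfolding lin_def using assms by (intro sum.mono_neutral_left) (auto simp: in_keys_iff)

lemma mlin_lin [simp]: "mlin (lin F)"
proof -
  have "lin F (p + q) = lin F p + lin F q" for p q
  proof -
    let ?S = "keys p \<union> keys q"
    have "finite ?S" "keys p \<subseteq> ?S" "keys q \<subseteq> ?S" "keys (p + q) \<subseteq> ?S"
      using keys_add[of p q] by auto
    then show ?thesis
      by (simp add: lin_superset[of ?S] lookup_add mconst_add distrib_right sum.distrib)
  qed
  moreover have "lin F (mconst c * p) = mconst c * lin F p" for c p
    using keys_mconst_mult[of c p]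
    by (simp add: lin_superset[of "keys p"] mconst_mult sum_distrib_left mult.assoc)
  ultimately show ?thesis by (simp add: mlin_def)
qed

lemma lin_single [simp]: "lin F (single k 1) = F k"
  by (simp add: lin_def)

lemma mlin_mult [simp]: "mlin (\<lambda>p. r * p)"
  by (simp add: mlin_def algebra_simps)

lemma mlin_id [simp]: "mlin (\<lambda>p. p)"
  by (simp add: mlin_def)

lemma mlin_compose: "mlin A \<Longrightarrow> mlin B \<Longrightarrow> mlin (\<lambda>p. A (B p))"
  by (simp add: mlin_def)

lemma mlin_plus: "mlin A \<Longrightarrow> mlin B \<Longrightarrow> mlin (\<lambda>p. A p + B p)"
  by (simp add: mlin_def algebra_simps)

lemma mlin_minus: "mlin A \<Longrightarrow> mlin B \<Longrightarrow> mlin (\<lambda>p. A p - B p)"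
  by (simp add: mlin_def algebra_simps)

lemma mlin_times: "mlin A \<Longrightarrow> mlin (\<lambda>p. r * A p)"
  by (simp add: mlin_def algebra_simps)

lemma mlin_Sum: "(\<And>i. i \<in> I \<Longrightarrow> mlin (A i)) \<Longrightarrow> mlin (\<lambda>p. \<Sum>i\<in>I. A i p)"
  by (induction I rule: infinite_finite_induct) (auto simp: mlin_plus, auto simp: mlin_def)

lemma mlin_mderiv [simp]: "mlin (mderiv i)"
  by (simp add: mlin_def mderiv_add mderiv_mult)

section \<open>The action of permutations on exponents and polynomials\<close>

definition xp :: "('n::finite \<Rightarrow> nat) \<Rightarrow> 'n \<Rightarrow>\<^sub>0 nat" where
  "xp l = Abs_poly_mapping l"

lemma lookup_xp [simp]: "lookup (xp l) = l"
  by (simp add: xp_def)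

lemma xp_lookup [simp]: "xp (lookup k) = k"
  by (simp add: poly_mapping_eq_iff)

definition kperm :: "('n \<Rightarrow> 'n) \<Rightarrow> ('n::finite \<Rightarrow>\<^sub>0 nat) \<Rightarrow> 'n \<Rightarrow>\<^sub>0 nat" where
  "kperm \<sigma> k = xp (lookup k \<circ> \<sigma>)"

lemma lookup_kperm [simp]: "lookup (kperm \<sigma> k) i = lookup k (\<sigma> i)"
  by (simp add: kperm_def)

lemma kperm_kperm: "kperm \<sigma> (kperm \<tau> k) = kperm (\<tau> \<circ> \<sigma>) k"
  by (simp add: kperm_def o_assoc)

lemma kperm_id [simp]: "kperm id k = k"
  by (simp add: kperm_def)

lemma kperm_inv: "bij \<sigma> \<Longrightarrow> kperm \<sigma> (kperm (inv \<sigma>) k) = k" "bij \<sigma> \<Longrightarrow> kperm (inv \<sigma>) (kperm \<sigma> k) = k"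
  by (simp_all add: kperm_kperm bij_is_inj bij_is_surj surj_iff[symmetric] inj_iff[symmetric])
     (simp_all add: bij_def surj_iff inj_iff)

lemma kperm_add: "kperm \<sigma> (k + l) = kperm \<sigma> k + kperm \<sigma> l"
  by (rule poly_mapping_eqI) (simp add: lookup_add)

text \<open>The inverse on exponents makes this the left action that sends x_i to x_(\<sigma>
  i).\<close>

definition pperm :: "('n \<Rightarrow> 'n) \<Rightarrow> 'n::finite mpoly \<Rightarrow> 'n mpoly" where
  "pperm \<sigma> = lin (\<lambda>k. single (kperm (inv \<sigma>) k) 1)"

lemma mlin_pperm [simp]: "mlin (pperm \<sigma>)"
  by (simp add: pperm_def)

lemma pperm_single: "pperm \<sigma> (single k 1) = single (kperm (inv \<sigma>) k) 1"
  by (simp add: pperm_def)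

lemma lookup_pperm:
  assumes "bij \<sigma>"
  shows "lookup (pperm \<sigma> p) k = lookup p (kperm \<sigma> k)"
proof -
  have *: "kperm (inv \<sigma>) l = k \<longleftrightarrow> l = kperm \<sigma> k" for l
    using kperm_inv[OF assms] by metis
  have "lookup (pperm \<sigma> p) k = (\<Sum>l\<in>keys p. if l = kperm \<sigma> k then lookup p l else 0)"
    unfolding mlin_lookup[OF mlin_pperm] pperm_single
    by (intro sum.cong refl) (auto simp: lookup_single when_def *)
  then show ?thesis
    by (simp add: in_keys_iff)
qed

lemma pperm_mult:
  assumes "bij \<sigma>"
  shows "pperm \<sigma> (p * q) = pperm \<sigma> p * pperm \<sigma> q"
proof (rule mlin_eqI[of "\<lambda>p. pperm \<sigma> (p * q)" "\<lambda>p. pperm \<sigma> p * pperm \<sigma> q"])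
  fix k
  show "pperm \<sigma> (single k 1 * q) = pperm \<sigma> (single k 1) * pperm \<sigma> q"
    by (rule mlin_eqI[of "\<lambda>q. pperm \<sigma> (single k 1 * q)" "\<lambda>q. pperm \<sigma> (single k 1) * pperm \<sigma> q"])
      (simp_all add: mlin_compose mlin_times mult_single pperm_single kperm_add)
qed (simp_all add: mlin_compose mult.commute[of _ q] mult.commute[of _ "pperm \<sigma> q"])

lemma pperm_compose: "bij \<sigma> \<Longrightarrow> bij \<tau> \<Longrightarrow> pperm \<sigma> (pperm \<tau> p) = pperm (\<sigma> \<circ> \<tau>) p"
  by (rule poly_mapping_eqI) (simp add: lookup_pperm bij_comp kperm_kperm)

lemma pperm_mvar: "bij \<sigma> \<Longrightarrow> pperm \<sigma> (mvar i) = mvar (\<sigma> i)"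
proof -
  assume b: "bij \<sigma>"
  have "kperm (inv \<sigma>) (single i 1) = single (\<sigma> i) 1"
    using b by (intro poly_mapping_eqI) (auto simp: lookup_single when_def bij_inv_eq_iff)
  then show ?thesis by (simp add: mvar_def pperm_single)
qed

lemma pperm_mconst: "bij \<sigma> \<Longrightarrow> pperm \<sigma> (mconst c) = mconst c"
proof -
  assume b: "bij \<sigma>"
  have "kperm (inv \<sigma>) 0 = 0"
    by (intro poly_mapping_eqI) simp
  then have "pperm \<sigma> 1 = 1"
    using pperm_single[of \<sigma> 0] by simp
  then show ?thesis
    using mlin_scale[OF mlin_pperm, of \<sigma> c 1] by simp
qed

lemma pperm_mderiv:
  assumes b: "bij \<sigma>"
  shows "pperm \<sigma> (mderiv i p) = mderiv (\<sigma> i) (pperm \<sigma> p)"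
proof (rule mlin_eqI[of "\<lambda>p. pperm \<sigma> (mderiv i p)" "\<lambda>p. mderiv (\<sigma> i) (pperm \<sigma> p)"])
  fix k
  have e: "kperm (inv \<sigma>) (k - single i 1) = kperm (inv \<sigma>) k - single (\<sigma> i) 1"
    using b by (intro poly_mapping_eqI) (auto simp: lookup_single lookup_minus when_def bij_inv_eq_iff)
  have "single k' c = mconst c * single k' 1" for k' :: "'a \<Rightarrow>\<^sub>0 nat" and c
    by (simp add: mconst_def mult_single)
  then have "mderiv j (single k' 1) = mconst (real (lookup k' j)) * single (k' - single j 1) 1" for j and k' :: "'a \<Rightarrow>\<^sub>0 nat"
    unfolding mderiv_single by (metis mult.right_neutral)
  then show "pperm \<sigma> (mderiv i (single k 1)) = mderiv (\<sigma> i) (pperm \<sigma> (single k 1))"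
    using b by (simp add: pperm_single mlin_scale e bij_is_inj del: One_nat_def)
qed (simp_all add: mlin_compose)

text \<open>The exponents on the ladder between \<open>k\<close> and its transposition; for k_i
  \<ge> k_j the latter is reached at c = k_i - k_j.\<close>

definition stp :: "'n \<Rightarrow> 'n \<Rightarrow> ('n::finite \<Rightarrow>\<^sub>0 nat) \<Rightarrow> nat \<Rightarrow> 'n \<Rightarrow>\<^sub>0 nat" where
  "stp i j k c = k - single i c + single j c"

lemma lookup_stp: "i \<noteq> j \<Longrightarrow> lookup (stp i j k c) m =
   (if m = i then lookup k i - c else if m = j then lookup k j + c else lookup k m)"
  by (auto simp: stp_def lookup_add lookup_minus lookup_single when_def)

text \<open>\<open>(x\<^sup>k - s\<^bsub>ij\<^esub> x\<^sup>k) / (x\<^sub>i - x\<^sub>j)\<close> if \<open>k\<^sub>i \<ge> k\<^sub>j\<close>, and \<open>0\<close> otherwise.\<close>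

definition stair :: "'n \<Rightarrow> 'n \<Rightarrow> ('n::finite \<Rightarrow>\<^sub>0 nat) \<Rightarrow> 'n mpoly" where
  "stair i j k = (\<Sum>c<lookup k i - lookup k j.
      single (stp i j k c - single i 1) 1)"

text \<open>The divided difference \<open>(p - s\<^bsub>ij\<^esub> p) / (x\<^sub>i - x\<^sub>j)\<close>.\<close>

definition ddiff :: "'n \<Rightarrow> 'n \<Rightarrow> 'n::finite mpoly \<Rightarrow> 'n mpoly" where
  "ddiff i j = lin (\<lambda>k. stair i j k - stair j i k)"

lemma mlin_ddiff [simp]: "mlin (ddiff i j)"
  by (simp add: ddiff_def)

lemma mvar_stair_summand:
  assumes "i \<noteq> j" "c < lookup k i - lookup k j"
  shows "mvar i * single (stp i j k c - single i 1) 1 = single (stp i j k c) 1"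
    "mvar j * single (stp i j k c - single i 1) 1 = single (stp i j k (Suc c)) 1"
proof -
  have "single i 1 + (stp i j k c - single i 1) = stp i j k c"
    using assms by (intro poly_mapping_eqI) (auto simp: lookup_add lookup_minus lookup_single lookup_stp when_def)
  then show "mvar i * single (stp i j k c - single i 1) 1 = single (stp i j k c) 1"
    by (simp add: mvar_def mult_single)
  have "single j 1 + (stp i j k c - single i 1) = stp i j k (Suc c)"
    using assms by (intro poly_mapping_eqI) (auto simp: lookup_add lookup_minus lookup_single lookup_stp when_def)
  then show "mvar j * single (stp i j k c - single i 1) 1 = single (stp i j k (Suc c)) 1"
    by (simp add: mvar_def mult_single)
qed

lemma mvar_stair: "i \<noteq> j \<Longrightarrow> mvar i * stair i j k = (\<Sum>c<lookup k i - lookup k j. single (stp i j k c) 1)"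
  "i \<noteq> j \<Longrightarrow> mvar j * stair i j k = (\<Sum>c<lookup k i - lookup k j. single (stp i j k (Suc c)) 1)"
  unfolding stair_def sum_distrib_left by (intro sum.cong refl mvar_stair_summand; simp)+

lemma stp_0 [simp]: "stp i j k 0 = k"
  by (simp add: stp_def)

lemma stp_full:
  assumes "i \<noteq> j" "lookup k j \<le> lookup k i"
  shows "stp i j k (lookup k i - lookup k j) = kperm (Transposition.transpose i j) k"
  using assms by (intro poly_mapping_eqI) (auto simp: lookup_stp Transposition.transpose_def)

lemma stair_telescope:
  assumes "i \<noteq> j"
  shows "(mvar i - mvar j) * stair i j k = single k 1 - single (stp i j k (lookup k i - lookup k j)) 1"
proof -
  have "(\<Sum>c<m. single (stp i j k c) 1) - (\<Sum>c<m. single (stp i j k (Suc c)) 1)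
      = single k 1 - (single (stp i j k m) 1 :: 'a mpoly)" for m
    by (induction m) (auto simp: algebra_simps)
  then show ?thesis
    by (simp add: left_diff_distrib mvar_stair assms)
qed

lemma ddiff_mult:
  assumes "i \<noteq> j"
  shows "(mvar i - mvar j) * ddiff i j p = p - pperm (Transposition.transpose i j) p"
proof (rule mlin_eqI[of "\<lambda>p. (mvar i - mvar j) * ddiff i j p" "\<lambda>p. p - pperm (Transposition.transpose i j) p"])
  fix k :: "'a \<Rightarrow>\<^sub>0 nat"
  let ?s = "Transposition.transpose i j"
  let ?a = "lookup k i" and ?b = "lookup k j"
  \<comment> \<open>For \<open>?a < ?b\<close> truncated subtraction leaves the stair empty, and the
    right-hand side has to be 0.\<close>
  have a1: "(mvar i - mvar j) * stair i j k = single k 1 - single (if ?b \<le> ?a then kperm ?s k else k) 1"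
    using stp_full[OF assms, of k] by (simp add: stair_telescope[OF assms])
  have "(mvar i - mvar j) * stair j i k = - ((mvar j - mvar i) * stair j i k)"
    by (simp add: algebra_simps)
  also have "\<dots> = - (single k 1 - single (if ?a \<le> ?b then kperm ?s k else k) 1)"
    using stp_full[of j i k] assms by (simp add: stair_telescope transpose_commute[of j i])
  finally have a2: "(mvar i - mvar j) * stair j i k = - (single k 1 - single (if ?a \<le> ?b then kperm ?s k else k) 1)" .
  have a3: "?a = ?b \<Longrightarrow> kperm ?s k = k"
    by (intro poly_mapping_eqI) (auto simp: Transposition.transpose_def)
  show "(mvar i - mvar j) * ddiff i j (single k 1) = single k 1 - pperm ?s (single k 1)"
  proof -
    consider "?a = ?b" | "?a < ?b" | "?b < ?a"
      by linarith
    then show ?thesis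
    proof cases
      case 1
      show ?thesis
        unfolding ddiff_def lin_single right_diff_distrib[of _ "stair i j k"] a1 a2 pperm_single inv_transpose_eq a3[OF 1] if_cancel
        by (simp only: diff_self minus_zero)
    next
      case 2
      then have e: "(?b \<le> ?a) = False" "(?a \<le> ?b) = True" by simp_all
      show ?thesis
        unfolding ddiff_def lin_single right_diff_distrib[of _ "stair i j k"] a1 a2 pperm_single inv_transpose_eq e if_True if_False
        by (simp only: diff_self diff_minus_eq_add add_0_left)
    next
      case 3
      then have e: "(?b \<le> ?a) = True" "(?a \<le> ?b) = False" by simp_all
      show ?thesis
        unfolding ddiff_def lin_single right_diff_distrib[of _ "stair i j k"] a1 a2 pperm_single inv_transpose_eq e if_True if_False
        by (simp only: diff_self minus_zero diff_zero)
    qed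
  qed
qed (intro mlin_times mlin_minus mlin_id mlin_ddiff mlin_pperm)+

text \<open>Both sides agree after multiplication by x_(\<sigma> i) - x_(\<sigma> j), which can be
  cancelled.\<close>

lemma pperm_ddiff:
  fixes p :: "'n::{finite,linorder} mpoly"
  assumes b: "bij \<sigma>" and "i \<noteq> j"
  shows "pperm \<sigma> (ddiff i j p) = ddiff (\<sigma> i) (\<sigma> j) (pperm \<sigma> p)"
proof -
  have ne: "\<sigma> i \<noteq> \<sigma> j"
    using assms by (meson bij_is_inj injD)
  have c: "\<sigma> \<circ> Transposition.transpose i j = Transposition.transpose (\<sigma> i) (\<sigma> j) \<circ> \<sigma>"
    using b bij_is_inj[OF b] by (simp add: fun_eq_iff Transposition.transpose_def inj_eq)
  have "(mvar (\<sigma> i) - mvar (\<sigma> j)) * pperm \<sigma> (ddiff i j p) = pperm \<sigma> ((mvar i - mvar j) * ddiff i j p)"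
    by (simp add: pperm_mult b mlin_diff pperm_mvar)
  also have "\<dots> = pperm \<sigma> p - pperm (Transposition.transpose (\<sigma> i) (\<sigma> j)) (pperm \<sigma> p)"
    by (simp add: ddiff_mult assms mlin_diff pperm_compose c)
  also have "\<dots> = (mvar (\<sigma> i) - mvar (\<sigma> j)) * ddiff (\<sigma> i) (\<sigma> j) (pperm \<sigma> p)"
    using ne by (simp add: ddiff_mult)
  finally show ?thesis
    using ne by (simp add: mult_cancel_left)
qed

definition is_sym :: "'n::finite mpoly \<Rightarrow> bool" where
  "is_sym f \<longleftrightarrow> (\<forall>\<sigma>. bij \<sigma> \<longrightarrow> pperm \<sigma> f = f)"

text \<open>For such tuples \<open>g j\<close> is the transposition of \<open>g i\<close>, so x_i -
  x_j divides \<open>g i - g j\<close>. Constant tuples of symmetric polynomials are of this kind,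
  and L and K preserve the property.\<close>

definition equivar :: "('n \<Rightarrow> 'n::finite mpoly) \<Rightarrow> bool" where
  "equivar g \<longleftrightarrow> (\<forall>\<sigma> i. bij \<sigma> \<longrightarrow> g (\<sigma> i) = pperm \<sigma> (g i))"

text \<open>The polynomial form of X^-1 L: for equivariant \<open>g\<close>, the polynomial
  \<open>ddiff i j (g i)\<close> is (g_i - g_j) / (x_i - x_j).\<close>

definition Dp :: "real \<Rightarrow> ('n \<Rightarrow> 'n::finite mpoly) \<Rightarrow> 'n \<Rightarrow> 'n mpoly" where
  "Dp \<kappa> g i = mderiv i (g i) + mconst \<kappa> * (\<Sum>j\<in>UNIV - {i}. ddiff i j (g i))"

definition Lp :: "real \<Rightarrow> ('n \<Rightarrow> 'n::finite mpoly) \<Rightarrow> 'n \<Rightarrow> 'n mpoly" where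
  "Lp \<kappa> g i = mvar i * Dp \<kappa> g i"

definition Kp :: "real \<Rightarrow> real \<Rightarrow> ('n \<Rightarrow> 'n::finite mpoly) \<Rightarrow> 'n \<Rightarrow> 'n mpoly" where
  "Kp \<kappa> b g i = Lp \<kappa> (Lp \<kappa> g) i + mconst b * Lp \<kappa> g i + mconst \<kappa> * (\<Sum>j\<in>UNIV. Lp \<kappa> g j)
     + mconst 2 * Dp \<kappa> g i"

lemma equivar_const: "is_sym f \<Longrightarrow> equivar (\<lambda>_. f)"
  by (simp add: is_sym_def equivar_def)

lemma pperm_sum: "pperm \<sigma> (sum f A) = (\<Sum>x\<in>A. pperm \<sigma> (f x))"
  by (rule mlin_sum) simp

lemma sum_bij_minus: "bij \<sigma> \<Longrightarrow> (\<Sum>j\<in>UNIV - {\<sigma> i}. f j) = (\<Sum>j\<in>UNIV - {i :: 'n::finite}. f (\<sigma> j))"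
proof -
  assume b: "bij \<sigma>"
  have "bij_betw \<sigma> (UNIV - {i}) (UNIV - {\<sigma> i})"
    by (rule bij_betw_DiffI[OF b]) (auto simp: bij_betw_def)
  then show ?thesis
    by (rule sum.reindex_bij_betw[symmetric])
qed

lemma equivar_Dp:
  fixes g :: "'n \<Rightarrow> 'n::{finite,linorder} mpoly"
  assumes g: "equivar g"
  shows "equivar (Dp \<kappa> g)"
  unfolding equivar_def
proof (intro allI impI)
  fix \<sigma> :: "'n \<Rightarrow> 'n" and i
  assume b: "bij \<sigma>"
  have gi: "g (\<sigma> i) = pperm \<sigma> (g i)"
    using g b by (simp add: equivar_def)
  have "pperm \<sigma> (Dp \<kappa> g i) = mderiv (\<sigma> i) (g (\<sigma> i)) + mconst \<kappa> * (\<Sum>j\<in>UNIV - {i}. ddiff (\<sigma> i) (\<sigma> j) (g (\<sigma> i)))"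
  proof -
    have "(\<Sum>j\<in>UNIV - {i}. pperm \<sigma> (ddiff i j (g i))) = (\<Sum>j\<in>UNIV - {i}. ddiff (\<sigma> i) (\<sigma> j) (pperm \<sigma> (g i)))"
      by (intro sum.cong refl pperm_ddiff[OF b]) auto
    then show ?thesis
      unfolding Dp_def
      by (simp add: mlin_add[OF mlin_pperm] pperm_mult b pperm_mconst pperm_sum pperm_mderiv gi)
  qed
  then show "Dp \<kappa> g (\<sigma> i) = pperm \<sigma> (Dp \<kappa> g i)"
    unfolding Dp_def[of \<kappa> g "\<sigma> i"] by (simp add: sum_bij_minus[OF b])
qed

lemma equivar_Lp:
  fixes g :: "'n \<Rightarrow> 'n::{finite,linorder} mpoly"
  shows "equivar g \<Longrightarrow> equivar (Lp \<kappa> g)"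
  using equivar_Dp[of g \<kappa>] by (auto simp: equivar_def Lp_def pperm_mult pperm_mvar)

lemma sym_sum: "equivar g \<Longrightarrow> is_sym (\<Sum>i\<in>UNIV. g i)"
  unfolding is_sym_def
proof (intro allI impI)
  fix \<sigma> :: "'a \<Rightarrow> 'a"
  assume g: "equivar g" and b: "bij \<sigma>"
  have "pperm \<sigma> (\<Sum>i\<in>UNIV. g i) = (\<Sum>i\<in>UNIV. g (\<sigma> i))"
    using g b by (simp add: pperm_sum equivar_def)
  also have "\<dots> = (\<Sum>i\<in>UNIV. g i)"
    by (rule sum.reindex_bij_betw[OF b])
  finally show "pperm \<sigma> (\<Sum>i\<in>UNIV. g i) = (\<Sum>i\<in>UNIV. g i)" .
qed

lemma equivar_add: "equivar g \<Longrightarrow> equivar h \<Longrightarrow> equivar (\<lambda>i. g i + h i)"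
  by (simp add: equivar_def mlin_add[OF mlin_pperm])

lemma equivar_scale: "equivar g \<Longrightarrow> equivar (\<lambda>i. mconst c * g i)"
  by (simp add: equivar_def mlin_scale[OF mlin_pperm])

lemma equivar_Kp:
  fixes g :: "'n \<Rightarrow> 'n::{finite,linorder} mpoly"
  assumes "equivar g"
  shows "equivar (Kp \<kappa> b g)"
proof -
  have "equivar (\<lambda>i. Lp \<kappa> (Lp \<kappa> g) i + mconst b * Lp \<kappa> g i + mconst \<kappa> * (\<Sum>j\<in>UNIV. Lp \<kappa> g j)
     + mconst 2 * Dp \<kappa> g i)"
    using assms by (intro equivar_add equivar_scale equivar_Lp equivar_Dp equivar_const sym_sum)
  then show ?thesis
    by (simp add: Kp_def[abs_def])
qed

lemma rvar_diff_nz: "i \<noteq> j \<Longrightarrow> rvar i - rvar j \<noteq> 0"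
  by simp

lemma rpoly_Lp:
  fixes g :: "'n \<Rightarrow> 'n::{finite,linorder} mpoly"
  assumes "equivar g"
  shows "lx.Lx \<kappa> (\<lambda>i. rpoly (g i)) i = rpoly (Lp \<kappa> g i)"
proof -
  have "lx.phi i j * (rpoly (g i) - rpoly (g j)) = rpoly (mvar i * ddiff i j (g i))" if "j \<noteq> i" for j
  proof -
    have "g j = pperm (Transposition.transpose i j) (g i)"
      using assms bij_transpose[of i j] unfolding equivar_def by (metis transpose_apply_first)
    then have "rpoly (g i) - rpoly (g j) = rpoly ((mvar i - mvar j) * ddiff i j (g i))"
      using that by (simp add: ddiff_mult rpoly_diff)
    then show ?thesis
      using rvar_diff_nz[of i j] that by (simp add: rpoly_mult rpoly_diff rvar_def[symmetric] lx.phi_def)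
  qed
  then have "(\<Sum>j\<in>UNIV. lx.phi i j * (rpoly (g i) - rpoly (g j))) = (\<Sum>j\<in>UNIV - {i}. rpoly (mvar i * ddiff i j (g i)))"
    by (simp add: sum.remove[of UNIV i])
  then show ?thesis
    by (simp add: lx.Lx_def Lp_def Dp_def rpoly_add rpoly_mult rpoly_sum rderiv_rpoly
        rconst_def[symmetric] rvar_def[symmetric] distrib_left sum_distrib_left mult.left_commute)
qed

lemma rpoly_Lp':
  fixes g :: "'n \<Rightarrow> 'n::{finite,linorder} mpoly"
  shows "equivar g \<Longrightarrow> lx.Lx \<kappa> (\<lambda>i. rpoly (g i)) = (\<lambda>i. rpoly (Lp \<kappa> g i))"
  by (simp add: fun_eq_iff rpoly_Lp)

lemma rpoly_Dp: "rpoly (Lp \<kappa> g i) / rvar i = rpoly (Dp \<kappa> g i)"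
  by (simp add: Lp_def rpoly_mult rvar_def[symmetric])

lemma rpoly_Kp:
  fixes g :: "'n \<Rightarrow> 'n::{finite,linorder} mpoly"
  assumes "equivar g"
  shows "lx.Kx \<kappa> (rconst b) (\<lambda>i. rpoly (g i)) = (\<lambda>i. rpoly (Kp \<kappa> b g i))"
proof
  fix i
  have "mconst 2 = (2 :: 'n mpoly)"
    using mconst_add[of 1 1] by simp
  then have "rpoly (mconst 2) = (2 :: 'n ratfun)"
    by (metis rconst_2 rconst_def)
  then show "lx.Kx \<kappa> (rconst b) (\<lambda>i. rpoly (g i)) i = rpoly (Kp \<kappa> b g i)"
    by (simp add: lx.Kx_def lx.Qx_def rpoly_Lp' assms equivar_Lp rpoly_Dp Kp_def rpoly_add rpoly_mult rconst_def[symmetric] rpoly_sum)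
qed

lemma equivar_Lp_pow:
  fixes g :: "'n \<Rightarrow> 'n::{finite,linorder} mpoly"
  shows "equivar g \<Longrightarrow> equivar ((Lp \<kappa> ^^ k) g)"
  by (induction k) (auto intro: equivar_Lp)

lemma equivar_Kp_pow:
  fixes g :: "'n \<Rightarrow> 'n::{finite,linorder} mpoly"
  shows "equivar g \<Longrightarrow> equivar ((Kp \<kappa> b ^^ k) g)"
  by (induction k) (auto intro: equivar_Kp)

lemma rpoly_Lp_pow:
  fixes g :: "'n \<Rightarrow> 'n::{finite,linorder} mpoly"
  assumes "equivar g"
  shows "(lx.Lx \<kappa> ^^ k) (\<lambda>i. rpoly (g i)) = (\<lambda>i. rpoly ((Lp \<kappa> ^^ k) g i))"
  using equivar_Lp_pow[OF assms, where \<kappa> = \<kappa>] by (induction k) (simp_all add: rpoly_Lp')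

lemma rpoly_Kp_pow:
  fixes g :: "'n \<Rightarrow> 'n::{finite,linorder} mpoly"
  assumes "equivar g"
  shows "(lx.Kx \<kappa> (rconst b) ^^ k) (\<lambda>i. rpoly (g i)) = (\<lambda>i. rpoly ((Kp \<kappa> b ^^ k) g i))"
  using equivar_Kp_pow[OF assms, where \<kappa> = \<kappa> and b = b] by (induction k) (simp_all add: rpoly_Kp)

section \<open>Polynomial versions of the operators\<close>

definition mom :: "real \<Rightarrow> nat \<Rightarrow> 'n::finite mpoly \<Rightarrow> 'n mpoly" where
  "mom \<kappa> k f = (\<Sum>i\<in>UNIV. (Lp \<kappa> ^^ k) (\<lambda>_. f) i)"

definition BDp :: "real \<Rightarrow> real \<Rightarrow> nat \<Rightarrow> 'n::finite mpoly \<Rightarrow> 'n mpoly" where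
  "BDp a \<kappa> d f = (\<Sum>i\<in>UNIV. (Kp \<kappa> (b_par a \<kappa>) ^^ d) (\<lambda>_. f) i)"

definition Emp :: "'n::finite mpoly \<Rightarrow> 'n mpoly" where
  "Emp f = (\<Sum>i\<in>UNIV. mderiv i f)"

text \<open>The constant is that of \<open>D2_op_eq\<close>.\<close>

definition D2p :: "real \<Rightarrow> 'n::finite mpoly \<Rightarrow> 'n mpoly" where
  "D2p \<kappa> f = mom \<kappa> 2 f + mconst (\<kappa> * (real (card (UNIV :: 'n set)) - 1) - 1) * mom \<kappa> 1 f"

definition DBp :: "real \<Rightarrow> real \<Rightarrow> 'n::finite mpoly \<Rightarrow> 'n mpoly" where
  "DBp a \<kappa> f = D2p \<kappa> f + mconst a * mom \<kappa> 1 f + mconst 2 * Emp f"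

lemma rpoly_mom:
  fixes f :: "'n::{finite,linorder} mpoly"
  shows "is_sym f \<Longrightarrow> rpoly (mom \<kappa> k f) = (\<Sum>i\<in>UNIV. (lx.Lx \<kappa> ^^ k) (\<lambda>_. rpoly f) i)"
  by (simp add: mom_def rpoly_sum rpoly_Lp_pow[OF equivar_const])

lemma rpoly_mom1:
  fixes f :: "'n::{finite,linorder} mpoly"
  shows "is_sym f \<Longrightarrow> rpoly (mom \<kappa> 1 f) = lx.Es (rpoly f)"
  by (simp add: rpoly_mom lx.Es_moment[of _ \<kappa>])

lemma rpoly_mom2:
  fixes f :: "'n::{finite,linorder} mpoly"
  shows "is_sym f \<Longrightarrow> rpoly (mom \<kappa> 2 f) = lx.Hs \<kappa> (rpoly f)"
  by (simp add: rpoly_mom lx.Hs_moment2 numeral_2_eq_2)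

lemma rpoly_Emp:
  fixes f :: "'n::{finite,linorder} mpoly"
  shows "rpoly (Emp f) = lx.Em (rpoly f)"
  by (simp add: Emp_def lx.Em_def rpoly_sum rderiv_rpoly)

lemma D2_op_rpoly:
  fixes f :: "'n::{finite,linorder} mpoly"
  shows "is_sym f \<Longrightarrow> D2_op \<kappa> (rpoly f) = rpoly (D2p \<kappa> f)"
  using rpoly_mom1[of f \<kappa>] by (simp add: D2_op_eq D2p_def rpoly_add rpoly_mult rpoly_mom2 rconst_def)

lemma DB_op_rpoly:
  fixes f :: "'n::{finite,linorder} mpoly"
  assumes "is_sym f"
  shows "DB_op a \<kappa> (rpoly f) = rpoly (DBp a \<kappa> f)"
proof -
  have "(\<Sum>i\<in>UNIV. (rconst a * rvar i + 2) * rderiv i (rpoly f)) = rconst a * lx.Es (rpoly f) + 2 * lx.Em (rpoly f)"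
    by (simp add: lx.Es_def lx.Em_def sum.distrib sum_distrib_left algebra_simps)
  then show ?thesis
    using rpoly_mom1[OF assms, of \<kappa>] rconst_2[where 'a = 'n]
    by (simp add: DB_op_def DBp_def D2_op_rpoly[OF assms] rpoly_add rpoly_mult rpoly_Emp rconst_def)
qed

lemma DB_higher_rpoly:
  fixes f :: "'n::{finite,linorder} mpoly"
  shows "is_sym f \<Longrightarrow> DB_higher a \<kappa> d (rpoly f) = rpoly (BDp a \<kappa> d f)"
  by (simp add: DB_higher_eq BDp_def rpoly_sum rpoly_Kp_pow[OF equivar_const])

lemma euler_op_eq: "euler_op f = lx.Es f"
  by (simp add: euler_op_def lx.Es_def)

lemma sym_mom:
  fixes f :: "'n::{finite,linorder} mpoly"
  shows "is_sym f \<Longrightarrow> is_sym (mom \<kappa> k f)"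
  unfolding mom_def by (intro sym_sum equivar_Lp_pow equivar_const)

lemma sym_BDp:
  fixes f :: "'n::{finite,linorder} mpoly"
  shows "is_sym f \<Longrightarrow> is_sym (BDp a \<kappa> d f)"
  unfolding BDp_def by (intro sym_sum equivar_Kp_pow equivar_const)

lemma sym_add: "is_sym f \<Longrightarrow> is_sym g \<Longrightarrow> is_sym (f + g)"
  by (simp add: is_sym_def mlin_add[OF mlin_pperm])

lemma sym_diff: "is_sym f \<Longrightarrow> is_sym g \<Longrightarrow> is_sym (f - g)"
  by (simp add: is_sym_def mlin_diff[OF mlin_pperm])

lemma sym_scale: "is_sym f \<Longrightarrow> is_sym (mconst c * f)"
  by (simp add: is_sym_def mlin_scale[OF mlin_pperm])

lemma sym_0 [simp]: "is_sym 0"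
  by (simp add: is_sym_def mlin_0[OF mlin_pperm])

lemma sym_Sum: "(\<And>x. x \<in> A \<Longrightarrow> is_sym (f x)) \<Longrightarrow> is_sym (sum f A)"
  by (induction A rule: infinite_finite_induct) (auto intro: sym_add)

lemma sym_Emp: "is_sym f \<Longrightarrow> is_sym (Emp f)"
  unfolding Emp_def by (rule sym_sum) (simp add: equivar_def is_sym_def pperm_mderiv)

lemma sym_D2p:
  fixes f :: "'n::{finite,linorder} mpoly"
  shows "is_sym f \<Longrightarrow> is_sym (D2p \<kappa> f)"
  unfolding D2p_def by (intro sym_add sym_scale sym_mom)

lemma sym_DBp:
  fixes f :: "'n::{finite,linorder} mpoly"
  shows "is_sym f \<Longrightarrow> is_sym (DBp a \<kappa> f)"
  unfolding DBp_def by (intro sym_add sym_scale sym_mom sym_D2p sym_Emp)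

definition tlin :: "(('n \<Rightarrow> 'n mpoly) \<Rightarrow> 'n \<Rightarrow> 'n mpoly) \<Rightarrow> bool" where
  "tlin A \<longleftrightarrow> (\<forall>g h. A (\<lambda>i. g i + h i) = (\<lambda>i. A g i + A h i)) \<and> (\<forall>c g. A (\<lambda>i. mconst c * g i) = (\<lambda>i. mconst c * A g i))"

lemma tlin_add: "tlin A \<Longrightarrow> A (\<lambda>i. g i + h i) = (\<lambda>i. A g i + A h i)"
  and tlin_scale: "tlin A \<Longrightarrow> A (\<lambda>i. mconst c * g i) = (\<lambda>i. mconst c * A g i)"
  by (auto simp: tlin_def)

lemma tlin_Dp: "tlin (Dp \<kappa>)"
  unfolding tlin_def
proof (intro conjI allI ext)
  fix g h :: "'a \<Rightarrow> 'a mpoly" and c i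
  show "Dp \<kappa> (\<lambda>i. g i + h i) i = Dp \<kappa> g i + Dp \<kappa> h i"
    by (simp add: Dp_def mderiv_add mlin_add[OF mlin_ddiff] sum.distrib distrib_left)
  show "Dp \<kappa> (\<lambda>i. mconst c * g i) i = mconst c * Dp \<kappa> g i"
    by (simp add: Dp_def mlin_scale[OF mlin_ddiff] mlin_scale[OF mlin_mderiv] sum_distrib_left[symmetric] distrib_left mult.left_commute)
qed

lemma tlin_Lp: "tlin (Lp \<kappa>)"
  by (simp add: tlin_def Lp_def[abs_def] tlin_add[OF tlin_Dp] tlin_scale[OF tlin_Dp] distrib_left mult.left_commute)

lemma tlin_Kp: "tlin (Kp \<kappa> b)"
  unfolding tlin_def Kp_def[abs_def] tlin_add[OF tlin_Lp] tlin_scale[OF tlin_Lp] tlin_add[OF tlin_Dp] tlin_scale[OF tlin_Dp]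
  by (simp add: sum.distrib sum_distrib_left[symmetric] distrib_left mult.left_commute add_ac)

lemma tlin_pow: "tlin A \<Longrightarrow> tlin (A ^^ k)"
  by (induction k) (auto simp: tlin_def)

lemma tlin_mlin: "tlin A \<Longrightarrow> mlin (\<lambda>f. \<Sum>i\<in>I. A (\<lambda>_. f) i)"
  by (simp add: mlin_def tlin_def sum.distrib sum_distrib_left)

lemma mlin_mom: "mlin (mom \<kappa> k)"
  unfolding mom_def[abs_def] by (rule tlin_mlin[of "Lp \<kappa> ^^ k"]) (intro tlin_pow tlin_Lp)

lemma mlin_BDp: "mlin (BDp a \<kappa> d)"
  unfolding BDp_def[abs_def] by (rule tlin_mlin[of "Kp \<kappa> (b_par a \<kappa>) ^^ d"]) (intro tlin_pow tlin_Kp)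

lemma mlin_Emp: "mlin Emp"
  unfolding Emp_def[abs_def] by (intro mlin_Sum mlin_mderiv)

lemma mlin_D2p: "mlin (D2p \<kappa>)"
  unfolding D2p_def[abs_def] by (intro mlin_plus mlin_times mlin_mom)

lemma mlin_DBp: "mlin (DBp a \<kappa>)"
  unfolding DBp_def[abs_def] by (intro mlin_plus mlin_times mlin_mom mlin_D2p mlin_Emp)

declare One_nat_def [simp del]

section \<open>Triangularity\<close>

text \<open>Supports preserved by the degree-preserving operators built from \<open>Lp\<close>. The
  stronger \<open>closed_exps\<close> also admits the lowering of an exponent, as caused by
  \<open>Dp\<close> and \<open>Emp\<close>.\<close>

definition hclosed :: "('n::finite \<Rightarrow>\<^sub>0 nat) set \<Rightarrow> bool" where
  "hclosed S \<longleftrightarrow> (\<forall>k\<in>S. \<forall>i j c. i \<noteq> j \<longrightarrow> c \<le> lookup k i - lookup k j \<longrightarrow> stp i j k c \<in> S)"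

definition closed_exps :: "('n::finite \<Rightarrow>\<^sub>0 nat) set \<Rightarrow> bool" where
  "closed_exps S \<longleftrightarrow> hclosed S \<and> (\<forall>k\<in>S. \<forall>i. k - single i 1 \<in> S)"

lemma keys_add_subset: "keys p \<subseteq> S \<Longrightarrow> keys q \<subseteq> S \<Longrightarrow> keys (p + q) \<subseteq> S"
  using keys_add[of p q] by blast

lemma keys_scale_subset: "keys p \<subseteq> S \<Longrightarrow> keys (mconst c * p) \<subseteq> S"
  using keys_mconst_mult[of c p] by blast

lemma keys_sum_subset: "(\<And>x. x \<in> A \<Longrightarrow> keys (f x) \<subseteq> S) \<Longrightarrow> keys (sum f A :: 'n mpoly) \<subseteq> S"
proof (induction A rule: infinite_finite_induct)
  case (insert x F)
  then show ?case by (simp add: keys_add_subset)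
qed simp_all

lemma keys_diff_subset: "keys p \<subseteq> S \<Longrightarrow> keys q \<subseteq> S \<Longrightarrow> keys (p - q :: 'n mpoly) \<subseteq> S"
  by (auto simp: in_keys_iff lookup_minus subset_iff) (metis diff_zero)

lemma keys_stair: "closed_exps S \<Longrightarrow> k \<in> S \<Longrightarrow> i \<noteq> j \<Longrightarrow> keys (stair i j k) \<subseteq> S"
  unfolding stair_def by (intro keys_sum_subset) (auto simp: closed_exps_def hclosed_def)

lemma keys_ddiff:
  assumes "closed_exps S" "keys p \<subseteq> S" "i \<noteq> j"
  shows "keys (ddiff i j p) \<subseteq> S"
proof (rule mlin_keys[OF mlin_ddiff])
  fix k assume "k \<in> keys p"
  then show "keys (ddiff i j (single k 1)) \<subseteq> S"
    unfolding ddiff_def lin_single using assms by (intro keys_diff_subset keys_stair) auto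
qed

lemma keys_mvar_ddiff:
  assumes "hclosed S" "keys p \<subseteq> S" "i \<noteq> j"
  shows "keys (mvar i * ddiff i j p) \<subseteq> S"
proof (rule mlin_keys[of "\<lambda>p. mvar i * ddiff i j p"])
  fix k assume "k \<in> keys p"
  then have k: "k \<in> S" using assms by auto
  show "keys (mvar i * ddiff i j (single k 1)) \<subseteq> S"
    unfolding ddiff_def lin_single right_diff_distrib mvar_stair(1)[OF assms(3)] mvar_stair(2)[OF assms(3)[symmetric]]
    using assms(1) k \<open>i \<noteq> j\<close> by (intro keys_diff_subset keys_sum_subset) (auto simp: hclosed_def)
qed (intro mlin_times mlin_ddiff)

lemma mderiv_single': "mderiv i (single k 1) = mconst (real (lookup k i)) * single (k - single i 1) 1"
  by (simp only: mderiv_single mconst_def mult_single add_0_left mult_1_right)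

lemma mvar_mderiv_single: "mvar i * mderiv i (single k 1) = mconst (real (lookup k i)) * single k 1"
proof (cases "lookup k i = 0")
  case False
  then have "single i 1 + (k - single i 1) = k"
    by (intro poly_mapping_eqI) (auto simp: lookup_add lookup_minus lookup_single when_def)
  then have "mvar i * single (k - single i 1) 1 = single k 1"
    by (simp add: mvar_def mult_single)
  then show ?thesis
    unfolding mderiv_single' mult.left_commute[of "mvar i"] by simp
qed (simp add: mderiv_single')

lemma keys_mderiv: "closed_exps S \<Longrightarrow> keys p \<subseteq> S \<Longrightarrow> keys (mderiv i p) \<subseteq> S"
  by (rule mlin_keys[OF mlin_mderiv]) (auto simp: mderiv_single' closed_exps_def intro!: keys_scale_subset simp del: One_nat_def)

lemma keys_mvar_mderiv: "keys p \<subseteq> S \<Longrightarrow> keys (mvar i * mderiv i p) \<subseteq> S"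
  by (rule mlin_keys[of "\<lambda>p. mvar i * mderiv i p"]) (auto simp: mvar_mderiv_single intro!: keys_scale_subset mlin_times)

lemma keys_Dp: "closed_exps S \<Longrightarrow> (\<And>i. keys (g i) \<subseteq> S) \<Longrightarrow> keys (Dp \<kappa> g i) \<subseteq> S"
  unfolding Dp_def by (intro keys_add_subset keys_scale_subset keys_sum_subset keys_mderiv keys_ddiff) auto

lemma Lp_alt: "Lp \<kappa> g i = mvar i * mderiv i (g i) + mconst \<kappa> * (\<Sum>j\<in>UNIV - {i}. mvar i * ddiff i j (g i))"
  by (simp add: Lp_def Dp_def distrib_left sum_distrib_left mult.left_commute)

lemma keys_Lp: "hclosed S \<Longrightarrow> (\<And>i. keys (g i) \<subseteq> S) \<Longrightarrow> keys (Lp \<kappa> g i) \<subseteq> S"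
  unfolding Lp_alt by (intro keys_add_subset keys_scale_subset keys_sum_subset keys_mvar_mderiv keys_mvar_ddiff) auto

lemma closed_exps_hclosed: "closed_exps S \<Longrightarrow> hclosed S"
  by (simp add: closed_exps_def)

lemma keys_Kp: "closed_exps S \<Longrightarrow> (\<And>i. keys (g i) \<subseteq> S) \<Longrightarrow> keys (Kp \<kappa> b g i) \<subseteq> S"
  unfolding Kp_def by (intro keys_add_subset keys_scale_subset keys_sum_subset keys_Dp keys_Lp) (auto dest: closed_exps_hclosed)

lemma keys_Lp_pow: "hclosed S \<Longrightarrow> (\<And>i. keys (g i) \<subseteq> S) \<Longrightarrow> keys ((Lp \<kappa> ^^ k) g i) \<subseteq> S"
  by (induction k arbitrary: i) (simp, simp add: keys_Lp)

lemma keys_Kp_pow: "closed_exps S \<Longrightarrow> (\<And>i. keys (g i) \<subseteq> S) \<Longrightarrow> keys ((Kp \<kappa> b ^^ k) g i) \<subseteq> S"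
  by (induction k arbitrary: i) (simp, simp add: keys_Kp)

lemma keys_mom: "hclosed S \<Longrightarrow> keys f \<subseteq> S \<Longrightarrow> keys (mom \<kappa> k f) \<subseteq> S"
  unfolding mom_def by (intro keys_sum_subset keys_Lp_pow)

lemma keys_D2p: "hclosed S \<Longrightarrow> keys f \<subseteq> S \<Longrightarrow> keys (D2p \<kappa> f) \<subseteq> S"
  unfolding D2p_def by (intro keys_add_subset keys_scale_subset keys_mom)

lemma keys_Emp: "closed_exps S \<Longrightarrow> keys f \<subseteq> S \<Longrightarrow> keys (Emp f) \<subseteq> S"
  unfolding Emp_def by (intro keys_sum_subset keys_mderiv)

lemma keys_BDp: "closed_exps S \<Longrightarrow> keys f \<subseteq> S \<Longrightarrow> keys (BDp a \<kappa> d f) \<subseteq> S"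
  unfolding BDp_def by (intro keys_sum_subset keys_Kp_pow)

section \<open>Degree and square sum of exponents, and leading coefficients\<close>

definition deg :: "('n::finite \<Rightarrow>\<^sub>0 nat) \<Rightarrow> nat" where "deg k = (\<Sum>i\<in>UNIV. lookup k i)"
definition qn :: "('n::finite \<Rightarrow>\<^sub>0 nat) \<Rightarrow> nat" where "qn k = (\<Sum>i\<in>UNIV. (lookup k i)\<^sup>2)"

lemma sum_two:
  fixes f :: "'n::finite \<Rightarrow> 'b::comm_monoid_add"
  assumes "i \<noteq> j"
  shows "(\<Sum>m\<in>UNIV. f m) = f i + f j + (\<Sum>m\<in>UNIV - {i, j}. f m)"
proof -
  have "(\<Sum>m\<in>UNIV. f m) = f i + (f j + (\<Sum>m\<in>UNIV - {i} - {j}. f m))"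
    using assms by (simp add: sum.remove[of UNIV i] sum.remove[of "UNIV - {i}" j])
  also have "UNIV - {i} - {j} = UNIV - {i, j}" by auto
  finally show ?thesis by (simp add: add.assoc)
qed

lemma deg_stp: "i \<noteq> j \<Longrightarrow> c \<le> lookup k i \<Longrightarrow> deg (stp i j k c) = deg k"
  unfolding deg_def by (simp add: sum_two[of i j] lookup_stp)

text \<open>The loss is 2 c (k_i - c - k_j).\<close>

lemma qn_stp:
  assumes "i \<noteq> j" "c \<le> lookup k i - lookup k j"
  shows "qn (stp i j k c) \<le> qn k"
    and "0 < c \<Longrightarrow> c < lookup k i - lookup k j \<Longrightarrow> qn (stp i j k c) < qn k"
proof -
  let ?a = "lookup k i" and ?b = "lookup k j"
  have e: "qn (stp i j k c) = (?a - c)\<^sup>2 + (?b + c)\<^sup>2 + (\<Sum>m\<in>UNIV - {i, j}. (lookup k m)\<^sup>2)"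
    "qn k = ?a\<^sup>2 + ?b\<^sup>2 + (\<Sum>m\<in>UNIV - {i, j}. (lookup k m)\<^sup>2)"
    unfolding qn_def using assms(1) by (simp_all add: sum_two[of i j] lookup_stp)
  obtain u where u: "?a - c = u" "?a = u + c" "c = 0 \<or> ?b \<le> u"
    using assms(2) by (intro that[of "?a - c"]) auto
  show "qn (stp i j k c) \<le> qn k"
  proof (cases "c = 0")
    case False
    then obtain w where w: "u = ?b + w"
      using u(3) by (auto simp: le_iff_add)
    show ?thesis
      unfolding e u(1) unfolding u(2) w by (simp add: power2_eq_square algebra_simps)
  qed simp
  assume "0 < c" "c < ?a - ?b"
  then have "?b < u" using u by linarith
  then obtain w where w: "u = Suc (?b + w)"
    using less_iff_Suc_add by auto
  show "qn (stp i j k c) < qn k"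
    unfolding e u(1) unfolding u(2) w using \<open>0 < c\<close> by (simp add: power2_eq_square algebra_simps)
qed

lemma qn_minus:
  "qn (k - single i 1) \<le> qn k"
  "0 < lookup k i \<Longrightarrow> qn (k - single i 1) < qn k"
proof -
  show "qn (k - single i 1) \<le> qn k"
    unfolding qn_def by (intro sum_mono power_mono) (auto simp: lookup_minus)
  assume "0 < lookup k i"
  then show "qn (k - single i 1) < qn k"
  proof (unfold qn_def, intro sum_strict_mono_ex1)
    assume "0 < lookup k i"
    then have "(lookup (k - single i 1) i)\<^sup>2 < (lookup k i)\<^sup>2"
      by (intro power_strict_mono) (auto simp: lookup_minus)
    then show "\<exists>a\<in>UNIV. (lookup (k - single i 1) a)\<^sup>2 < (lookup k a)\<^sup>2"
      by blast
  qed (auto simp: lookup_minus intro!: power_mono)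
qed

lemma closed_qn: "closed_exps {k. qn k \<le> Q}"
  unfolding closed_exps_def hclosed_def by (auto intro: order.trans[OF qn_stp(1)] order.trans[OF qn_minus(1)])

lemma hclosed_deg: "hclosed {k. deg k = N}"
  unfolding hclosed_def by (auto simp: deg_stp)

text \<open>Each monomial that \<open>Dp\<close> produces has a smaller \<open>qn\<close> than the
  one it stems from. Hence the term 2 \<open>Dp\<close> in \<open>Kp\<close> leaves no trace in the
  eigenvalues.\<close>

lemma lead_Dp:
  assumes "\<And>i k. k \<in> keys (g i) \<Longrightarrow> qn k \<le> qn l"
  shows "lookup (Dp \<kappa> g i) l = 0"
proof -
  have "lookup (mderiv i (g i)) l = 0"
  proof -
    have "lookup (mderiv i (single k 1)) l = 0" if "k \<in> keys (g i)" for k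
      using assms[OF that] qn_minus(2)[of k i] by (cases "lookup k i = 0") (auto simp: mderiv_single' lookup_single when_def)
    then show ?thesis
      by (simp add: mlin_lookup[OF mlin_mderiv, where p = "g i"])
  qed
  moreover have "lookup (ddiff i j (g i)) l = 0" if "i \<noteq> j" for j
  proof -
    have st: "lookup (stair i j k) l = 0" if "i \<noteq> j" "qn k \<le> qn l" for i j k
    proof -
      have "stp i j k c - single i 1 \<noteq> l" if "c < lookup k i - lookup k j" for c
      proof -
        have "qn (stp i j k c - single i 1) < qn (stp i j k c)"
          using that \<open>i \<noteq> j\<close> by (intro qn_minus) (simp add: lookup_stp)
        also have "\<dots> \<le> qn k"
          using that \<open>i \<noteq> j\<close> by (intro qn_stp) auto
        finally show ?thesis using \<open>qn k \<le> qn l\<close> by auto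
      qed
      then show ?thesis
        by (simp add: stair_def lookup_sum lookup_single when_def del: One_nat_def)
    qed
    have "lookup (ddiff i j (single k 1)) l = 0" if "k \<in> keys (g i)" for k
      using st[OF \<open>i \<noteq> j\<close> assms[OF that]] st[OF \<open>i \<noteq> j\<close>[symmetric] assms[OF that]] by (simp add: ddiff_def lookup_minus)
    then show ?thesis
      by (simp add: mlin_lookup[OF mlin_ddiff, where p = "g i"])
  qed
  ultimately show ?thesis
    by (auto simp: Dp_def lookup_add lookup_sum intro!: sum.neutral)
qed

lemma kperm_transpose: "kperm (Transposition.transpose i j) (kperm (Transposition.transpose i j) k) = k"
  by (simp add: kperm_kperm)

text \<open>On the ladder between \<open>k\<close> and its transposition only the two ends keep the
  value of \<open>qn\<close>. The factor x_i selects \<open>k\<close> itself if k_i > k_j, and the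
  transposition, with a minus sign, if k_i < k_j.\<close>

lemma lead_mvar_ddiff:
  assumes ij: "i \<noteq> j" and q: "\<And>k. k \<in> keys p \<Longrightarrow> qn k \<le> qn l"
  shows "lookup (mvar i * ddiff i j p) l =
    (if lookup l j < lookup l i
     then lookup p l - lookup p (kperm (Transposition.transpose i j) l) else 0)"
proof -
  let ?s = "kperm (Transposition.transpose i j)"
  let ?c = "lookup l j < lookup l i"
  have one: "lookup (mvar i * ddiff i j (single k 1)) l =
      (if ?c \<and> k = l then 1 else 0) - (if ?c \<and> k = ?s l then 1 else 0)" if k: "k \<in> keys p" for k
  proof -
    let ?a = "lookup k i" and ?b = "lookup k j"
    have "stp i j k c = l \<longleftrightarrow> c = 0 \<and> k = l" if "c < ?a - ?b" for c
      using qn_stp(2)[OF ij, of c k] that q[OF k] by (cases "c = 0") auto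
    then have "lookup (\<Sum>c<?a - ?b. single (stp i j k c) (1::real)) l
        = (\<Sum>c<?a - ?b. if c = 0 then (if k = l then 1 else 0) else 0)"
      unfolding lookup_sum lookup_single when_def by (intro sum.cong refl) auto
    then have 1: "lookup (\<Sum>c<?a - ?b. single (stp i j k c) (1::real)) l = (if ?b < ?a \<and> k = l then 1 else 0)"
      by (auto simp: sum.delta)
    have "stp j i k (Suc c) = l \<longleftrightarrow> Suc c = ?b - ?a \<and> k = ?s l" if "c < ?b - ?a" for c
    proof (cases "Suc c = ?b - ?a")
      case True
      then have "stp j i k (Suc c) = ?s k"
        using stp_full[of j i k] ij that by (simp add: transpose_commute[of j i])
      then show ?thesis
        using True kperm_transpose by metis
    next
      case False
      then show ?thesis
        using qn_stp(2)[OF ij[symmetric], of "Suc c" k] that q[OF k] by auto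
    qed
    then have "lookup (\<Sum>c<?b - ?a. single (stp j i k (Suc c)) (1::real)) l
        = (\<Sum>c<?b - ?a. if c = ?b - ?a - 1 then (if k = ?s l then 1 else 0) else 0)"
      unfolding lookup_sum lookup_single when_def by (intro sum.cong refl) auto
    then have 2: "lookup (\<Sum>c<?b - ?a. single (stp j i k (Suc c)) (1::real)) l = (if ?a < ?b \<and> k = ?s l then 1 else 0)"
      by (auto simp: sum.delta)
    have "?c \<Longrightarrow> ?s l \<noteq> l"
      by (metis lookup_kperm transpose_apply_first less_irrefl)
    moreover have "k = ?s l \<Longrightarrow> ?a = lookup l j \<and> ?b = lookup l i"
      by simp
    ultimately show ?thesis
      unfolding ddiff_def lin_single right_diff_distrib mvar_stair(1)[OF ij] mvar_stair(2)[OF ij[symmetric]] lookup_minus 1 2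
      by auto
  qed
  have "lookup (mvar i * ddiff i j p) l = (\<Sum>k\<in>keys p. lookup p k *
      ((if ?c \<and> k = l then 1 else 0) - (if ?c \<and> k = ?s l then 1 else 0)))"
    unfolding mlin_lookup[of "\<lambda>p. mvar i * ddiff i j p" p, OF mlin_times[OF mlin_ddiff]]
    by (intro sum.cong refl) (simp add: one)
  also have "\<dots> = (\<Sum>k\<in>keys p. if k = l then (if ?c then lookup p l else 0) else 0)
     - (\<Sum>k\<in>keys p. if k = ?s l then (if ?c then lookup p (?s l) else 0) else 0)"
    unfolding sum_subtractf[symmetric] by (intro sum.cong refl) auto
  finally show ?thesis
    by (auto simp: in_keys_iff)
qed

text \<open>The action of \<open>L\<close> on the coefficients of \<open>x\<^sup>l\<close> in a tuple whose exponents have square sum at most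
  that of the partition \<open>l\<close>.\<close>

definition Tm :: "real \<Rightarrow> ('n::{finite,linorder} \<Rightarrow> nat) \<Rightarrow> ('n \<Rightarrow> real) \<Rightarrow> 'n \<Rightarrow> real" where
  "Tm \<kappa> l v i = (real (l i) + \<kappa> * real (card {i<..})) * v i - \<kappa> * (\<Sum>j\<in>{i<..}. v j)"

lemma lead_Lp:
  fixes g :: "'n \<Rightarrow> 'n::{finite,linorder} mpoly"
  assumes g: "equivar g" and l: "is_partition l"
    and q: "\<And>i k. k \<in> keys (g i) \<Longrightarrow> qn k \<le> qn (xp l)"
  shows "lookup (Lp \<kappa> g i) (xp l) = Tm \<kappa> l (\<lambda>j. lookup (g j) (xp l)) i"
proof -
  let ?v = "\<lambda>j. lookup (g j) (xp l)"
  have gj: "lookup (g i) (kperm (Transposition.transpose i j) (xp l)) = ?v j" for j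
  proof -
    have "g j = pperm (Transposition.transpose i j) (g i)"
      using g bij_transpose[of i j] unfolding equivar_def by (metis transpose_apply_first)
    then show ?thesis
      by (simp add: lookup_pperm)
  qed
  \<comment> \<open>For a partition, \<open>l j < l i\<close> forces \<open>i < j\<close>. Where the
    two entries agree, so do the two coefficients, and the condition may be replaced by
    \<open>i < j\<close>.\<close>
  have 1: "lookup (mvar i * ddiff i j (g i)) (xp l) = (if i < j then ?v i - ?v j else 0)" if "j \<in> UNIV - {i}" for j
  proof -
    have ij: "i \<noteq> j" using that by auto
    have e: "lookup (mvar i * ddiff i j (g i)) (xp l) = (if l j < l i then ?v i - ?v j else 0)"
      using lead_mvar_ddiff[OF ij q] by (simp add: gj)
    consider "l j < l i" | "l i < l j" | "l i = l j" by linarith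
    then show ?thesis
    proof cases
      case 1
      then have "i < j"
        using l unfolding is_partition_def by (metis antimonoD leD not_le_imp_less ij linorder_less_linear less_imp_le)
      then show ?thesis using e 1 by simp
    next
      case 2
      then have "\<not> i < j"
        using l unfolding is_partition_def by (metis antimonoD leD less_imp_le)
      then show ?thesis using e 2 by simp
    next
      case 3
      then have "kperm (Transposition.transpose i j) (xp l) = xp l"
        by (intro poly_mapping_eqI) (auto simp: Transposition.transpose_def)
      then have "?v i = ?v j" using gj[of j] by simp
      then show ?thesis using e 3 by simp
    qed
  qed
  have "(\<Sum>j\<in>UNIV - {i}. lookup (mvar i * ddiff i j (g i)) (xp l)) = (\<Sum>j\<in>UNIV - {i}. if i < j then ?v i - ?v j else 0)"
    by (rule sum.cong[OF refl 1])
  also have "\<dots> = (\<Sum>j\<in>{i<..}. ?v i - ?v j)"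
    by (intro sum.mono_neutral_cong_right) auto
  also have "\<dots> = real (card {i<..}) * ?v i - (\<Sum>j\<in>{i<..}. ?v j)"
    by (simp add: sum_subtractf)
  finally have 2: "(\<Sum>j\<in>UNIV - {i}. lookup (mvar i * ddiff i j (g i)) (xp l)) = real (card {i<..}) * ?v i - (\<Sum>j\<in>{i<..}. ?v j)" .
  have 3: "lookup (mvar i * mderiv i (g i)) (xp l) = real (l i) * ?v i"
  proof -
    have "lookup (mvar i * mderiv i (g i)) (xp l) =
        (\<Sum>k\<in>keys (g i). if k = xp l then real (l i) * ?v i else 0)"
      unfolding mlin_lookup[of "\<lambda>p. mvar i * mderiv i p" "g i", OF mlin_times[OF mlin_mderiv]] mvar_mderiv_single
      by (intro sum.cong refl) (auto simp: lookup_single when_def)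
    then show ?thesis by (simp add: in_keys_iff)
  qed
  show ?thesis
    unfolding Lp_alt lookup_add lookup_mconst_mult lookup_sum 2 3 Tm_def by (simp add: algebra_simps)
qed

definition Km :: "real \<Rightarrow> real \<Rightarrow> ('n::{finite,linorder} \<Rightarrow> nat) \<Rightarrow> ('n \<Rightarrow> real) \<Rightarrow> 'n \<Rightarrow> real" where
  "Km \<kappa> b l v i = Tm \<kappa> l (Tm \<kappa> l v) i + b * Tm \<kappa> l v i + \<kappa> * (\<Sum>j\<in>UNIV. Tm \<kappa> l v j)"

definition mom_eig :: "real \<Rightarrow> nat \<Rightarrow> ('n::{finite,linorder} \<Rightarrow> nat) \<Rightarrow> real" where
  "mom_eig \<kappa> k l = (\<Sum>i\<in>UNIV. (Tm \<kappa> l ^^ k) (\<lambda>_. 1) i)"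

definition BD_eig :: "real \<Rightarrow> real \<Rightarrow> nat \<Rightarrow> ('n::{finite,linorder} \<Rightarrow> nat) \<Rightarrow> real" where
  "BD_eig a \<kappa> d l = (\<Sum>i\<in>UNIV. (Km \<kappa> (b_par a \<kappa>) l ^^ d) (\<lambda>_. 1) i)"

lemma Tm_scale: "Tm \<kappa> l (\<lambda>j. v j * c) = (\<lambda>i. Tm \<kappa> l v i * c)"
  by (simp add: Tm_def fun_eq_iff sum_distrib_right[symmetric] left_diff_distrib mult.assoc)

lemma Km_scale: "Km \<kappa> b l (\<lambda>j. v j * c) = (\<lambda>i. Km \<kappa> b l v i * c)"
  by (simp add: Km_def fun_eq_iff Tm_scale sum_distrib_right[symmetric] distrib_right mult.assoc)

lemma pow_scale:
  fixes A :: "('n \<Rightarrow> real) \<Rightarrow> 'n \<Rightarrow> real"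
  assumes "\<And>v. A (\<lambda>j. v j * c) = (\<lambda>i. A v i * (c :: real))"
  shows "(A ^^ k) (\<lambda>j. v j * c) = (\<lambda>i. (A ^^ k) v i * c)"
proof (induction k)
  case (Suc k)
  show ?case
    unfolding funpow.simps o_apply Suc by (rule assms)
qed simp

lemma lead_Lp_pow:
  fixes g :: "'n \<Rightarrow> 'n::{finite,linorder} mpoly"
  assumes g: "equivar g" and l: "is_partition l"
    and q: "\<And>i. keys (g i) \<subseteq> {k. qn k \<le> qn (xp l)}"
  shows "(\<lambda>i. lookup ((Lp \<kappa> ^^ k) g i) (xp l)) = (Tm \<kappa> l ^^ k) (\<lambda>j. lookup (g j) (xp l))"
proof (induction k)
  case (Suc k)
  have "keys ((Lp \<kappa> ^^ k) g i) \<subseteq> {k. qn k \<le> qn (xp l)}" for i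
    by (rule keys_Lp_pow[OF closed_exps_hclosed[OF closed_qn] q])
  then have "lookup ((Lp \<kappa> ^^ Suc k) g i) (xp l) = Tm \<kappa> l (\<lambda>j. lookup ((Lp \<kappa> ^^ k) g j) (xp l)) i" for i
    unfolding funpow.simps o_apply by (intro lead_Lp equivar_Lp_pow g l) auto
  then show ?case
    unfolding Suc by simp
qed simp

lemma lead_Kp:
  fixes g :: "'n \<Rightarrow> 'n::{finite,linorder} mpoly"
  assumes g: "equivar g" and l: "is_partition l"
    and q: "\<And>i. keys (g i) \<subseteq> {k. qn k \<le> qn (xp l)}"
  shows "lookup (Kp \<kappa> b g i) (xp l) = Km \<kappa> b l (\<lambda>j. lookup (g j) (xp l)) i"
proof -
  have q2: "keys (Lp \<kappa> g i) \<subseteq> {k. qn k \<le> qn (xp l)}" for i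
    by (rule keys_Lp[OF closed_exps_hclosed[OF closed_qn] q])
  have 1: "lookup (Lp \<kappa> g i) (xp l) = Tm \<kappa> l (\<lambda>j. lookup (g j) (xp l)) i" for i
    using q by (intro lead_Lp g l) auto
  have 2: "lookup (Lp \<kappa> (Lp \<kappa> g) i) (xp l) = Tm \<kappa> l (\<lambda>j. lookup (Lp \<kappa> g j) (xp l)) i" for i
    using q2 by (intro lead_Lp equivar_Lp g l) auto
  have 3: "lookup (Dp \<kappa> g i) (xp l) = 0"
    using q by (intro lead_Dp) auto
  show ?thesis
    unfolding Kp_def lookup_add lookup_mconst_mult lookup_sum 2 3 unfolding 1 Km_def by simp
qed

lemma lead_Kp_pow:
  fixes g :: "'n \<Rightarrow> 'n::{finite,linorder} mpoly"
  assumes g: "equivar g" and l: "is_partition l"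
    and q: "\<And>i. keys (g i) \<subseteq> {k. qn k \<le> qn (xp l)}"
  shows "(\<lambda>i. lookup ((Kp \<kappa> b ^^ k) g i) (xp l)) = (Km \<kappa> b l ^^ k) (\<lambda>j. lookup (g j) (xp l))"
proof (induction k)
  case (Suc k)
  have "lookup ((Kp \<kappa> b ^^ Suc k) g i) (xp l) = Km \<kappa> b l (\<lambda>j. lookup ((Kp \<kappa> b ^^ k) g j) (xp l)) i" for i
    unfolding funpow.simps o_apply by (intro lead_Kp equivar_Kp_pow g l keys_Kp_pow[OF closed_qn q])
  then show ?case
    unfolding Suc by simp
qed simp

text \<open>The diagonal entry is required at every partition of maximal \<open>qn\<close>, because
  a symmetric polynomial may contain several of them.\<close>

definition triangular :: "('n::{finite,linorder} mpoly \<Rightarrow> 'n mpoly) \<Rightarrow> (('n \<Rightarrow> nat) \<Rightarrow> real) \<Rightarrow> bool" where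
  "triangular T e \<longleftrightarrow> mlin T \<and> (\<forall>f. is_sym f \<longrightarrow> is_sym (T f)) \<and>
     (\<forall>S f. closed_exps S \<longrightarrow> keys f \<subseteq> S \<longrightarrow> keys (T f) \<subseteq> S) \<and>
     (\<forall>f l. is_sym f \<longrightarrow> is_partition l \<longrightarrow> keys f \<subseteq> {k. qn k \<le> qn (xp l)} \<longrightarrow>
        lookup (T f) (xp l) = e l * lookup f (xp l))"

lemma triD:
  assumes "triangular T e"
  shows tri_mlin: "mlin T"
    and tri_sym: "is_sym f \<Longrightarrow> is_sym (T f)"
    and tri_keys: "closed_exps S \<Longrightarrow> keys f \<subseteq> S \<Longrightarrow> keys (T f) \<subseteq> S"
    and tri_lead: "is_sym f \<Longrightarrow> is_partition l \<Longrightarrow> keys f \<subseteq> {k. qn k \<le> qn (xp l)} \<Longrightarrow>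
        lookup (T f) (xp l) = e l * lookup f (xp l)"
  using assms by (auto simp: triangular_def)

lemma tri_mom: "triangular (mom \<kappa> k) (mom_eig \<kappa> k)"
  unfolding triangular_def
proof (intro conjI allI impI)
  fix f :: "'a mpoly" and l :: "'a \<Rightarrow> nat"
  assume f: "is_sym f" "is_partition l" "keys f \<subseteq> {k. qn k \<le> qn (xp l)}"
  show "lookup (mom \<kappa> k f) (xp l) = mom_eig \<kappa> k l * lookup f (xp l)"
    using fun_cong[OF lead_Lp_pow[OF equivar_const[OF f(1)] f(2,3), where \<kappa> = \<kappa> and k = k]]
      pow_scale[where A = "Tm \<kappa> l", OF Tm_scale, where k = k and v = "\<lambda>_. 1" and c = "lookup f (xp l)"]
    by (simp add: mom_def lookup_sum mom_eig_def sum_distrib_right)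
qed (simp_all add: mlin_mom sym_mom keys_mom closed_exps_hclosed)

lemma tri_BDp: "triangular (BDp a \<kappa> d) (BD_eig a \<kappa> d)"
  unfolding triangular_def
proof (intro conjI allI impI)
  fix f :: "'a mpoly" and l :: "'a \<Rightarrow> nat"
  assume f: "is_sym f" "is_partition l" "keys f \<subseteq> {k. qn k \<le> qn (xp l)}"
  show "lookup (BDp a \<kappa> d f) (xp l) = BD_eig a \<kappa> d l * lookup f (xp l)"
    using fun_cong[OF lead_Kp_pow[OF equivar_const[OF f(1)] f(2,3), where \<kappa> = \<kappa> and b = "b_par a \<kappa>" and k = d]]
      pow_scale[where A = "Km \<kappa> (b_par a \<kappa>) l", OF Km_scale, where k = d and v = "\<lambda>_. 1" and c = "lookup f (xp l)"]
    by (simp add: BDp_def lookup_sum BD_eig_def sum_distrib_right)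
next
  fix S and f :: "'a mpoly"
  assume "closed_exps S" "keys f \<subseteq> S"
  then show "keys (BDp a \<kappa> d f) \<subseteq> S"
    by (rule keys_BDp)
qed (auto intro: mlin_BDp sym_BDp)

lemma tri_Emp: "triangular Emp (\<lambda>_. 0)"
  unfolding triangular_def
proof (intro conjI allI impI)
  fix f :: "'a mpoly" and l :: "'a \<Rightarrow> nat"
  assume f: "is_sym f" "is_partition l" "keys f \<subseteq> {k. qn k \<le> qn (xp l)}"
  have "lookup (mderiv i f) (xp l) = 0" for i
    using f(3) lead_Dp[of "\<lambda>_. f" "xp l" 0 i] by (auto simp: Dp_def)
  then show "lookup (Emp f) (xp l) = 0 * lookup f (xp l)"
    by (simp add: Emp_def lookup_sum)
next
  fix S and f :: "'a mpoly"
  assume "closed_exps S" "keys f \<subseteq> S"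
  then show "keys (Emp f) \<subseteq> S"
    by (rule keys_Emp)
qed (auto intro: mlin_Emp sym_Emp)

lemma tri_plus:
  assumes "triangular T e" "triangular U f"
  shows "triangular (\<lambda>p. T p + U p) (\<lambda>l. e l + f l)"
  unfolding triangular_def
proof (intro conjI allI impI)
  fix S and p :: "'a mpoly"
  assume "closed_exps S" "keys p \<subseteq> S"
  then show "keys (T p + U p) \<subseteq> S"
    by (intro keys_add_subset tri_keys[OF assms(1)] tri_keys[OF assms(2)])
qed (simp_all add: mlin_plus tri_mlin[OF assms(1)] tri_mlin[OF assms(2)] sym_add tri_sym[OF assms(1)] tri_sym[OF assms(2)]
    lookup_add distrib_right tri_lead[OF assms(1)] tri_lead[OF assms(2)])

lemma tri_times:
  assumes "triangular T e"
  shows "triangular (\<lambda>p. mconst c * T p) (\<lambda>l. c * e l)"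
  unfolding triangular_def
proof (intro conjI allI impI)
  fix S and p :: "'a mpoly"
  assume "closed_exps S" "keys p \<subseteq> S"
  then show "keys (mconst c * T p) \<subseteq> S"
    by (intro keys_scale_subset tri_keys[OF assms])
qed (simp_all add: mlin_times tri_mlin[OF assms] sym_scale tri_sym[OF assms] tri_lead[OF assms])

lemma mom_eig_1: "mom_eig \<kappa> 1 l = real (sum l UNIV)"
  by (simp add: mom_eig_def Tm_def One_nat_def algebra_simps)

lemma card_less_greater: "real (card {..<i}) = real (card (UNIV :: 'n::{finite,linorder} set)) - 1 - real (card {i :: 'n<..})"
proof -
  have "UNIV = {..<i} \<union> {i<..} \<union> {i}" by auto
  then have "card (UNIV :: 'n set) = card ({..<i} \<union> {i<..} \<union> {i})" by simp
  also have "\<dots> = card {..<i} + card {i<..} + 1"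
    by (subst card_Un_disjoint; (subst card_Un_disjoint)?) auto
  finally show ?thesis by simp
qed

lemma sum_greater: "(\<Sum>i\<in>UNIV. \<Sum>j\<in>{i<..}. v j) = (\<Sum>j\<in>UNIV. real (card {..<j :: 'n::{finite,linorder}}) * v j)"
proof -
  have "(\<Sum>i\<in>UNIV. \<Sum>j\<in>{i<..}. v j) = (\<Sum>i\<in>UNIV. \<Sum>j\<in>UNIV. if i < j then v j else 0)"
    by (intro sum.cong refl sum.mono_neutral_cong_left) auto
  also have "\<dots> = (\<Sum>j\<in>UNIV. \<Sum>i\<in>UNIV. if i < j then v j else 0)"
    by (rule sum.swap)
  also have "\<dots> = (\<Sum>j\<in>UNIV. real (card {..<j}) * v j)"
  proof (intro sum.cong refl)
    fix j :: 'n
    have "(\<Sum>i\<in>UNIV. if i < j then v j else 0) = (\<Sum>i\<in>{..<j}. v j)"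
      by (intro sum.mono_neutral_cong_right) auto
    then show "(\<Sum>i\<in>UNIV. if i < j then v j else 0) = real (card {..<j}) * v j"
      by simp
  qed
  finally show ?thesis .
qed

text \<open>Interchanging the summations turns the upper triangular part of \<open>Tm\<close> into
  -\<kappa>(i - 1) l_i. With i - 1 = (n - 1) - (n - i) this supplies the second \<kappa>(n - i) l_i,
  and the rest cancels against the added multiple of the degree.\<close>

lemma D2_eig: "mom_eig \<kappa> 2 l + (\<kappa> * (real (card (UNIV :: 'n set)) - 1) - 1) * mom_eig \<kappa> 1 l = d_eig \<kappa> l"
  for l :: "'n::{finite,linorder} \<Rightarrow> nat"
proof -
  have T1: "Tm \<kappa> l (\<lambda>_. 1) = (\<lambda>i. real (l i))"
    by (simp add: Tm_def fun_eq_iff algebra_simps)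
  have "mom_eig \<kappa> 2 l = (\<Sum>i\<in>UNIV. (real (l i) + \<kappa> * real (card {i<..})) * real (l i)) - \<kappa> * (\<Sum>i\<in>UNIV. \<Sum>j\<in>{i<..}. real (l j))"
    by (simp add: mom_eig_def numeral_2_eq_2 T1) (simp add: Tm_def sum_subtractf sum_distrib_left)
  also have "\<dots> = (\<Sum>i\<in>UNIV. (real (l i) + \<kappa> * real (card {i<..})) * real (l i) - \<kappa> * (real (card {..<i}) * real (l i)))"
    by (simp add: sum_greater sum_subtractf sum_distrib_left)
  finally show ?thesis
    unfolding mom_eig_1 d_eig_def card_less_greater
    by (simp add: sum_distrib_left sum.distrib[symmetric]) (simp add: algebra_simps)
qed

lemma tri_D2p: "triangular (D2p \<kappa>) (d_eig \<kappa>)"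
  unfolding D2p_def[abs_def] D2_eig[symmetric, abs_def] by (intro tri_plus tri_times tri_mom)

lemma tri_DBp: "triangular (DBp a \<kappa>) (e_eig a \<kappa>)"
proof -
  have e: "e_eig a \<kappa> = (\<lambda>l :: 'a \<Rightarrow> nat. d_eig \<kappa> l + a * mom_eig \<kappa> 1 l + 2 * 0)"
    by (simp add: e_eig_def mom_eig_1 fun_eq_iff)
  show ?thesis
    unfolding DBp_def[abs_def] e by (intro tri_plus tri_times tri_mom tri_D2p tri_Emp)
qed

lemma sym_lookup: "is_sym f \<Longrightarrow> bij \<sigma> \<Longrightarrow> lookup f (kperm \<sigma> k) = lookup f k"
  by (metis lookup_pperm is_sym_def)

text \<open>Maximise the sum of (n - i) k_(\<sigma> i) over all permutations; exchanging a pair in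
  the wrong order would increase it.\<close>

lemma exists_sorting: "\<exists>\<sigma>. bij \<sigma> \<and> is_partition (lookup (kperm \<sigma> k))"
  for k :: "'n::{finite,linorder} \<Rightarrow>\<^sub>0 nat"
proof -
  define W where "W \<sigma> = (\<Sum>i\<in>UNIV. int (card {i<..}) * int (lookup k (\<sigma> i)))" for \<sigma> :: "'n \<Rightarrow> 'n"
  define B where "B = {\<sigma> :: 'n \<Rightarrow> 'n. bij \<sigma>}"
  have fin: "finite (W ` B)"
    by simp
  have "id \<in> B"
    by (simp add: B_def)
  then have "Max (W ` B) \<in> W ` B"
    by (intro Max_in fin) blast
  then obtain \<sigma> where "\<sigma> \<in> B" and m: "Max (W ` B) = W \<sigma>"
    by (rule imageE)
  moreover have "W \<tau> \<le> W \<sigma>" if "\<tau> \<in> B" for \<tau>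
    unfolding m[symmetric] using that by (intro Max_ge fin imageI)
  ultimately have s: "bij \<sigma>" "\<And>\<tau>. bij \<tau> \<Longrightarrow> W \<tau> \<le> W \<sigma>"
    by (simp_all add: B_def)
  have "is_partition (lookup (kperm \<sigma> k))"
    unfolding is_partition_def
  proof (rule antimonoI, rule ccontr)
    fix i j :: 'n
    assume ij: "i \<le> j" and "\<not> lookup (kperm \<sigma> k) j \<le> lookup (kperm \<sigma> k) i"
    then have lt: "lookup k (\<sigma> i) < lookup k (\<sigma> j)" by simp
    then have ne: "i < j" using ij by (cases "i = j") auto
    let ?t = "\<sigma> \<circ> Transposition.transpose i j"
    have d: "card {j<..} < card {i<..}"
      using ne by (intro psubset_card_mono) auto
    have "bij ?t" using s(1) by (simp add: bij_comp)
    then have "W ?t \<le> W \<sigma>" by (rule s(2))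
    then have "int (card {i<..}) * int (lookup k (\<sigma> j)) + int (card {j<..}) * int (lookup k (\<sigma> i))
      \<le> int (card {i<..}) * int (lookup k (\<sigma> i)) + int (card {j<..}) * int (lookup k (\<sigma> j))"
      unfolding W_def using ne by (simp add: sum_two[of i j])
    then have "(int (card {i<..}) - int (card {j<..})) * (int (lookup k (\<sigma> j)) - int (lookup k (\<sigma> i))) \<le> 0"
      by (simp add: algebra_simps)
    moreover have "0 < (int (card {i<..}) - int (card {j<..})) * (int (lookup k (\<sigma> j)) - int (lookup k (\<sigma> i)))"
      using d lt by (intro mult_pos_pos) auto
    ultimately show False by linarith
  qed
  then show ?thesis using s(1) by blast
qed

lemma qn_kperm: "bij \<sigma> \<Longrightarrow> qn (kperm \<sigma> k) = qn k"
  unfolding qn_def lookup_kperm by (rule sum.reindex_bij_betw)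

lemma deg_kperm: "bij \<sigma> \<Longrightarrow> deg (kperm \<sigma> k) = deg k"
  unfolding deg_def lookup_kperm by (rule sum.reindex_bij_betw)

lemma top_key:
  fixes f :: "'n::{finite,linorder} mpoly"
  assumes "is_sym f" "f \<noteq> 0"
  obtains l where "is_partition l" "xp l \<in> keys f" "keys f \<subseteq> {k. qn k \<le> qn (xp l)}"
proof -
  have "keys f \<noteq> {}" using assms by auto
  then have "Max (qn ` keys f) \<in> qn ` keys f" by (intro Max_in) auto
  then obtain k where k: "k \<in> keys f" "qn k = Max (qn ` keys f)" by auto
  obtain \<sigma> where s: "bij \<sigma>" "is_partition (lookup (kperm \<sigma> k))"
    using exists_sorting by blast
  show thesis
  proof (rule that)
    show "is_partition (lookup (kperm \<sigma> k))" by fact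
    show "xp (lookup (kperm \<sigma> k)) \<in> keys f"
      using k s sym_lookup[OF assms(1) s(1), of k] by (simp add: in_keys_iff)
    show "keys f \<subseteq> {k'. qn k' \<le> qn (xp (lookup (kperm \<sigma> k)))}"
      using k(2) by (auto simp: qn_kperm s(1))
  qed
qed

text \<open>The eigenvalue is read off at a sorted exponent of maximal \<open>qn\<close>.\<close>

lemma eigen_top:
  fixes f :: "'n::{finite,linorder} mpoly"
  assumes "triangular T e" "is_sym f" "f \<noteq> 0" "T f = mconst c * f"
  obtains l where "is_partition l" "xp l \<in> keys f" "e l = c"
proof -
  obtain l where l: "is_partition l" "xp l \<in> keys f" "keys f \<subseteq> {k. qn k \<le> qn (xp l)}"
    using top_key assms by blast
  have "e l * lookup f (xp l) = c * lookup f (xp l)"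
    unfolding tri_lead[OF assms(1,2) l(1,3), symmetric] assms(4) by simp
  moreover have "lookup f (xp l) \<noteq> 0"
    using l(2) by (simp add: in_keys_iff)
  ultimately have "e l = c"
    by (metis mult_cancel_right)
  then show thesis
    by (rule that[OF l(1,2)])
qed

lemma poly_op_eqI:
  assumes "rpoly p = rpoly q" shows "p = q"
  using assms by simp

lemma D2p_mom_commute:
  fixes f :: "'n::{finite,linorder} mpoly"
  assumes f: "is_sym f"
  shows "mom \<kappa> 2 (mom \<kappa> k f) = mom \<kappa> k (mom \<kappa> 2 f)"
proof (rule poly_op_eqI)
  have "rpoly (mom \<kappa> 2 (mom \<kappa> k f)) = lx.Hs \<kappa> (\<Sum>i\<in>UNIV. (lx.Lx \<kappa> ^^ k) (\<lambda>_. rpoly f) i)"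
    unfolding rpoly_mom2[OF sym_mom[OF f]] rpoly_mom[OF f] ..
  also have "\<dots> = rpoly (mom \<kappa> k (mom \<kappa> 2 f))"
    unfolding lx.Hs_moment by (simp add: rpoly_mom[OF sym_mom[OF f]] rpoly_mom2[OF f])
  finally show "rpoly (mom \<kappa> 2 (mom \<kappa> k f)) = rpoly (mom \<kappa> k (mom \<kappa> 2 f))" .
qed

lemma DBp_BDp_commute:
  fixes f :: "'n::{finite,linorder} mpoly"
  assumes f: "is_sym f"
  shows "DBp a \<kappa> (BDp a \<kappa> d f) = BDp a \<kappa> d (DBp a \<kappa> f)"
  by (rule poly_op_eqI)
    (simp add: DB_op_rpoly[symmetric] DB_higher_rpoly[symmetric] sym_BDp sym_DBp f DB_commute)

text \<open>Dominance of the decreasing rearrangements (up to total degree): a partial sum of the largest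
  entries is a maximum over the subsets \<open>J\<close> of the given size.\<close>

definition dom_le :: "('n::finite \<Rightarrow>\<^sub>0 nat) \<Rightarrow> ('n \<Rightarrow>\<^sub>0 nat) \<Rightarrow> bool" where
  "dom_le k l \<longleftrightarrow> (\<forall>I. \<exists>J. card J = card I \<and> (\<Sum>i\<in>I. lookup k i) \<le> (\<Sum>i\<in>J. lookup l i))"

lemma dom_le_refl: "dom_le k k"
  unfolding dom_le_def by blast

lemma dom_le_trans: "dom_le k l \<Longrightarrow> dom_le l m \<Longrightarrow> dom_le k m"
  unfolding dom_le_def by (metis order_trans)

lemma dom_le_kperm: "bij \<sigma> \<Longrightarrow> dom_le (kperm \<sigma> k) k"
  unfolding dom_le_def
proof
  fix I
  assume b: "bij \<sigma>"
  then have i: "inj_on \<sigma> I" by (meson bij_is_inj inj_on_subset subset_UNIV)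
  show "\<exists>J. card J = card I \<and> (\<Sum>i\<in>I. lookup (kperm \<sigma> k) i) \<le> (\<Sum>i\<in>J. lookup k i)"
    by (rule exI[of _ "\<sigma> ` I"]) (simp add: card_image i sum.reindex)
qed

lemma dom_le_mono: "(\<And>i. lookup k i \<le> lookup l i) \<Longrightarrow> dom_le k l"
  unfolding dom_le_def by (rule allI, rule exI, rule conjI[OF refl], rule sum_mono)

text \<open>Only a set that contains \<open>j\<close> but not \<open>i\<close> gains from the
  transfer. Exchanging \<open>j\<close> for \<open>i\<close> makes up for this, since k_j + c \<le>
  k_i.\<close>

lemma dom_le_stp:
  assumes "i \<noteq> j" "c \<le> lookup k i - lookup k j"
  shows "dom_le (stp i j k c) k"
  unfolding dom_le_def
proof
  fix I
  let ?k = "lookup k" and ?s = "lookup (stp i j k c)"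
  show "\<exists>J. card J = card I \<and> (\<Sum>i\<in>I. ?s i) \<le> (\<Sum>i\<in>J. ?k i)"
  proof (cases "0 < c \<and> j \<in> I \<and> i \<notin> I")
    case True
    let ?J = "insert i (I - {j})"
    have "(\<Sum>m\<in>I. ?s m) = ?s j + (\<Sum>m\<in>I - {j}. ?s m)"
      using True by (simp add: sum.remove)
    also have "(\<Sum>m\<in>I - {j}. ?s m) = (\<Sum>m\<in>I - {j}. ?k m)"
      using True assms(1) by (intro sum.cong refl) (auto simp: lookup_stp)
    also have "?s j + (\<Sum>m\<in>I - {j}. ?k m) \<le> (\<Sum>m\<in>?J. ?k m)"
    proof -
      have "?k j + c \<le> ?k i" using True assms(2) by linarith
      then show ?thesis using True assms(1) by (simp add: lookup_stp)
    qed
    finally have "(\<Sum>m\<in>I. ?s m) \<le> (\<Sum>m\<in>?J. ?k m)" .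
    moreover have "card ?J = card I"
      using True by (simp add: card_Diff_singleton card_gt_0_iff) (metis Suc_diff_1 card_gt_0_iff empty_iff finite)
    ultimately show ?thesis by blast
  next
    case False
    have "(\<Sum>m\<in>I. ?s m) \<le> (\<Sum>m\<in>I. ?k m)"
    proof (cases "0 < c \<and> j \<in> I")
      case True
      then have "j \<in> I" by simp
      have "i \<in> I" using True False by blast
      have e: "(\<Sum>m\<in>I. f m) = f i + f j + (\<Sum>m\<in>I - {i, j}. f m)" for f :: "'a \<Rightarrow> nat"
      proof -
        have "(\<Sum>m\<in>I. f m) = f i + (f j + (\<Sum>m\<in>I - {i} - {j}. f m))"
          using assms(1) \<open>i \<in> I\<close> \<open>j \<in> I\<close> by (simp add: sum.remove[of I i] sum.remove[of "I - {i}" j])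
        also have "I - {i} - {j} = I - {i, j}" by auto
        finally show ?thesis by simp
      qed
      have "(\<Sum>m\<in>I - {i, j}. ?s m) = (\<Sum>m\<in>I - {i, j}. ?k m)"
        using assms(1) by (intro sum.cong refl) (auto simp: lookup_stp)
      then show ?thesis
        using assms by (simp add: e lookup_stp)
    next
      case False
      then show ?thesis
        using assms(1) by (cases "c = 0") (auto intro!: sum_mono simp: lookup_stp)
    qed
    then show ?thesis by blast
  qed
qed

text \<open>Strict decrease of \<open>qn\<close> is built in, so that \<open>Cs_partition\<close>
  need not extract it from dominance. The degree is left free for the sake of the lowering
  operators.\<close>

definition Cs :: "('n::finite \<Rightarrow>\<^sub>0 nat) \<Rightarrow> ('n \<Rightarrow>\<^sub>0 nat) set" where
  "Cs l = {k. dom_le k l \<and> ((\<exists>\<sigma>. bij \<sigma> \<and> k = kperm \<sigma> l) \<or> qn k < qn l)}"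

lemma Cs_refl: "l \<in> Cs l"
  using bij_id kperm_id[of l] by (auto simp: Cs_def dom_le_refl intro!: exI[of _ id])

lemma Cs_kperm: "bij \<sigma> \<Longrightarrow> kperm \<sigma> l \<in> Cs l"
  by (auto simp: Cs_def dom_le_kperm)

lemma Cs_qn: "k \<in> Cs l \<Longrightarrow> qn k \<le> qn l"
  by (auto simp: Cs_def qn_kperm)

lemma Cs_trans:
  assumes "k \<in> Cs m" "m \<in> Cs l"
  shows "k \<in> Cs l"
proof -
  have "dom_le k l" using assms by (auto simp: Cs_def intro: dom_le_trans)
  moreover have "(\<exists>\<sigma>. bij \<sigma> \<and> k = kperm \<sigma> l) \<or> qn k < qn l"
  proof (cases "qn k < qn l")
    case False
    then have "\<not> qn k < qn m" "\<not> qn m < qn l"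
      using Cs_qn[OF assms(1)] Cs_qn[OF assms(2)] by linarith+
    then obtain \<sigma> \<tau> where "bij \<sigma>" "k = kperm \<sigma> m" "bij \<tau>" "m = kperm \<tau> l"
      using assms by (auto simp: Cs_def)
    then have "bij (\<tau> \<circ> \<sigma>)" "k = kperm (\<tau> \<circ> \<sigma>) l"
      by (simp_all add: bij_comp kperm_kperm)
    then show ?thesis by blast
  qed simp
  ultimately show ?thesis by (simp add: Cs_def)
qed

lemma stp_in_Cs:
  assumes "i \<noteq> j" "c \<le> lookup k i - lookup k j"
  shows "stp i j k c \<in> Cs k"
proof -
  consider "c = 0" | "0 < c" "c < lookup k i - lookup k j"
    | "0 < c" "c = lookup k i - lookup k j"
    using assms(2) by linarith
  then show ?thesis
  proof cases
    case 1 then show ?thesis by (simp add: Cs_refl)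
  next
    case 2 then show ?thesis using qn_stp(2)[OF assms] dom_le_stp[OF assms] by (simp add: Cs_def)
  next
    case 3
    then have "lookup k j \<le> lookup k i" by linarith
    then show ?thesis unfolding 3(2) using stp_full[OF assms(1), of k] by (simp add: Cs_kperm)
  qed
qed

lemma minus_in_Cs: "k - single i 1 \<in> Cs k"
proof (cases "lookup k i = 0")
  case True
  then have "k - single i 1 = k"
    by (intro poly_mapping_eqI) (auto simp: lookup_minus lookup_single when_def)
  then show ?thesis by (simp add: Cs_refl)
next
  case False
  then show ?thesis
    using qn_minus(2)[of k i] by (auto simp: Cs_def lookup_minus intro!: dom_le_mono)
qed

lemma closed_Cs: "closed_exps (Cs l)"
  unfolding closed_exps_def hclosed_def using stp_in_Cs minus_in_Cs Cs_trans by blast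

lemma deg_Cs: "k \<in> Cs l \<Longrightarrow> deg k \<le> deg l"
proof -
  assume "k \<in> Cs l"
  then obtain J where J: "card J = card (UNIV :: 'a set)" "deg k \<le> (\<Sum>i\<in>J. lookup l i)"
    by (auto simp: Cs_def dom_le_def deg_def)
  then have "J = UNIV" by (simp add: card_eq_UNIV_imp_eq_UNIV)
  then show ?thesis using J by (simp add: deg_def)
qed

text \<open>The indices of \<open>J\<close> outside the segment carry entries at most
  \<open>l i\<close>. Equally many indices of the segment lie outside \<open>J\<close>, and their
  entries are at least \<open>l i\<close>.\<close>

lemma sum_le_initial:
  fixes l :: "'n::{finite,linorder} \<Rightarrow> nat"
  assumes l: "is_partition l" and c: "card J = card {..i}"
  shows "sum l J \<le> sum l {..i}"
proof -
  have f: "finite J" by simp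
  have "card (J - {..i}) = card ({..i} - J)"
    using c by (metis card_le_sym_Diff card_Diff_subset_Int Int_commute finite)
  moreover have "sum l (J - {..i}) \<le> card (J - {..i}) * l i"
    using l by (intro sum_bounded_above[where K = "l i", simplified]) (auto simp: is_partition_def antimono_def)
  moreover have "card ({..i} - J) * l i \<le> sum l ({..i} - J)"
    using l by (intro sum_bounded_below[where K = "l i", simplified]) (auto simp: is_partition_def antimono_def)
  ultimately have "sum l (J - {..i}) \<le> sum l ({..i} - J)" by simp
  moreover have "sum l J = sum l (J \<inter> {..i}) + sum l (J - {..i})"
    by (simp add: sum.Int_Diff)
  moreover have "sum l {..i} = sum l (J \<inter> {..i}) + sum l ({..i} - J)"
    by (metis Int_commute finite sum.Int_Diff)
  ultimately show ?thesis by linarith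
qed

lemma dom_le_partial_sums:
  fixes l m :: "'n::{finite,linorder} \<Rightarrow> nat"
  assumes "is_partition l" "dom_le (xp m) (xp l)"
  shows "sum m {..i} \<le> sum l {..i}"
proof -
  obtain J where "card J = card {..i}" "sum m {..i} \<le> sum l J"
    using assms(2) unfolding dom_le_def lookup_xp by blast
  then show ?thesis using sum_le_initial[OF assms(1)] by (meson order_trans)
qed

lemma partial_sums_eqI:
  fixes l m :: "'n::{finite,linorder} \<Rightarrow> nat"
  assumes "\<And>i. sum m {..i} = sum l {..i}"
  shows "m = l"
proof
  fix i
  show "m i = l i"
  proof (induction "card {..<i}" arbitrary: i rule: less_induct)
    case less
    have "m j = l j" if "j < i" for j
      using that by (intro less psubset_card_mono) auto
    then have "sum m {..<i} = sum l {..<i}" by (intro sum.cong) auto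
    moreover have "{..i} = insert i {..<i}" by auto
    ultimately show ?case using assms[of i] by simp
  qed
qed

text \<open>Each of the two partitions dominates the other, so all partial sums agree.\<close>

lemma partition_unique:
  fixes l m :: "'n::{finite,linorder} \<Rightarrow> nat"
  assumes "is_partition l" "is_partition m" "bij \<sigma>" "xp m = kperm \<sigma> (xp l)"
  shows "m = l"
proof (rule partial_sums_eqI, rule antisym)
  fix i
  show "sum m {..i} \<le> sum l {..i}"
    using assms dom_le_kperm[of \<sigma> "xp l"] by (intro dom_le_partial_sums) auto
  have "xp l = kperm (inv \<sigma>) (xp m)"
    using assms by (simp add: kperm_inv)
  then show "sum l {..i} \<le> sum m {..i}"
    using assms dom_le_kperm[of "inv \<sigma>" "xp m"] by (intro dom_le_partial_sums) (auto simp: bij_imp_bij_inv)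
qed

lemma Cs_partition:
  fixes l m :: "'n::{finite,linorder} \<Rightarrow> nat"
  assumes "is_partition l" "is_partition m" "xp m \<in> Cs (xp l)" "m \<noteq> l"
  shows "qn (xp m) < qn (xp l)"
  using assms partition_unique[OF assms(1,2)] by (auto simp: Cs_def)

text \<open>Formulated with \<open>Cs\<close> because its closure under transfers bounds the
  supports of the operators. \<open>Lam_dominated\<close> leads back to the dominance order in the
  definition of Jack polynomials.\<close>

definition jack_support :: "('n::{finite,linorder} \<Rightarrow> nat) \<Rightarrow> ('n \<Rightarrow> nat) set" where
  "jack_support l = {m. is_partition m \<and> xp m \<in> Cs (xp l) \<and> deg (xp m) = deg (xp l)}"

lemma finite_bounded_funs: "finite {m :: 'n::finite \<Rightarrow> nat. \<forall>i. m i \<le> N}"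
proof -
  have "finite {m :: 'n \<Rightarrow> nat. \<forall>i. (i \<in> UNIV \<longrightarrow> m i \<in> {..N}) \<and> (i \<notin> UNIV \<longrightarrow> m i = 0)}"
    by (rule finite_set_of_finite_funs) auto
  then show ?thesis by simp
qed

lemma finite_deg_le: "finite {m :: 'n::finite \<Rightarrow> nat. deg (xp m) \<le> N}"
proof (rule finite_subset[OF _ finite_bounded_funs[of N]], safe)
  fix m :: "'n \<Rightarrow> nat" and i
  assume "deg (xp m) \<le> N"
  moreover have "m i \<le> deg (xp m)"
    by (simp add: deg_def member_le_sum)
  ultimately show "m i \<le> N" by linarith
qed

lemma finite_qn_le: "finite {m :: 'n::finite \<Rightarrow> nat. qn (xp m) \<le> N}"
proof (rule finite_subset[OF _ finite_bounded_funs[of N]], safe)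
  fix m :: "'n \<Rightarrow> nat" and i
  assume "qn (xp m) \<le> N"
  moreover have "(m i)\<^sup>2 \<le> qn (xp m)"
    unfolding qn_def lookup_xp by (rule member_le_sum) auto
  moreover have "m i \<le> (m i)\<^sup>2" by (simp add: power2_eq_square)
  ultimately show "m i \<le> N" by linarith
qed

lemma finite_Lam: "finite (jack_support l)"
  by (rule finite_subset[OF _ finite_deg_le[of "deg (xp l)"]]) (auto simp: jack_support_def)

lemma Lam_dominated:
  assumes "is_partition l" "m \<in> jack_support l"
  shows "dominated m l"
  using assms dom_le_partial_sums[OF assms(1), of m]
  by (auto simp: dominated_def jack_support_def deg_def Cs_def)

text \<open>Abel summation: \<open>w\<close> is a sum of indicators of the sets {i. t < w i}, and
  each nonempty one is an initial segment.\<close>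

lemma partition_layers:
  fixes w :: "'n::{finite,linorder} \<Rightarrow> nat" and v :: "'n \<Rightarrow> int"
  assumes w: "is_partition w" and v: "\<And>i. 0 \<le> sum v {..i}"
  shows "0 \<le> (\<Sum>i\<in>UNIV. int (w i) * v i)"
proof -
  obtain W where W: "\<And>i. w i \<le> W"
    by (meson finite_UNIV finite_imageI Max_ge rangeI)
  have "int (w i) * v i = (\<Sum>t<W. if t < w i then v i else 0)" for i
  proof -
    have "(\<Sum>t<W. if t < w i then v i else 0) = (\<Sum>t<w i. v i)"
      using W[of i] by (intro sum.mono_neutral_cong_right) auto
    then show ?thesis by simp
  qed
  then have "(\<Sum>i\<in>UNIV. int (w i) * v i) = (\<Sum>t<W. \<Sum>i\<in>UNIV. if t < w i then v i else 0)"
    by (simp only:) (rule sum.swap)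
  also have "0 \<le> \<dots>"
  proof (rule sum_nonneg)
    fix t
    show "0 \<le> (\<Sum>i\<in>UNIV. if t < w i then v i else 0)"
    proof (cases "{i. t < w i} = {}")
      case False
      define M where "M = Max {i. t < w i}"
      have "M \<in> {i. t < w i}" unfolding M_def by (rule Max_in[OF _ False]) simp
      then have M: "t < w M" by simp
      have "{i. t < w i} = {..M}"
      proof (intro set_eqI iffI)
        fix i assume "i \<in> {..M}"
        then have "w M \<le> w i" using w by (auto simp: is_partition_def antimono_def)
        then show "i \<in> {i. t < w i}" using M by simp
      qed (auto simp: M_def)
      then have "(\<Sum>i\<in>UNIV. if t < w i then v i else 0) = sum v {..M}"
        by (simp add: sum.If_cases)
      then show ?thesis using v by simp
    qed simp
  qed
  finally show ?thesis .
qed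

text \<open>With v = l - m one has |l|^2 = |m|^2 + |v|^2 + 2 <m, v>, and
  \<open>partition_layers\<close> shows that the scalar product is nonnegative.\<close>

lemma dominated_qn:
  fixes l m :: "'n::{finite,linorder} \<Rightarrow> nat"
  assumes "is_partition m" "dominated m l" "m \<noteq> l"
  shows "qn (xp m) < qn (xp l)"
proof -
  define v where "v i = int (l i) - int (m i)" for i
  have "sum v {..i} = int (sum l {..i}) - int (sum m {..i})" for i
    by (simp add: v_def sum_subtractf)
  then have "0 \<le> sum v {..i}" for i
    using assms(2) by (simp add: dominated_def of_nat_sum[symmetric] del: of_nat_sum)
  then have "0 \<le> (\<Sum>i\<in>UNIV. int (m i) * v i)"
    by (rule partition_layers[OF assms(1)])
  moreover have "0 < (\<Sum>i\<in>UNIV. (v i)\<^sup>2)"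
  proof -
    obtain i where "m i \<noteq> l i" using assms(3) by auto
    then have "0 < (v i)\<^sup>2" by (simp add: v_def)
    then show ?thesis by (intro sum_pos2[of _ i]) auto
  qed
  moreover have "int (qn (xp l)) = int (qn (xp m)) + (\<Sum>i\<in>UNIV. (v i)\<^sup>2) + 2 * (\<Sum>i\<in>UNIV. int (m i) * v i)"
    by (simp add: qn_def v_def sum_distrib_left sum.distrib[symmetric] power2_eq_square) (simp add: algebra_simps)
  ultimately show ?thesis by linarith
qed

section \<open>Monomial symmetric polynomials\<close>

lemma sum_single_lookup:
  fixes A :: "('n::finite \<Rightarrow> nat) set"
  assumes "finite A"
  shows "lookup (\<Sum>\<alpha>\<in>A. single (xp \<alpha>) (1::real)) k = (if lookup k \<in> A then 1 else 0)"
proof -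
  have "lookup (\<Sum>\<alpha>\<in>A. single (xp \<alpha>) (1::real)) k = (\<Sum>\<alpha>\<in>A. if \<alpha> = lookup k then 1 else 0)"
    unfolding lookup_sum by (intro sum.cong refl) (auto simp: lookup_single when_def)
  then show ?thesis using assms by simp
qed

lemma prod_mvar: "finite I \<Longrightarrow> (\<Prod>i\<in>I. mvar i ^ \<alpha> i) = single (\<Sum>i\<in>I. single i (\<alpha> i)) 1"
proof (induction I rule: finite_induct)
  case (insert i I)
  have "mvar i ^ m = single (single i m) 1" for m
    by (induction m) (simp_all add: mvar_def mult_single single_add[symmetric] One_nat_def)
  then show ?case using insert by (simp add: mult_single)
qed simp

lemma lookup_monomial_sym:
  "lookup (monomial_sym l) k = (if \<exists>\<sigma>. bij \<sigma> \<and> k = kperm \<sigma> (xp l) then 1 else 0)"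
proof -
  have e: "(\<Sum>i\<in>UNIV. single i (\<alpha> i)) = xp \<alpha>" for \<alpha> :: "'a \<Rightarrow> nat"
    by (rule poly_mapping_eqI) (simp add: lookup_sum lookup_single when_def)
  have "finite ((\<lambda>\<sigma>. l \<circ> \<sigma>) ` {\<sigma> :: 'a \<Rightarrow> 'a. bij \<sigma>})" by simp
  then have "finite {l \<circ> \<sigma> |\<sigma> :: 'a \<Rightarrow> 'a. bij \<sigma>}"
    by (rule rev_finite_subset) blast
  moreover have "lookup k \<in> {l \<circ> \<sigma> |\<sigma> :: 'a \<Rightarrow> 'a. bij \<sigma>} \<longleftrightarrow> (\<exists>\<sigma>. bij \<sigma> \<and> k = kperm \<sigma> (xp l))"
    unfolding kperm_def lookup_xp by (auto intro!: poly_mapping_eqI)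
  ultimately show ?thesis
    by (simp add: monomial_sym_def prod_mvar e sum_single_lookup)
qed

lemma sym_monomial_sym: "is_sym (monomial_sym l)"
  unfolding is_sym_def
proof (intro allI impI poly_mapping_eqI)
  fix \<sigma> :: "'a \<Rightarrow> 'a" and k
  assume b: "bij \<sigma>"
  have "(\<exists>\<tau>. bij \<tau> \<and> kperm \<sigma> k = kperm \<tau> (xp l)) = (\<exists>\<tau>. bij \<tau> \<and> k = kperm \<tau> (xp l))"
  proof safe
    fix \<tau> :: "'a \<Rightarrow> 'a"
    assume t: "bij \<tau>"
    { assume "kperm \<sigma> k = kperm \<tau> (xp l)"
      then have "k = kperm (\<tau> \<circ> inv \<sigma>) (xp l)"
        using kperm_inv[OF b] by (metis kperm_kperm)
      then show "\<exists>\<tau>. bij \<tau> \<and> k = kperm \<tau> (xp l)"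
        using t b by (intro exI[of _ "\<tau> \<circ> inv \<sigma>"]) (simp add: bij_comp bij_imp_bij_inv) }
    show "\<exists>\<tau>'. bij \<tau>' \<and> kperm \<sigma> (kperm \<tau> (xp l)) = kperm \<tau>' (xp l)"
      using t b by (intro exI[of _ "\<tau> \<circ> \<sigma>"]) (simp add: bij_comp kperm_kperm)
  qed
  then show "lookup (pperm \<sigma> (monomial_sym l)) k = lookup (monomial_sym l) k"
    by (simp add: lookup_pperm b lookup_monomial_sym)
qed

lemma keys_monomial_sym: "keys (monomial_sym l) \<subseteq> Cs (xp l) \<inter> {k. deg k = deg (xp l)}"
  by (auto simp: in_keys_iff lookup_monomial_sym Cs_kperm deg_kperm split: if_splits)

lemma lookup_monomial_sym_partition:
  assumes "is_partition l" "is_partition m"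
  shows "lookup (monomial_sym l) (xp m) = (if m = l then 1 else 0)"
  using partition_unique[OF assms] bij_id kperm_id[of "xp l"] by (auto simp: lookup_monomial_sym)

lemma sym_eqI:
  fixes f g :: "'n::{finite,linorder} mpoly"
  assumes "is_sym f" "is_sym g" "\<And>m. is_partition m \<Longrightarrow> lookup f (xp m) = lookup g (xp m)"
  shows "f = g"
proof (rule poly_mapping_eqI)
  fix k :: "'n \<Rightarrow>\<^sub>0 nat"
  obtain \<sigma> where s: "bij \<sigma>" "is_partition (lookup (kperm \<sigma> k))"
    using exists_sorting by blast
  then show "lookup f k = lookup g k"
    using assms(3)[OF s(2)] sym_lookup[OF assms(1) s(1), of k] sym_lookup[OF assms(2) s(1), of k] by simp
qed

lemma sym_expand:
  fixes f :: "'n::{finite,linorder} mpoly"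
  assumes f: "is_sym f" and M: "finite M" "\<And>m. m \<in> M \<Longrightarrow> is_partition m"
    "\<And>m. is_partition m \<Longrightarrow> xp m \<in> keys f \<Longrightarrow> m \<in> M"
  shows "f = (\<Sum>m\<in>M. mconst (lookup f (xp m)) * monomial_sym m)"
proof (rule sym_eqI[OF f])
  show "is_sym (\<Sum>m\<in>M. mconst (lookup f (xp m)) * monomial_sym m)"
    by (intro sym_Sum sym_scale sym_monomial_sym)
  fix m :: "'n \<Rightarrow> nat"
  assume m: "is_partition m"
  have "lookup (\<Sum>m\<in>M. mconst (lookup f (xp m)) * monomial_sym m) (xp m)
     = (\<Sum>m'\<in>M. if m' = m then lookup f (xp m) else 0)"
    unfolding lookup_sum lookup_mconst_mult
    by (intro sum.cong refl) (auto simp: lookup_monomial_sym_partition M m)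
  also have "\<dots> = lookup f (xp m)"
    using M m by (auto simp: in_keys_iff)
  finally show "lookup f (xp m) = lookup (\<Sum>m\<in>M. mconst (lookup f (xp m)) * monomial_sym m) (xp m)" ..
qed

text \<open>For triangular \<open>D\<close> with diagonal entries \<open>e\<close>, the factors taken in decreasing order kill one
  leading term after the other.\<close>

definition prodop :: "('n mpoly \<Rightarrow> 'n mpoly) \<Rightarrow> ('b \<Rightarrow> real) \<Rightarrow> 'b list \<Rightarrow> 'n mpoly \<Rightarrow> 'n mpoly" where
  "prodop D e xs f = fold (\<lambda>x f. D f - mconst (e x) * f) xs f"

lemma prodop_simps [simp]:
  "prodop D e [] f = f" "prodop D e (x # xs) f = prodop D e xs (D f - mconst (e x) * f)"
  by (simp_all add: prodop_def)

text \<open>All factors are polynomials in \<open>D\<close>, so a further one may be applied last or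
  first.\<close>

lemma prodop_commute:
  assumes "mlin D"
  shows "D (prodop D e xs f) - mconst c * prodop D e xs f = prodop D e xs (D f - mconst c * f)"
proof (induction xs arbitrary: f)
  case (Cons x xs)
  have "D (D f - mconst (e x) * f) - mconst c * (D f - mconst (e x) * f) = D (D f - mconst c * f) - mconst (e x) * (D f - mconst c * f)"
    by (simp only: mlin_diff[OF assms] mlin_scale[OF assms]) (simp add: algebra_simps)
  then show ?case using Cons by simp
qed simp

lemma prodop_tri:
  assumes "triangular D e" "is_sym f" "is_partition l" "keys f \<subseteq> Cs (xp l)"
  shows "is_sym (prodop D g xs f)" "keys (prodop D g xs f) \<subseteq> Cs (xp l)"
    "lookup (prodop D g xs f) (xp l) = (\<Prod>x\<leftarrow>xs. e l - g x) * lookup f (xp l)"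
proof -
  have "is_sym (prodop D g xs f) \<and> keys (prodop D g xs f) \<subseteq> Cs (xp l) \<and>
    lookup (prodop D g xs f) (xp l) = (\<Prod>x\<leftarrow>xs. e l - g x) * lookup f (xp l)"
    using assms(2,4)
  proof (induction xs arbitrary: f)
    case (Cons x xs)
    let ?f = "D f - mconst (g x) * f"
    have "is_sym ?f"
      using Cons.prems tri_sym[OF assms(1)] by (intro sym_diff sym_scale)
    moreover have "keys ?f \<subseteq> Cs (xp l)"
      using Cons.prems by (intro keys_diff_subset keys_scale_subset tri_keys[OF assms(1) closed_Cs])
    moreover have "lookup ?f (xp l) = (e l - g x) * lookup f (xp l)"
    proof -
      have "keys f \<subseteq> {k. qn k \<le> qn (xp l)}"
        using Cons.prems(2) Cs_qn by blast
      from tri_lead[OF assms(1) Cons.prems(1) assms(3) this] show ?thesis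
        by (simp add: lookup_minus left_diff_distrib)
    qed
    ultimately show ?case using Cons.IH[of ?f] by (simp add: mult_ac)
  qed simp
  then show "is_sym (prodop D g xs f)" "keys (prodop D g xs f) \<subseteq> Cs (xp l)"
    "lookup (prodop D g xs f) (xp l) = (\<Prod>x\<leftarrow>xs. e l - g x) * lookup f (xp l)"
    by auto
qed

text \<open>The list may repeat elements of \<open>M\<close>. In a product this only raises factors
  of the leading coefficient to powers, which does not affect whether it vanishes.\<close>

definition qsort :: "('n::finite \<Rightarrow> nat) set \<Rightarrow> ('n \<Rightarrow> nat) list" where
  "qsort M = sort_key (\<lambda>m. - int (qn (xp m))) (SOME ys. set ys = M)"

lemma set_qsort: "finite M \<Longrightarrow> set (qsort M) = M"
  unfolding qsort_def by (simp add: someI_ex[OF finite_list])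

lemma sorted_qsort: "sorted_wrt (\<lambda>m m'. qn (xp m') \<le> qn (xp m)) (qsort M)"
proof -
  have "sorted (map (\<lambda>m. - int (qn (xp m))) (qsort M))"
    by (simp add: qsort_def)
  then show ?thesis by (simp add: sorted_map)
qed

section \<open>Sets of partitions closed under D_2, and annihilating products\<close>

lemma hclosed_UN: "(\<And>x. x \<in> A \<Longrightarrow> hclosed (S x)) \<Longrightarrow> hclosed (\<Union>x\<in>A. S x)"
  unfolding hclosed_def by fast

lemma hclosed_Int: "hclosed S \<Longrightarrow> hclosed T \<Longrightarrow> hclosed (S \<inter> T)"
  unfolding hclosed_def by simp

lemma hclosed_level: "hclosed (Cs l \<inter> {k. deg k = N})"
  by (intro hclosed_Int closed_exps_hclosed closed_Cs hclosed_deg)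

lemma refl_Lam: "is_partition l \<Longrightarrow> l \<in> jack_support l"
  by (simp add: jack_support_def Cs_refl)

lemma Lam_trans: "m \<in> jack_support l \<Longrightarrow> x \<in> jack_support m \<Longrightarrow> x \<in> jack_support l"
  by (auto simp: jack_support_def intro: Cs_trans)

lemma Lam_qn: "is_partition l \<Longrightarrow> m \<in> jack_support l \<Longrightarrow> m \<noteq> l \<Longrightarrow> qn (xp m) < qn (xp l)"
  by (auto simp: jack_support_def intro: Cs_partition)

definition jack_closed :: "('n::{finite,linorder} \<Rightarrow> nat) set \<Rightarrow> bool" where
  "jack_closed A \<longleftrightarrow> (\<forall>y\<in>A. is_partition y \<and> jack_support y \<subseteq> A)"

lemma lamclosed_Lam: "jack_closed (jack_support l)"
  unfolding jack_closed_def
proof (intro ballI conjI subsetI)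
  fix y x assume y: "y \<in> jack_support l"
  then show "is_partition y" by (simp add: jack_support_def)
  assume "x \<in> jack_support y"
  with y show "x \<in> jack_support l" by (rule Lam_trans)
qed

abbreviation qdesc :: "('n::finite \<Rightarrow> nat) list \<Rightarrow> bool" where
  "qdesc \<equiv> sorted_wrt (\<lambda>m m'. qn (xp m') \<le> qn (xp m))"

lemma lamclosed_tl:
  assumes "jack_closed (set (x # xs))" "qdesc (x # xs)"
  shows "jack_closed (set xs)"
  unfolding jack_closed_def
proof (intro ballI conjI subsetI)
  fix y m
  assume y: "y \<in> set xs"
  then show p: "is_partition y" using assms(1) by (auto simp: jack_closed_def)
  assume m: "m \<in> jack_support y"
  then have "m \<in> set (x # xs)" using y assms(1) by (auto simp: jack_closed_def)
  \<comment> \<open>If \<open>x\<close> and \<open>y\<close> are different, then \<open>x\<close>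
    cannot lie in the support of \<open>y\<close>: it would have a smaller \<open>qn\<close>,
    against the ordering of the list.\<close>
  moreover have "m = x \<Longrightarrow> x \<in> set xs"
    using Lam_qn[OF p m] assms(2) y by (cases "x = y") auto
  ultimately show "m \<in> set xs" by auto
qed

definition supp_in :: "('n::{finite,linorder} \<Rightarrow> nat) set \<Rightarrow> 'n mpoly \<Rightarrow> bool" where
  "supp_in A f \<longleftrightarrow> is_sym f \<and> (\<forall>m. is_partition m \<and> xp m \<in> keys f \<longrightarrow> m \<in> A)"

lemma supp_in_keys:
  assumes "supp_in A f"
  shows "keys f \<subseteq> (\<Union>y\<in>A. Cs (xp y) \<inter> {k. deg k = deg (xp y)})"
proof
  fix k assume k: "k \<in> keys f"
  obtain \<sigma> where s: "bij \<sigma>" "is_partition (lookup (kperm \<sigma> k))"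
    using exists_sorting by blast
  let ?m = "lookup (kperm \<sigma> k)"
  have "xp ?m \<in> keys f"
    using k s sym_lookup[of f \<sigma> k] assms by (simp add: in_keys_iff supp_in_def)
  then have "?m \<in> A" using assms s by (simp add: supp_in_def)
  moreover have "k = kperm (inv \<sigma>) (xp ?m)"
    using s by (simp add: kperm_inv)
  then have "k \<in> Cs (xp ?m)" "deg k = deg (xp ?m)"
    using Cs_kperm[OF bij_imp_bij_inv[OF s(1)], of "xp ?m"] deg_kperm[OF bij_imp_bij_inv[OF s(1)], of "xp ?m"] by simp_all
  ultimately show "k \<in> (\<Union>y\<in>A. Cs (xp y) \<inter> {k. deg k = deg (xp y)})" by blast
qed

lemma supp_inI:
  assumes "jack_closed A" "is_sym f" "keys f \<subseteq> (\<Union>y\<in>A. Cs (xp y) \<inter> {k. deg k = deg (xp y)})"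
  shows "supp_in A f"
  unfolding supp_in_def
proof (intro conjI allI impI)
  fix m assume m: "is_partition m \<and> xp m \<in> keys f"
  then obtain y where "y \<in> A" "xp m \<in> Cs (xp y)" "deg (xp m) = deg (xp y)"
    using assms(3) by blast
  then show "m \<in> A"
    using assms(1) m by (auto simp: jack_closed_def jack_support_def)
qed fact

lemma hclosed_supp: "hclosed (\<Union>y\<in>A. Cs (xp y) \<inter> {k. deg k = deg (xp y)})"
  by (intro hclosed_UN hclosed_level)

lemma supp_in_empty: "supp_in {} f \<Longrightarrow> f = 0"
  using top_key[of f] by (auto simp: supp_in_def)

lemma supp_in_qn:
  assumes "supp_in (set (x # xs)) f" "qdesc (x # xs)"
  shows "keys f \<subseteq> {k. qn k \<le> qn (xp x)}"
proof
  fix k assume "k \<in> keys f"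
  then obtain y where "y \<in> set (x # xs)" "k \<in> Cs (xp y)"
    using supp_in_keys[OF assms(1)] by blast
  then show "k \<in> {k. qn k \<le> qn (xp x)}"
    using assms(2) Cs_qn[of k "xp y"] by auto
qed

lemma supp_in_remove:
  assumes "supp_in (set (x # xs)) f" "lookup f (xp x) = 0"
  shows "supp_in (set xs) f"
  using assms by (auto simp: supp_in_def in_keys_iff)

lemma supp_in_D2p:
  assumes "jack_closed A" "supp_in A f"
  shows "supp_in A (D2p \<kappa> f)"
proof (rule supp_inI[OF assms(1)])
  show "is_sym (D2p \<kappa> f)"
    using assms(2) by (simp add: sym_D2p supp_in_def)
qed (rule keys_D2p[OF hclosed_supp supp_in_keys[OF assms(2)]])

lemma supp_in_diff:
  assumes "jack_closed A" "supp_in A f" "supp_in A g"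
  shows "supp_in A (f - mconst c * g)"
proof (rule supp_inI[OF assms(1)])
  show "is_sym (f - mconst c * g)"
    using assms(2,3) by (simp add: sym_diff sym_scale supp_in_def)
qed (rule keys_diff_subset[OF supp_in_keys[OF assms(2)] keys_scale_subset[OF supp_in_keys[OF assms(3)]]])

lemma prodop_annihilates:
  "jack_closed (set xs) \<Longrightarrow> qdesc xs \<Longrightarrow> supp_in (set xs) f \<Longrightarrow> prodop (D2p \<kappa>) (d_eig \<kappa>) xs f = 0"
proof (induction xs arbitrary: f)
  case Nil
  then show ?case using supp_in_empty by simp
next
  case (Cons x xs)
  let ?g = "D2p \<kappa> f - mconst (d_eig \<kappa> x) * f"
  have x: "is_partition x" using Cons.prems(1) by (simp add: jack_closed_def)
  have f: "is_sym f" using Cons.prems(3) by (simp add: supp_in_def)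
  have "lookup ?g (xp x) = 0"
    using tri_lead[OF tri_D2p f x supp_in_qn[OF Cons.prems(3,2)], of \<kappa>] by (simp add: lookup_minus)
  then have "supp_in (set xs) ?g"
    by (intro supp_in_remove[OF supp_in_diff[OF Cons.prems(1) supp_in_D2p[OF Cons.prems(1,3)] Cons.prems(3)]])
  then show ?case
    using Cons.IH[OF lamclosed_tl[OF Cons.prems(1,2)], of ?g] Cons.prems(2) by simp
qed

text \<open>A multiple of the Jack polynomial free of denominators. It satisfies the eigenvalue
  equation for every \<kappa> and loses its leading term where \<open>Jlead\<close>
  vanishes.\<close>

definition Jp :: "real \<Rightarrow> ('n::{finite,linorder} \<Rightarrow> nat) \<Rightarrow> 'n mpoly" where
  "Jp \<kappa> l = prodop (D2p \<kappa>) (d_eig \<kappa>) (qsort (jack_support l - {l})) (monomial_sym l)"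

definition Jlead :: "real \<Rightarrow> ('n::{finite,linorder} \<Rightarrow> nat) \<Rightarrow> real" where
  "Jlead \<kappa> l = (\<Prod>x\<leftarrow>qsort (jack_support l - {l}). d_eig \<kappa> l - d_eig \<kappa> x)"

definition regular :: "real \<Rightarrow> ('n::{finite,linorder} \<Rightarrow> nat) \<Rightarrow> bool" where
  "regular \<kappa> l \<longleftrightarrow> (\<forall>m\<in>jack_support l - {l}. d_eig \<kappa> m \<noteq> d_eig \<kappa> l)"

lemma Jlead_nz: "Jlead \<kappa> l \<noteq> 0 \<longleftrightarrow> regular \<kappa> l"
  by (simp add: Jlead_def regular_def prod_list_zero_iff set_qsort finite_Lam image_iff eq_commute[of "0::real"] eq_commute[of "d_eig \<kappa> l"])

lemma mkeys_level: "keys (monomial_sym l) \<subseteq> Cs (xp l)"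
  using keys_monomial_sym by blast

text \<open>With \<open>l\<close> put in front of the list, the product annihilates
  \<open>monomial_sym l\<close>. Applied last instead, the factor of \<open>l\<close> is the
  eigenvalue equation.\<close>

lemma Jp_props:
  assumes l: "is_partition l"
  shows sym_Jp: "is_sym (Jp \<kappa> l)"
    and keys_Jp: "keys (Jp \<kappa> l) \<subseteq> Cs (xp l) \<inter> {k. deg k = deg (xp l)}"
    and lookup_Jp: "lookup (Jp \<kappa> l) (xp l) = Jlead \<kappa> l"
    and D2p_Jp: "D2p \<kappa> (Jp \<kappa> l) = mconst (d_eig \<kappa> l) * Jp \<kappa> l"
proof -
  let ?xs = "qsort (jack_support l - {l})"
  note p = prodop_tri[OF tri_D2p[of \<kappa>] sym_monomial_sym l mkeys_level, where g = "d_eig \<kappa>" and xs = ?xs]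
  show "is_sym (Jp \<kappa> l)" unfolding Jp_def by (rule p(1))
  show "lookup (Jp \<kappa> l) (xp l) = Jlead \<kappa> l"
    unfolding Jp_def p(3) Jlead_def using lookup_monomial_sym_partition[OF l l] by simp
  have "keys f \<subseteq> {k. deg k = deg (xp l)} \<Longrightarrow> keys (prodop (D2p \<kappa>) g xs f) \<subseteq> {k. deg k = deg (xp l)}"
    for f and g :: "('a \<Rightarrow> nat) \<Rightarrow> real" and xs
  proof (induction xs arbitrary: f)
    case (Cons x xs)
    show ?case
      unfolding prodop_simps
      by (rule Cons.IH) (intro keys_diff_subset keys_scale_subset keys_D2p[OF hclosed_deg] Cons.prems)
  qed simp
  then have "keys (Jp \<kappa> l) \<subseteq> {k. deg k = deg (xp l)}"
    unfolding Jp_def using keys_monomial_sym[of l] by blast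
  then show "keys (Jp \<kappa> l) \<subseteq> Cs (xp l) \<inter> {k. deg k = deg (xp l)}"
    using p(2) unfolding Jp_def by blast
  have s: "set (l # ?xs) = jack_support l"
    using refl_Lam[OF l] finite_Lam[of l] by (auto simp: set_qsort)
  have "prodop (D2p \<kappa>) (d_eig \<kappa>) (l # ?xs) (monomial_sym l) = 0"
  proof (rule prodop_annihilates)
    show "jack_closed (set (l # ?xs))" unfolding s by (rule lamclosed_Lam)
    show "qdesc (l # ?xs)"
      using Lam_qn[OF l] sorted_qsort[of "jack_support l - {l}"] finite_Lam[of l]
      by (auto simp: set_qsort less_imp_le)
    show "supp_in (set (l # ?xs)) (monomial_sym l)"
      unfolding s
    proof (rule supp_inI[OF lamclosed_Lam sym_monomial_sym])
      show "keys (monomial_sym l) \<subseteq> (\<Union>y\<in>jack_support l. Cs (xp y) \<inter> {k. deg k = deg (xp y)})"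
        using keys_monomial_sym[of l] refl_Lam[OF l] by blast
    qed
  qed
  then have "D2p \<kappa> (Jp \<kappa> l) - mconst (d_eig \<kappa> l) * Jp \<kappa> l = 0"
    unfolding Jp_def prodop_commute[OF mlin_D2p] by simp
  then show "D2p \<kappa> (Jp \<kappa> l) = mconst (d_eig \<kappa> l) * Jp \<kappa> l" by simp
qed

text \<open>If \<open>l\<close> is not regular this is 0, because \<open>inverse 0 = 0\<close>;
  everything except the normalisation then still holds.\<close>

definition Pp :: "real \<Rightarrow> ('n::{finite,linorder} \<Rightarrow> nat) \<Rightarrow> 'n mpoly" where
  "Pp \<kappa> l = mconst (inverse (Jlead \<kappa> l)) * Jp \<kappa> l"

lemma Pp_props:
  assumes l: "is_partition l"
  shows sym_Pp: "is_sym (Pp \<kappa> l)"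
    and keys_Pp: "keys (Pp \<kappa> l) \<subseteq> Cs (xp l) \<inter> {k. deg k = deg (xp l)}"
    and D2p_Pp: "D2p \<kappa> (Pp \<kappa> l) = mconst (d_eig \<kappa> l) * Pp \<kappa> l"
    and lookup_Pp: "regular \<kappa> l \<Longrightarrow> lookup (Pp \<kappa> l) (xp l) = 1"
proof -
  show "is_sym (Pp \<kappa> l)" unfolding Pp_def by (intro sym_scale sym_Jp l)
  show "keys (Pp \<kappa> l) \<subseteq> Cs (xp l) \<inter> {k. deg k = deg (xp l)}"
    unfolding Pp_def by (intro keys_scale_subset keys_Jp l)
  show "D2p \<kappa> (Pp \<kappa> l) = mconst (d_eig \<kappa> l) * Pp \<kappa> l"
    unfolding Pp_def mlin_scale[OF mlin_D2p] D2p_Jp[OF l] by (simp add: mult.left_commute)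
  show "regular \<kappa> l \<Longrightarrow> lookup (Pp \<kappa> l) (xp l) = 1"
    unfolding Pp_def using Jlead_nz[of \<kappa> l] by (simp add: lookup_Jp l)
qed

text \<open>The difference has coefficient 0 at \<open>l\<close>, so its top exponent would be
  another partition of the support with the same eigenvalue.\<close>

lemma eigen_unique:
  fixes l :: "'n::{finite,linorder} \<Rightarrow> nat"
  assumes l: "is_partition l" "regular \<kappa> l"
    and f: "is_sym f" "keys f \<subseteq> Cs (xp l) \<inter> {k. deg k = deg (xp l)}" "D2p \<kappa> f = mconst (d_eig \<kappa> l) * f"
  shows "f = mconst (lookup f (xp l)) * Pp \<kappa> l"
proof (rule ccontr)
  let ?r = "f - mconst (lookup f (xp l)) * Pp \<kappa> l"
  assume "f \<noteq> mconst (lookup f (xp l)) * Pp \<kappa> l"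
  then have nz: "?r \<noteq> 0" by simp
  have s: "is_sym ?r" by (intro sym_diff sym_scale f sym_Pp l)
  have k: "keys ?r \<subseteq> Cs (xp l) \<inter> {k. deg k = deg (xp l)}"
    by (intro keys_diff_subset keys_scale_subset f keys_Pp l)
  have "D2p \<kappa> ?r = mconst (d_eig \<kappa> l) * ?r"
    by (simp only: mlin_diff[OF mlin_D2p] mlin_scale[OF mlin_D2p] f(3) D2p_Pp[OF l(1)]) (simp add: algebra_simps)
  from eigen_top[OF tri_D2p s nz this] obtain m where m: "is_partition m" "xp m \<in> keys ?r" "d_eig \<kappa> m = d_eig \<kappa> l"
    by blast
  have "m \<in> jack_support l" using m k by (auto simp: jack_support_def)
  moreover have "m \<noteq> l"
    using m(2) lookup_Pp[OF l] by (auto simp: in_keys_iff lookup_minus)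
  ultimately show False using l(2) m(3) by (auto simp: regular_def)
qed

section \<open>Comparison with the defining property of Jack polynomials\<close>

lemma rconst_rpoly: "rconst c * rpoly p = rpoly (mconst c * p)"
  by (simp add: rconst_def rpoly_mult)

lemma mconst_of_nat: "mconst (real m) = of_nat m"
  by (induction m) (simp_all add: mconst_add)

lemma euler_homogeneous:
  fixes f :: "'n::{finite,linorder} mpoly"
  assumes "keys f \<subseteq> {k. deg k = N}"
  shows "(\<Sum>i\<in>UNIV. mvar i * mderiv i f) = mconst (real N) * f"
proof -
  have "(\<Sum>i\<in>UNIV. mvar i * mderiv i f) = (\<Sum>k\<in>keys f. mconst (lookup f k) * (\<Sum>i\<in>UNIV. mvar i * mderiv i (single k 1)))"
    by (rule mlin_expand[of "\<lambda>f. \<Sum>i\<in>UNIV. mvar i * mderiv i f"]) (auto intro!: mlin_Sum mlin_times)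
  also have "\<dots> = (\<Sum>k\<in>keys f. mconst (lookup f k) * (mconst (real N) * single k 1))"
  proof (intro sum.cong refl arg_cong[where f = "(*) _"])
    fix k assume "k \<in> keys f"
    then have "deg k = N" using assms by auto
    moreover have "(\<Sum>i\<in>UNIV. mconst (real (lookup k i))) = (mconst (real (deg k)) :: 'n mpoly)"
      unfolding mconst_of_nat deg_def by simp
    ultimately show "(\<Sum>i\<in>UNIV. mvar i * mderiv i (single k 1)) = mconst (real N) * single k 1"
      by (simp add: mvar_mderiv_single sum_distrib_right[symmetric])
  qed
  also have "\<dots> = mconst (real N) * f"
    by (subst (3) mpoly_expand[OF finite_keys order.refl]) (simp add: sum_distrib_left mult.left_commute)
  finally show ?thesis .
qed

lemma euler_op_homogeneous:
  fixes f :: "'n::{finite,linorder} mpoly"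
  assumes "keys f \<subseteq> {k. deg k = N}"
  shows "euler_op (rpoly f) = rconst (real N) * rpoly f"
  unfolding euler_op_def rconst_rpoly euler_homogeneous[OF assms, symmetric]
  by (simp add: rpoly_sum rpoly_mult rderiv_rpoly rvar_def)

lemma mom1_homogeneous:
  fixes f :: "'n::{finite,linorder} mpoly"
  assumes "is_sym f" "keys f \<subseteq> {k. deg k = N}"
  shows "mom \<kappa> 1 f = mconst (real N) * f"
  using rpoly_mom1[OF assms(1), of \<kappa>] euler_op_homogeneous[OF assms(2)]
  by (simp add: euler_op_eq rconst_rpoly)

lemma finite_dominated: "finite {m. is_partition m \<and> dominated m l \<and> P m}"
  by (rule finite_subset[OF _ finite_deg_le[of "deg (xp l)"]]) (auto simp: dominated_def deg_def)

lemma is_jackD: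
  fixes l :: "'n::{finite,linorder} \<Rightarrow> nat"
  assumes l: "is_partition l" and p: "is_jack \<kappa> l p"
  shows "is_sym p" "keys p \<subseteq> {k. qn k \<le> qn (xp l)}" "keys p \<subseteq> {k. deg k = deg (xp l)}"
    "lookup p (xp l) = 1" "D2p \<kappa> p = mconst (d_eig \<kappa> l) * p"
proof -
  let ?M = "{m. is_partition m \<and> dominated m l \<and> m \<noteq> l}"
  obtain c where c: "p = monomial_sym l + (\<Sum>m\<in>?M. mconst (c m) * monomial_sym m)"
    using p unfolding is_jack_def by blast
  show s: "is_sym p"
    unfolding c by (intro sym_add sym_Sum sym_scale sym_monomial_sym)
  have q: "keys (monomial_sym m) \<subseteq> {k. qn k \<le> qn (xp l)}" if "m = l \<or> m \<in> ?M" for m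
    using that dominated_qn[of m l] keys_monomial_sym[of m] Cs_qn[of _ "xp m"] by fastforce
  show k: "keys p \<subseteq> {k. qn k \<le> qn (xp l)}"
    unfolding c by (intro keys_add_subset keys_sum_subset keys_scale_subset q) auto
  have "keys (monomial_sym m) \<subseteq> {k. deg k = deg (xp l)}" if "m = l \<or> m \<in> ?M" for m
    using that keys_monomial_sym[of m] by (auto simp: dominated_def deg_def)
  then show "keys p \<subseteq> {k. deg k = deg (xp l)}"
    unfolding c by (intro keys_add_subset keys_sum_subset keys_scale_subset) auto
  have "(\<Sum>m\<in>?M. c m * lookup (monomial_sym m) (xp l)) = 0"
    using l by (intro sum.neutral) (auto simp: lookup_monomial_sym_partition)
  then show 1: "lookup p (xp l) = 1"
    unfolding c using lookup_monomial_sym_partition[OF l l] by (simp add: lookup_add lookup_sum)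
  obtain e where "D2_op \<kappa> (rpoly p) = rconst e * rpoly p"
    using p unfolding is_jack_def eigenfunction_def by blast
  then have e: "D2p \<kappa> p = mconst e * p"
    using s by (simp add: D2_op_rpoly rconst_rpoly)
  moreover have "e = d_eig \<kappa> l"
    using tri_lead[OF tri_D2p s l k, of \<kappa>] 1 by (simp add: e)
  ultimately show "D2p \<kappa> p = mconst (d_eig \<kappa> l) * p" by simp
qed

lemma is_jackI:
  fixes l :: "'n::{finite,linorder} \<Rightarrow> nat"
  assumes l: "is_partition l" and p: "is_sym p" "\<And>m. is_partition m \<Longrightarrow> xp m \<in> keys p \<Longrightarrow> dominated m l"
    "keys p \<subseteq> {k. deg k = deg (xp l)}" "lookup p (xp l) = 1" "D2p \<kappa> p = mconst c * p"
  shows "is_jack \<kappa> l p"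
proof -
  let ?M = "{m. is_partition m \<and> dominated m l \<and> m \<noteq> l}"
  have f: "finite ?M" by (rule finite_dominated)
  have "p = (\<Sum>m\<in>insert l ?M. mconst (lookup p (xp m)) * monomial_sym m)"
    using l p(2) f by (intro sym_expand p(1)) auto
  also have "\<dots> = monomial_sym l + (\<Sum>m\<in>?M. mconst (lookup p (xp m)) * monomial_sym m)"
    using f p(4) by simp
  finally have e: "\<exists>c. p = monomial_sym l + (\<Sum>m\<in>?M. mconst (c m) * monomial_sym m)"
    by (rule exI[of _ "\<lambda>m. lookup p (xp m)"])
  have "p \<noteq> 0" using p(4) by auto
  moreover have "D2_op \<kappa> (rpoly p) = rconst c * rpoly p"
    using p by (simp add: D2_op_rpoly rconst_rpoly)
  ultimately show ?thesis
    unfolding is_jack_def eigenfunction_def using e euler_op_homogeneous[OF p(3)] by blast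
qed

lemma is_jack_Pp:
  assumes l: "is_partition l" "regular \<kappa> l"
  shows "is_jack \<kappa> l (Pp \<kappa> l)"
proof (rule is_jackI[OF l(1) sym_Pp[OF l(1)] _ _ lookup_Pp[OF l] D2p_Pp[OF l(1)]])
  show "keys (Pp \<kappa> l) \<subseteq> {k. deg k = deg (xp l)}"
    using keys_Pp[OF l(1), of \<kappa>] by blast
  fix m assume "is_partition m" "xp m \<in> keys (Pp \<kappa> l)"
  then have "m \<in> jack_support l" using keys_Pp[OF l(1), of \<kappa>] by (auto simp: jack_support_def)
  then show "dominated m l" by (rule Lam_dominated[OF l(1)])
qed

text \<open>If \<open>d\<^sub>m = d\<^sub>l\<close> for some \<open>m\<close> strictly below \<open>l\<close>, choose \<open>m\<close> minimal; then \<open>Jp \<kappa> m\<close> is an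
  eigenfunction that may be added to any Jack polynomial for \<open>l\<close>.\<close>

lemma unique_jack_regular:
  fixes l :: "'n::{finite,linorder} \<Rightarrow> nat"
  assumes l: "is_partition l" and u: "\<exists>!p. is_jack \<kappa> l p"
  shows "regular \<kappa> l"
proof (rule ccontr)
  assume "\<not> regular \<kappa> l"
  let ?B = "{m \<in> jack_support l - {l}. d_eig \<kappa> m = d_eig \<kappa> l}"
  have "?B \<noteq> {}" using \<open>\<not> regular \<kappa> l\<close> by (auto simp: regular_def)
  then obtain m where m: "m \<in> ?B" "\<And>x. x \<in> ?B \<Longrightarrow> qn (xp m) \<le> qn (xp x)"
    using ex_has_least_nat[of "\<lambda>m. m \<in> ?B" _ "\<lambda>m. qn (xp m)"] by (metis (no_types, lifting) all_not_in_conv)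
  have mp: "is_partition m" "m \<in> jack_support l" "m \<noteq> l" "d_eig \<kappa> m = d_eig \<kappa> l"
    using m(1) by (auto simp: jack_support_def)
  have "regular \<kappa> m"
    unfolding regular_def
  proof (intro ballI notI)
    fix x assume x: "x \<in> jack_support m - {m}" and "d_eig \<kappa> x = d_eig \<kappa> m"
    have qx: "qn (xp x) < qn (xp m)" using Lam_qn[OF mp(1)] x by auto
    have "qn (xp m) < qn (xp l)" using Lam_qn[OF l] mp by auto
    then have "x \<noteq> l" using qx by auto
    then have "x \<in> ?B" using x mp \<open>d_eig \<kappa> x = d_eig \<kappa> m\<close> Lam_trans[OF mp(2)] by auto
    then show False using m(2) qx by fastforce
  qed
  obtain p where p: "is_jack \<kappa> l p" using u by blast
  note pD = is_jackD[OF l p]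
  have km: "keys (Pp \<kappa> m) \<subseteq> Cs (xp m) \<inter> {k. deg k = deg (xp l)}"
    using keys_Pp[OF mp(1), of \<kappa>] mp(2) by (auto simp: jack_support_def)
  have dom: "dominated x l" if "is_partition x" "xp x \<in> keys p" for x
  proof -
    let ?M = "{m. is_partition m \<and> dominated m l \<and> m \<noteq> l}"
    obtain c where c: "p = monomial_sym l + (\<Sum>m\<in>?M. mconst (c m) * monomial_sym m)"
      using p unfolding is_jack_def by blast
    show ?thesis
    proof (rule ccontr)
      assume nd: "\<not> dominated x l"
      then have "x \<noteq> l" by (auto simp: dominated_def)
      then have "lookup p (xp x) = (\<Sum>m\<in>?M. c m * lookup (monomial_sym m) (xp x))"
        using lookup_monomial_sym_partition[OF l that(1)] by (simp add: c lookup_add lookup_sum)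
      also have "\<dots> = 0"
        using nd that(1) by (intro sum.neutral) (auto simp: lookup_monomial_sym_partition)
      finally show False using that(2) by (simp add: in_keys_iff)
    qed
  qed
  have "is_jack \<kappa> l (p + Pp \<kappa> m)"
  proof (rule is_jackI[OF l])
    show "is_sym (p + Pp \<kappa> m)" by (intro sym_add pD sym_Pp mp)
    show "keys (p + Pp \<kappa> m) \<subseteq> {k. deg k = deg (xp l)}"
      using km by (intro keys_add_subset pD) blast
    show "D2p \<kappa> (p + Pp \<kappa> m) = mconst (d_eig \<kappa> l) * (p + Pp \<kappa> m)"
      by (simp add: mlin_add[OF mlin_D2p] pD D2p_Pp mp distrib_left)
    have "xp l \<notin> keys (Pp \<kappa> m)"
    proof
      assume "xp l \<in> keys (Pp \<kappa> m)"
      then have "qn (xp l) \<le> qn (xp m)" using km Cs_qn by blast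
      then show False using Lam_qn[OF l mp(2,3)] by simp
    qed
    then show "lookup (p + Pp \<kappa> m) (xp l) = 1"
      using pD(4) by (simp add: lookup_add in_keys_iff)
    fix x assume x: "is_partition x" "xp x \<in> keys (p + Pp \<kappa> m)"
    then consider "xp x \<in> keys p" | "xp x \<in> keys (Pp \<kappa> m)"
      using keys_add[of p "Pp \<kappa> m"] by blast
    then show "dominated x l"
    proof cases
      case 2
      then have "x \<in> jack_support m" using km x mp(2) by (auto simp: jack_support_def)
      then show ?thesis using Lam_trans[OF mp(2)] Lam_dominated[OF l] by blast
    qed (use dom x in blast)
  qed
  then have "p + Pp \<kappa> m = p" using u p by blast
  then have "Pp \<kappa> m = 0" by simp
  then show False using lookup_Pp[OF mp(1) \<open>regular \<kappa> m\<close>] by simp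
qed

lemma jack_eq:
  assumes "is_partition l" "\<exists>!p. is_jack \<kappa> l p"
  shows "jack \<kappa> l = Pp \<kappa> l"
  unfolding jack_def using is_jack_Pp[OF assms(1) unique_jack_regular[OF assms]] assms(2) by (metis the1_equality)

section \<open>The lowering operator on Jack polynomials\<close>

definition revlin :: "real multiset \<Rightarrow> real poly" where
  "revlin R = (\<Prod>r\<in>#R. [:1, - r:])"

lemma revlin_add: "revlin (R + S) = revlin R * revlin S"
  by (simp add: revlin_def)

text \<open>A root 0 contributes the factor 1, hence the condition on the sizes. Reversing the
  coefficients gives a polynomial that has the multiset as its roots.\<close>

lemma revlin_inj:
  assumes "revlin R = revlin S" "size R = size S"
  shows "R = S"
proof -
  define Q where "Q R = (\<Prod>r\<in>#R. [:- r, 1:])" for R :: "real multiset"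
  have nz: "Q R \<noteq> 0" for R
    by (auto simp: Q_def prod_mset_zero_iff)
  have pr: "proots (Q R) = R" for R
  proof (induction R)
    case (add r R)
    have "Q (add_mset r R) = [:- r, 1:] * Q R"
      by (simp add: Q_def)
    then have "proots (Q (add_mset r R)) = proots [:- r, 1:] + proots (Q R)"
      using nz[of R] by (simp only:) (rule proots_mult, simp_all)
    then show ?case
      using add by simp
  qed (simp add: Q_def)
  have ev: "poly (Q R) t = t ^ size R * poly (revlin R) (1 / t)" if "t \<noteq> 0" for t R
    using that by (induction R) (auto simp: Q_def revlin_def field_simps)
  have "poly (Q R - Q S) t = 0" if "t \<noteq> 0" for t
    using that assms by (simp add: ev)
  then have "UNIV - {0} \<subseteq> {t. poly (Q R - Q S) t = 0}"
    by auto
  moreover have "infinite (UNIV - {0 :: real})"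
    by (simp add: infinite_UNIV_char_0)
  ultimately have "infinite {t. poly (Q R - Q S) t = 0}"
    using finite_subset by blast
  then have "Q R - Q S = 0"
    using poly_roots_finite by blast
  then show ?thesis using pr by (metis right_minus_eq)
qed

definition spec :: "real \<Rightarrow> ('n::{finite,linorder} \<Rightarrow> nat) \<Rightarrow> 'n \<Rightarrow> real" where
  "spec \<kappa> l i = real (l i) + \<kappa> * real (card {i<..})"

definition lf :: "real \<Rightarrow> real fps" where "lf r = 1 - fps_const r * fps_X"

lemma fps_of_revlin: "fps_of_poly (revlin R) = (\<Prod>r\<in>#R. lf r)"
proof (induction R)
  case (add r R)
  have "revlin (add_mset r R) = [:1, - r:] * revlin R"
    by (simp only: revlin_def image_mset_add_mset prod_mset.add_mset)
  moreover have "fps_of_poly [:1, - r:] = lf r"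
    by (simp only: fps_of_poly_linear' lf_def fps_const_neg[symmetric]) simp
  ultimately have "fps_of_poly (revlin (add_mset r R)) = lf r * fps_of_poly (revlin R)"
    by (simp only: fps_of_poly_mult)
  then show ?case
    using add by simp
qed (simp add: revlin_def)

definition mspec :: "real \<Rightarrow> ('n::{finite,linorder} \<Rightarrow> nat) \<Rightarrow> real multiset" where
  "mspec \<kappa> l = image_mset (spec \<kappa> l) (mset_set UNIV)"

lemma fps_of_revlin_spec: "fps_of_poly (revlin (image_mset f (mset_set UNIV))) = (\<Prod>i\<in>UNIV. lf (f i))"
  by (simp add: fps_of_revlin prod_unfold_prod_mset image_mset.compositionality o_def)

text \<open>As \<open>Tm\<close> is triangular, the indices can be eliminated one by one from the top.\<close>

lemma mom_eig_gf:
  fixes l :: "'n::{finite,linorder} \<Rightarrow> nat"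
  shows "(1 - fps_const \<kappa> * fps_X * Abs_fps (\<lambda>k. mom_eig \<kappa> k l)) * fps_of_poly (revlin (mspec \<kappa> l)) =
     fps_of_poly (revlin (image_mset (\<lambda>r. r + \<kappa>) (mspec \<kappa> l)))"
proof -
  define V where "V i = Abs_fps (\<lambda>k. (Tm \<kappa> l ^^ k) (\<lambda>_. 1) i)" for i
  \<comment> \<open>Row \<open>i\<close> of the resolvent equation (1 - z T) V = 1.\<close>
  have V: "V i = 1 + fps_X * (fps_const (spec \<kappa> l i) * V i - fps_const \<kappa> * (\<Sum>j\<in>{i<..}. V j))" for i
  proof (rule fps_ext)
    fix k
    show "fps_nth (V i) k = fps_nth (1 + fps_X * (fps_const (spec \<kappa> l i) * V i - fps_const \<kappa> * (\<Sum>j\<in>{i<..}. V j))) k"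
      by (cases k) (simp_all add: V_def fps_sum_nth Tm_def spec_def)
  qed
  \<comment> \<open>Adding the smallest index \<open>b\<close> to an upward closed set leaves
    \<open>A\<close> = {b<..}, which consists of the indices that row \<open>b\<close> is coupled
    to.\<close>
  have "(\<forall>i\<in>A. {i<..} \<subseteq> A) \<longrightarrow> (1 - fps_const \<kappa> * fps_X * (\<Sum>j\<in>A. V j)) * (\<Prod>i\<in>A. lf (spec \<kappa> l i)) = (\<Prod>i\<in>A. lf (spec \<kappa> l i + \<kappa>))"
    if "finite A" for A :: "'n set"
    using that
  proof (induction A rule: finite_linorder_min_induct)
    case (insert b A)
    show ?case
    proof
      assume up: "\<forall>i\<in>insert b A. {i<..} \<subseteq> insert b A"
      have A: "A = {b<..}" using up insert.hyps by auto
      have nb: "b \<notin> A" using insert.hyps by auto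
      have "\<forall>i\<in>A. {i<..} \<subseteq> A" unfolding A by auto
      then have IH: "(1 - fps_const \<kappa> * fps_X * (\<Sum>j\<in>A. V j)) * (\<Prod>i\<in>A. lf (spec \<kappa> l i)) = (\<Prod>i\<in>A. lf (spec \<kappa> l i + \<kappa>))"
        using insert.IH by blast
      define S where "S = 1 - fps_const \<kappa> * fps_X * (\<Sum>j\<in>A. V j)"
      have Vb: "V b * lf (spec \<kappa> l b) = S"
        using V[of b] by (simp add: lf_def S_def A[symmetric] algebra_simps)
      have lk: "lf (spec \<kappa> l b + \<kappa>) = lf (spec \<kappa> l b) - fps_const \<kappa> * fps_X"
        by (simp add: lf_def fps_const_add[symmetric] algebra_simps del: fps_const_add)
      have "(1 - fps_const \<kappa> * fps_X * (\<Sum>j\<in>insert b A. V j)) * (\<Prod>i\<in>insert b A. lf (spec \<kappa> l i))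
         = (S * lf (spec \<kappa> l b) - fps_const \<kappa> * fps_X * (V b * lf (spec \<kappa> l b))) * (\<Prod>i\<in>A. lf (spec \<kappa> l i))"
        using nb insert.hyps by (simp add: S_def algebra_simps)
      also have "\<dots> = lf (spec \<kappa> l b + \<kappa>) * (S * (\<Prod>i\<in>A. lf (spec \<kappa> l i)))"
        unfolding Vb lk by (simp add: algebra_simps)
      also have "\<dots> = (\<Prod>i\<in>insert b A. lf (spec \<kappa> l i + \<kappa>))"
        unfolding S_def IH using nb insert.hyps by simp
      finally show "(1 - fps_const \<kappa> * fps_X * (\<Sum>j\<in>insert b A. V j)) * (\<Prod>i\<in>insert b A. lf (spec \<kappa> l i)) = (\<Prod>i\<in>insert b A. lf (spec \<kappa> l i + \<kappa>))" .
    qed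
  qed simp
  from this[of UNIV] have "(1 - fps_const \<kappa> * fps_X * (\<Sum>j\<in>UNIV. V j)) * (\<Prod>i\<in>UNIV. lf (spec \<kappa> l i)) = (\<Prod>i\<in>UNIV. lf (spec \<kappa> l i + \<kappa>))"
    by simp
  moreover have "(\<Sum>j\<in>UNIV. V j) = Abs_fps (\<lambda>k. mom_eig \<kappa> k l)"
    by (rule fps_ext) (simp add: V_def mom_eig_def fps_sum_nth)
  ultimately show ?thesis
    by (simp add: mspec_def image_mset.compositionality o_def fps_of_revlin_spec)
qed

text \<open>The difference of the multiplicities is periodic with period \<kappa> and has finite
  support.\<close>

lemma mset_shift_cancel:
  fixes L M :: "real multiset"
  assumes "image_mset (\<lambda>r. r + \<kappa>) L + M = image_mset (\<lambda>r. r + \<kappa>) M + L" "\<kappa> \<noteq> 0"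
  shows "L = M"
proof (rule multiset_eqI, rule ccontr)
  fix z assume ne: "count L z \<noteq> count M z"
  define E where "E z = int (count L z) - int (count M z)" for z
  have c: "count (image_mset (\<lambda>r. r + \<kappa>) R) (z + \<kappa>) = count R z" for R z
    by (induction R) auto
  have E: "E (z + \<kappa>) = E z" for z
    using arg_cong[OF assms(1), of "\<lambda>R. count R (z + \<kappa>)"] by (simp add: c E_def)
  have "E (z + real m * \<kappa>) = E z" for m
  proof (induction m)
    case (Suc m)
    have "z + real (Suc m) * \<kappa> = (z + real m * \<kappa>) + \<kappa>" by (simp add: algebra_simps)
    then show ?case using Suc E[of "z + real m * \<kappa>"] by (simp only:)
  qed simp
  then have "E (z + real m * \<kappa>) \<noteq> 0" for m
    using ne by (simp add: E_def)
  then have "z + real m * \<kappa> \<in> set_mset L \<union> set_mset M" for m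
    by (metis E_def UnI1 UnI2 count_eq_zero_iff diff_self)
  then have "range (\<lambda>m. z + real m * \<kappa>) \<subseteq> set_mset L \<union> set_mset M"
    by auto
  then have "finite (range (\<lambda>m. z + real m * \<kappa>))"
    by (rule finite_subset) simp
  moreover have "inj (\<lambda>m. z + real m * \<kappa>)"
    using assms(2) by (simp add: inj_def)
  ultimately show False
    using finite_imageD by blast
qed

text \<open>If E P_l has coefficient b at P_m, then \<open>Mp \<kappa> k j\<close> maps P_l to a
  polynomial with coefficient b \<open>gam \<kappa> \<alpha> m k\<close> \<alpha>^j at P_m, where
  \<alpha> comes from the commutator with the second moment. The recursion is \<open>Mx_Suc\<close>
  at this coefficient.\<close>

fun gam :: "real \<Rightarrow> real \<Rightarrow> ('n::{finite,linorder} \<Rightarrow> nat) \<Rightarrow> nat \<Rightarrow> real" where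
  "gam \<kappa> \<alpha> m 0 = 1"
| "gam \<kappa> \<alpha> m (Suc k) = (\<alpha> + \<kappa> - 1) * gam \<kappa> \<alpha> m k - \<kappa> * mom_eig \<kappa> k m"

text \<open>Assumption \<open>c\<close> compares coefficients in \<open>Em_moment\<close>. It makes
  the quotient of the generating functions of \<open>l\<close> and \<open>m\<close> equal to (1 -
  (\<alpha> + \<kappa>) z) (1 - (\<alpha> - 1) z) / ((1 - \<alpha> z) (1 - (\<alpha> + \<kappa> - 1)
  z)), which says that one value \<alpha> in the spectrum of \<open>l\<close> drops to \<alpha> -
  1.\<close>

lemma spectral_shift:
  fixes l m :: "'n::{finite,linorder} \<Rightarrow> nat"
  assumes \<kappa>: "\<kappa> \<noteq> 0"
    and c: "\<And>k. mom_eig \<kappa> k l = mom_eig \<kappa> k m + (\<Sum>j<k. gam \<kappa> \<alpha> m j * \<alpha> ^ (k - 1 - j))"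
  shows "add_mset (\<alpha> - 1) (mspec \<kappa> l) = add_mset \<alpha> (mspec \<kappa> m)"
proof (rule mset_shift_cancel[OF _ \<kappa>])
  define C where "C l = Abs_fps (\<lambda>k. mom_eig \<kappa> k l)" for l :: "'n \<Rightarrow> nat"
  define G where "G = Abs_fps (gam \<kappa> \<alpha> m)"
  define De where "De = C l - C m"
  let ?k = "fps_const \<kappa>"
  have De: "De = fps_X * (fps_const \<alpha> * De + G)"
  proof (rule fps_ext)
    fix k
    show "fps_nth De k = fps_nth (fps_X * (fps_const \<alpha> * De + G)) k"
    proof (cases k)
      case 0
      then show ?thesis using c[of 0] by (simp add: De_def C_def)
    next
      case (Suc k')
      have "(\<Sum>j<k'. gam \<kappa> \<alpha> m j * \<alpha> ^ (k' - j)) = \<alpha> * (\<Sum>j<k'. gam \<kappa> \<alpha> m j * \<alpha> ^ (k' - 1 - j))"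
        unfolding sum_distrib_left
      proof (intro sum.cong refl)
        fix j assume "j \<in> {..<k'}"
        then have "k' - j = Suc (k' - 1 - j)" by auto
        then show "gam \<kappa> \<alpha> m j * \<alpha> ^ (k' - j) = \<alpha> * (gam \<kappa> \<alpha> m j * \<alpha> ^ (k' - 1 - j))"
          by simp
      qed
      then show ?thesis
        unfolding Suc using c[of "Suc k'"] c[of k'] by (simp add: De_def C_def G_def)
    qed
  qed
  have G: "G * lf (\<alpha> + \<kappa> - 1) = 1 - ?k * fps_X * C m"
  proof -
    have "G = 1 + fps_X * (fps_const (\<alpha> + \<kappa> - 1) * G - ?k * C m)"
    proof (rule fps_ext)
      fix k
      show "fps_nth G k = fps_nth (1 + fps_X * (fps_const (\<alpha> + \<kappa> - 1) * G - ?k * C m)) k"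
        by (cases k) (simp_all add: G_def C_def)
    qed
    then show ?thesis by (simp add: lf_def algebra_simps)
  qed
  have Da: "De * lf \<alpha> = fps_X * G"
    using De by (simp add: lf_def algebra_simps)
  define Sm where "Sm = 1 - ?k * fps_X * C m"
  define Sl where "Sl = 1 - ?k * fps_X * C l"
  have Sl: "Sl = Sm - ?k * fps_X * De"
    by (simp add: Sl_def Sm_def De_def algebra_simps)
  have "Sl * (lf \<alpha> * lf (\<alpha> + \<kappa> - 1)) = Sm * (lf \<alpha> * lf (\<alpha> + \<kappa> - 1)) - ?k * fps_X * (De * lf \<alpha>) * lf (\<alpha> + \<kappa> - 1)"
    unfolding Sl by (simp add: algebra_simps)
  also have "\<dots> = Sm * (lf \<alpha> * lf (\<alpha> + \<kappa> - 1)) - ?k * fps_X * fps_X * (G * lf (\<alpha> + \<kappa> - 1))"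
    unfolding Da by (simp add: algebra_simps)
  also have "\<dots> = Sm * (lf \<alpha> * lf (\<alpha> + \<kappa> - 1) - ?k * fps_X * fps_X)"
    unfolding G Sm_def by (simp add: algebra_simps)
  \<comment> \<open>The two pairs of parameters have the same sum, and (\<alpha> + \<kappa>)
    (\<alpha> - 1) = \<alpha> (\<alpha> + \<kappa> - 1) - \<kappa>.\<close>
  also have "lf \<alpha> * lf (\<alpha> + \<kappa> - 1) - ?k * fps_X * fps_X = lf (\<alpha> + \<kappa>) * lf (\<alpha> - 1)"
  proof -
    have e: "fps_const (\<alpha> + \<kappa> - 1) = fps_const \<alpha> + ?k - 1" "fps_const (\<alpha> + \<kappa>) = fps_const \<alpha> + ?k" "fps_const (\<alpha> - 1) = fps_const \<alpha> - 1"
      by (simp_all flip: fps_const_add fps_const_sub)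
    show ?thesis unfolding lf_def e by (simp add: algebra_simps)
  qed
  finally have S: "Sl * (lf \<alpha> * lf (\<alpha> + \<kappa> - 1)) = Sm * (lf (\<alpha> + \<kappa>) * lf (\<alpha> - 1))" .
  let ?sh = "image_mset (\<lambda>r. r + \<kappa>)"
  let ?F = "\<lambda>R. fps_of_poly (revlin R)"
  note gl = mom_eig_gf[of \<kappa> l, folded C_def, folded Sl_def]
  note gm = mom_eig_gf[of \<kappa> m, folded C_def, folded Sm_def]
  have add: "?F (add_mset r R) = lf r * ?F R" for r R
    by (simp add: fps_of_revlin)
  have "?F (?sh (add_mset (\<alpha> - 1) (mspec \<kappa> l)) + add_mset \<alpha> (mspec \<kappa> m))
      = (lf (\<alpha> + \<kappa> - 1) * (Sl * ?F (mspec \<kappa> l))) * (lf \<alpha> * ?F (mspec \<kappa> m))"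
    unfolding revlin_add fps_of_poly_mult gl by (simp add: add algebra_simps)
  also have "\<dots> = (Sl * (lf \<alpha> * lf (\<alpha> + \<kappa> - 1))) * (?F (mspec \<kappa> l) * ?F (mspec \<kappa> m))"
    by (simp add: mult_ac)
  also have "\<dots> = (lf (\<alpha> + \<kappa>) * (Sm * ?F (mspec \<kappa> m))) * (lf (\<alpha> - 1) * ?F (mspec \<kappa> l))"
    unfolding S by (simp add: mult_ac)
  also have "\<dots> = ?F (?sh (add_mset \<alpha> (mspec \<kappa> m)) + add_mset (\<alpha> - 1) (mspec \<kappa> l))"
    unfolding revlin_add fps_of_poly_mult gm by (simp add: add)
  finally show "?sh (add_mset (\<alpha> - 1) (mspec \<kappa> l)) + add_mset \<alpha> (mspec \<kappa> m) = ?sh (add_mset \<alpha> (mspec \<kappa> m)) + add_mset (\<alpha> - 1) (mspec \<kappa> l)"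
    by (intro revlin_inj) (simp_all add: fps_of_poly_eq_iff mspec_def)
qed

lemma inj_card_greater: "inj (\<lambda>i :: 'n::{finite,linorder}. card {i<..})"
proof (rule linorder_injI)
  fix i j :: 'n assume "i < j"
  then have "card {j<..} < card {i<..}"
    by (intro psubset_card_mono) auto
  then show "card {i<..} \<noteq> card {j<..}" by simp
qed

text \<open>If the multiples of \<kappa> differed, \<kappa> would be a quotient of integers.\<close>

lemma spec_irrational:
  fixes l m :: "'n::{finite,linorder} \<Rightarrow> nat"
  assumes "\<kappa> \<notin> \<rat>" "spec \<kappa> l i = spec \<kappa> m j"
  shows "i = j" "l i = m j"
proof -
  have e: "\<kappa> * (real (card {i<..}) - real (card {j<..})) = real (m j) - real (l i)"
    using assms(2) by (simp add: spec_def algebra_simps)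
  have "card {i<..} = card {j<..}"
  proof (rule ccontr)
    assume "card {i<..} \<noteq> card {j<..}"
    then have "\<kappa> = (real (m j) - real (l i)) / (real (card {i<..}) - real (card {j<..}))"
      using e by (simp add: field_simps)
    also have "\<dots> \<in> \<rat>" by (intro Rats_divide Rats_diff Rats_of_nat)
    finally show False using assms(1) by simp
  qed
  then show ij: "i = j" using inj_card_greater by (auto dest: injD)
  then show "l i = m j" using assms(2) by (simp add: spec_def)
qed

text \<open>\<alpha> is the spectral value of \<open>l\<close> at some \<open>i\<close>. The other
  values of \<open>l\<close> recur in the spectrum of \<open>m\<close>, by irrationality at the same
  indices, and the degree leaves m_i = l_i - 1.\<close>

lemma shift_remove_box:
  fixes l m :: "'n::{finite,linorder} \<Rightarrow> nat"
  assumes \<kappa>: "\<kappa> \<notin> \<rat>" and e: "add_mset (\<alpha> - 1) (mspec \<kappa> l) = add_mset \<alpha> (mspec \<kappa> m)"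
    and d: "deg (xp m) + 1 = deg (xp l)"
  shows "m < l"
proof -
  have "\<alpha> \<in># mspec \<kappa> l"
  proof -
    have "\<alpha> \<in># add_mset (\<alpha> - 1) (mspec \<kappa> l)"
      unfolding e by simp
    then show ?thesis by simp
  qed
  then obtain i where i: "\<alpha> = spec \<kappa> l i"
    by (auto simp: mspec_def)
  have eq: "m j = l j" if "j \<noteq> i" for j
  proof -
    have "spec \<kappa> l j \<in># mspec \<kappa> l" by (simp add: mspec_def)
    then have "spec \<kappa> l j \<in># add_mset \<alpha> (mspec \<kappa> m)"
      unfolding e[symmetric] by simp
    moreover have "spec \<kappa> l j \<noteq> \<alpha>"
      using spec_irrational(1)[OF \<kappa>] that i by auto
    ultimately obtain j' where "spec \<kappa> l j = spec \<kappa> m j'"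
      by (auto simp: mspec_def)
    then show ?thesis using spec_irrational[OF \<kappa>] by metis
  qed
  have "sum m (UNIV - {i}) = sum l (UNIV - {i})"
    by (intro sum.cong refl eq) auto
  then have "m i + 1 = l i"
    using d by (simp add: deg_def sum.remove[of UNIV i])
  then have "m j \<le> l j" for j using eq[of j] by (cases "j = i") auto
  moreover have "m \<noteq> l" using \<open>m i + 1 = l i\<close> by auto
  ultimately show "m < l" by (auto simp: less_le le_fun_def)
qed

text \<open>\<open>Dp\<close> already contains one factor L, so the second index is one less than in
  \<open>Mx\<close>.\<close>

definition Mp :: "real \<Rightarrow> nat \<Rightarrow> nat \<Rightarrow> 'n::finite mpoly \<Rightarrow> 'n mpoly" where
  "Mp \<kappa> k m f = (\<Sum>i\<in>UNIV. (Lp \<kappa> ^^ k) (Dp \<kappa> ((Lp \<kappa> ^^ m) (\<lambda>_. f))) i)"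

lemma rpoly_Mp:
  fixes f :: "'n::{finite,linorder} mpoly"
  assumes "is_sym f"
  shows "rpoly (Mp \<kappa> k m f) = lx.Mx \<kappa> k (Suc m) (rpoly f)"
proof -
  have e: "equivar ((Lp \<kappa> ^^ m) (\<lambda>_. f))"
    by (intro equivar_Lp_pow equivar_const assms)
  have "(lx.Lx \<kappa> ^^ Suc m) (\<lambda>_. rpoly f) = (\<lambda>i. rpoly ((Lp \<kappa> ^^ Suc m) (\<lambda>_. f) i))"
    by (rule rpoly_Lp_pow[OF equivar_const[OF assms]])
  then have "(\<lambda>j. (lx.Lx \<kappa> ^^ Suc m) (\<lambda>_. rpoly f) j / rvar j) = (\<lambda>j. rpoly (Dp \<kappa> ((Lp \<kappa> ^^ m) (\<lambda>_. f)) j))"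
    by (simp add: rpoly_Dp)
  then show ?thesis
    unfolding lx.Mx_def Mp_def by (simp only: rpoly_Lp_pow[OF equivar_Dp[OF e]] rpoly_sum)
qed

lemma sym_Mp:
  fixes f :: "'n::{finite,linorder} mpoly"
  shows "is_sym f \<Longrightarrow> is_sym (Mp \<kappa> k m f)"
  unfolding Mp_def by (intro sym_sum equivar_Lp_pow equivar_Dp equivar_const)

lemma tlin_comp: "tlin A \<Longrightarrow> tlin B \<Longrightarrow> tlin (\<lambda>g. A (B g))"
  by (simp add: tlin_def)

lemma mlin_Mp: "mlin (Mp \<kappa> k m)"
  unfolding Mp_def[abs_def]
  by (rule tlin_mlin[of "\<lambda>g. (Lp \<kappa> ^^ k) (Dp \<kappa> ((Lp \<kappa> ^^ m) g))"]) (rule tlin_comp[OF tlin_pow[OF tlin_Lp] tlin_comp[OF tlin_Dp tlin_pow[OF tlin_Lp]]])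

lemma Mp_Suc:
  fixes f :: "'n::{finite,linorder} mpoly"
  assumes f: "is_sym f"
  shows "Mp \<kappa> (Suc k) m f = Mp \<kappa> k (Suc m) f + mconst (\<kappa> - 1) * Mp \<kappa> k m f - mconst \<kappa> * mom \<kappa> k (Mp \<kappa> 0 m f)"
proof (rule poly_op_eqI)
  show "rpoly (Mp \<kappa> (Suc k) m f) = rpoly (Mp \<kappa> k (Suc m) f + mconst (\<kappa> - 1) * Mp \<kappa> k m f - mconst \<kappa> * mom \<kappa> k (Mp \<kappa> 0 m f))"
    unfolding rpoly_diff rpoly_add rpoly_mult rpoly_mom[OF sym_Mp[OF f]] rpoly_Mp[OF f] rconst_def[symmetric] rconst_diff rconst_1
    by (rule lx.Mx_Suc)
qed

lemma mom2_Mp: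
  fixes f :: "'n::{finite,linorder} mpoly"
  assumes f: "is_sym f"
  shows "mom \<kappa> 2 (Mp \<kappa> 0 m f) = Mp \<kappa> 0 m (mom \<kappa> 2 f) - mconst 2 * Mp \<kappa> 0 (Suc m) f
     + mconst (1 + \<kappa> * (real (card (UNIV :: 'n set)) - 1)) * Mp \<kappa> 0 m f"
proof (rule poly_op_eqI)
  show "rpoly (mom \<kappa> 2 (Mp \<kappa> 0 m f)) = rpoly (Mp \<kappa> 0 m (mom \<kappa> 2 f) - mconst 2 * Mp \<kappa> 0 (Suc m) f
     + mconst (1 + \<kappa> * (real (card (UNIV :: 'n set)) - 1)) * Mp \<kappa> 0 m f)"
    unfolding rpoly_diff rpoly_add rpoly_mult rpoly_mom2[OF sym_Mp[OF f]] rpoly_Mp[OF f] rpoly_Mp[OF sym_mom[OF f]] rpoly_mom2[OF f]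
      rconst_def[symmetric] rconst_diff rconst_add rconst_mult rconst_1 rconst_2 rconst_of_nat
    by (rule lx.Hs_Mx)
qed

lemma Emp_mom:
  fixes f :: "'n::{finite,linorder} mpoly"
  assumes f: "is_sym f"
  shows "Emp (mom \<kappa> k f) = mom \<kappa> k (Emp f) + (\<Sum>j<k. Mp \<kappa> j (k - 1 - j) f)"
proof (rule poly_op_eqI)
  have "lx.Mx \<kappa> j (k - j) (rpoly f) = rpoly (Mp \<kappa> j (k - 1 - j) f)" if "j < k" for j
  proof -
    have "k - j = Suc (k - 1 - j)" using that by auto
    then show ?thesis by (simp add: rpoly_Mp[OF f])
  qed
  then show "rpoly (Emp (mom \<kappa> k f)) = rpoly (mom \<kappa> k (Emp f) + (\<Sum>j<k. Mp \<kappa> j (k - 1 - j) f))"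
    unfolding rpoly_add rpoly_sum rpoly_Emp rpoly_mom[OF sym_Emp[OF f]] rpoly_mom[OF f] lx.Em_moment by simp
qed

lemma Emp_Mp:
  fixes f :: "'n::{finite,linorder} mpoly"
  assumes f: "is_sym f"
  shows "Emp f = Mp \<kappa> 0 0 f"
proof (rule poly_op_eqI)
  show "rpoly (Emp f) = rpoly (Mp \<kappa> 0 0 f)"
    unfolding rpoly_Emp rpoly_Mp[OF f] lx.Em_eq_Mx[of _ \<kappa>] by (simp add: One_nat_def)
qed

section \<open>Spans of Jack polynomials\<close>

definition mspan :: "('b \<Rightarrow> 'n mpoly) \<Rightarrow> 'b set \<Rightarrow> 'n mpoly set" where
  "mspan v A = {\<Sum>m\<in>A. mconst (b m) * v m | b. True}"

lemma mspanI: "f = (\<Sum>m\<in>A. mconst (b m) * v m) \<Longrightarrow> f \<in> mspan v A"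
  unfolding mspan_def by blast

lemma mspanE:
  assumes "f \<in> mspan v A"
  obtains b where "f = (\<Sum>m\<in>A. mconst (b m) * v m)"
  using assms unfolding mspan_def by blast

lemma mspan_add: "f \<in> mspan v A \<Longrightarrow> g \<in> mspan v A \<Longrightarrow> f + g \<in> mspan v A"
  by (elim mspanE, rule mspanI[where b = "\<lambda>m. _ m + _ m"]) (simp add: mconst_add distrib_right sum.distrib)

lemma mspan_scale: "f \<in> mspan v A \<Longrightarrow> mconst c * f \<in> mspan v A"
  by (elim mspanE, rule mspanI[where b = "\<lambda>m. c * _ m"]) (simp add: mconst_mult sum_distrib_left mult.assoc)

lemma mspan_0: "0 \<in> mspan v A"
  by (rule mspanI[where b = "\<lambda>_. 0"]) simp

lemma mspan_diff:
  assumes "f \<in> mspan v A" "g \<in> mspan v A"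
  shows "f - g \<in> mspan v A"
proof -
  have "f - g = f + mconst (- 1) * g"
    by (rule poly_mapping_eqI) (simp add: lookup_add lookup_minus)
  then show ?thesis
    using assms by (simp only: mspan_add mspan_scale)
qed

lemma mspan_sum: "(\<And>x. x \<in> I \<Longrightarrow> f x \<in> mspan v A) \<Longrightarrow> sum f I \<in> mspan v A"
  by (induction I rule: infinite_finite_induct) (auto intro: mspan_0 mspan_add)

lemma mspan_mono:
  assumes "finite B" "A \<subseteq> B" "f \<in> mspan v A"
  shows "f \<in> mspan v B"
proof -
  obtain b where b: "f = (\<Sum>m\<in>A. mconst (b m) * v m)"
    using assms(3) by (rule mspanE)
  have "f = (\<Sum>m\<in>B. mconst (if m \<in> A then b m else 0) * v m)"
    unfolding b using assms(1,2) by (intro sum.mono_neutral_cong_left) auto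
  then show ?thesis by (rule mspanI)
qed

lemma mspan_base: "finite A \<Longrightarrow> m \<in> A \<Longrightarrow> v m \<in> mspan v A"
  by (rule mspan_mono[where A = "{m}"]) (auto intro!: mspanI[where b = "\<lambda>_. 1"])

lemma mspan_rescale:
  assumes "\<And>m. m \<in> A \<Longrightarrow> v m = mconst (c m) * w m" "f \<in> mspan v A"
  shows "f \<in> mspan w A"
proof -
  obtain b where b: "f = (\<Sum>m\<in>A. mconst (b m) * v m)"
    using assms(2) by (rule mspanE)
  have "f = (\<Sum>m\<in>A. mconst (b m * c m) * w m)"
    unfolding b using assms(1) by (intro sum.cong refl) (simp add: mconst_mult mult.assoc)
  then show ?thesis by (rule mspanI)
qed

lemma lookup_Jp_other:
  assumes "is_partition m" "is_partition x" "qn (xp m) \<le> qn (xp x)" "m \<noteq> x"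
  shows "lookup (Jp \<kappa> m) (xp x) = 0"
proof (rule ccontr)
  assume "lookup (Jp \<kappa> m) (xp x) \<noteq> 0"
  then have "xp x \<in> Cs (xp m)"
    using keys_Jp[OF assms(1), of \<kappa>] by (auto simp: in_keys_iff)
  then show False
    using Cs_partition[OF assms(1,2)] assms by auto
qed

lemma lookup_Pp_other:
  assumes "is_partition m" "is_partition x" "qn (xp m) \<le> qn (xp x)" "m \<noteq> x"
  shows "lookup (Pp \<kappa> m) (xp x) = 0"
  by (simp add: Pp_def lookup_Jp_other[OF assms])

lemma Pp_independent:
  fixes A :: "('n::{finite,linorder} \<Rightarrow> nat) set"
  assumes "finite A" "\<And>m. m \<in> A \<Longrightarrow> is_partition m" "\<And>m. m \<in> A \<Longrightarrow> regular \<kappa> m"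
    and z: "(\<Sum>m\<in>A. mconst (r m) * Pp \<kappa> m) = 0" and "x \<in> A"
  shows "r x = 0"
proof (rule ccontr)
  assume "r x \<noteq> 0"
  let ?B = "{m \<in> A. r m \<noteq> 0}"
  have "?B \<noteq> {}" using \<open>r x \<noteq> 0\<close> \<open>x \<in> A\<close> by auto
  then have "Max ((\<lambda>m. qn (xp m)) ` ?B) \<in> (\<lambda>m. qn (xp m)) ` ?B"
    using assms(1) by (intro Max_in) auto
  then obtain m where m: "m \<in> ?B" "qn (xp m) = Max ((\<lambda>m. qn (xp m)) ` ?B)" by auto
  have "qn (xp y) \<le> qn (xp m)" if "y \<in> ?B" for y
    unfolding m(2) using assms(1) that by (intro Max_ge) auto
  then have "r y * lookup (Pp \<kappa> y) (xp m) = (if y = m then r m else 0)" if "y \<in> A" for y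
    using that m(1) assms(2)[of y] assms(2)[of m] assms(3)[of m] lookup_Pp_other[of y m \<kappa>] lookup_Pp[of m \<kappa>]
    by (cases "r y = 0") auto
  then have "(\<Sum>y\<in>A. r y * lookup (Pp \<kappa> y) (xp m)) = (\<Sum>y\<in>A. if y = m then r m else 0)"
    by (intro sum.cong refl)
  also have "\<dots> = r m"
    using m(1) assms(1) by simp
  finally have "lookup (\<Sum>y\<in>A. mconst (r y) * Pp \<kappa> y) (xp m) = r m"
    by (simp add: lookup_sum)
  then show False using z m(1) by simp
qed

lemma Pp_basis:
  assumes "jack_closed (set xs)" "qdesc xs" "supp_in (set xs) f" "\<And>m. m \<in> set xs \<Longrightarrow> regular \<kappa> m"
  shows "f \<in> mspan (Pp \<kappa>) (set xs)"
  using assms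
proof (induction xs arbitrary: f)
  case Nil
  then have "f = 0" using supp_in_empty by simp
  then show ?case by (simp add: mspan_0)
next
  case (Cons x xs)
  have x: "is_partition x" "regular \<kappa> x" using Cons.prems by (auto simp: jack_closed_def)
  let ?g = "f - mconst (lookup f (xp x)) * Pp \<kappa> x"
  have P: "supp_in (set (x # xs)) (Pp \<kappa> x)"
  proof (rule supp_inI[OF Cons.prems(1) sym_Pp[OF x(1)]])
    show "keys (Pp \<kappa> x) \<subseteq> (\<Union>y\<in>set (x # xs). Cs (xp y) \<inter> {k. deg k = deg (xp y)})"
      using keys_Pp[OF x(1), of \<kappa>] by auto
  qed
  have "supp_in (set xs) ?g"
    by (rule supp_in_remove[OF supp_in_diff[OF Cons.prems(1,3) P]]) (simp add: lookup_minus lookup_Pp[OF x])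
  then have "?g \<in> mspan (Pp \<kappa>) (set xs)"
    using Cons.prems by (intro Cons.IH lamclosed_tl[OF Cons.prems(1,2)]) auto
  then have "?g \<in> mspan (Pp \<kappa>) (set (x # xs))"
    by (rule mspan_mono[rotated 2]) auto
  moreover have "mconst (lookup f (xp x)) * Pp \<kappa> x \<in> mspan (Pp \<kappa>) (set (x # xs))"
    by (intro mspan_scale mspan_base) auto
  ultimately have "?g + mconst (lookup f (xp x)) * Pp \<kappa> x \<in> mspan (Pp \<kappa>) (set (x # xs))"
    by (rule mspan_add)
  then show ?case by simp
qed

text \<open>The moment commutes with D_2 and preserves degree and support, so
  \<open>eigen_unique\<close> leaves only multiples. The factor is read off at the leading
  exponent.\<close>

lemma mom_Pp:
  fixes l :: "'n::{finite,linorder} \<Rightarrow> nat"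
  assumes l: "is_partition l" "regular \<kappa> l"
  shows "mom \<kappa> k (Pp \<kappa> l) = mconst (mom_eig \<kappa> k l) * Pp \<kappa> l"
proof -
  let ?P = "Pp \<kappa> l"
  let ?c = "\<kappa> * (real (card (UNIV :: 'n set)) - 1) - 1"
  let ?N = "deg (xp l)"
  note s = sym_Pp[OF l(1), of \<kappa>] and ks = keys_Pp[OF l(1), of \<kappa>]
  have kd: "keys ?P \<subseteq> {k. deg k = ?N}" using ks by blast
  have D: "D2p \<kappa> g = mom \<kappa> 2 g + mconst (?c * real ?N) * g" if "is_sym g" "keys g \<subseteq> {k. deg k = ?N}" for g :: "'n mpoly"
    unfolding D2p_def mom1_homogeneous[OF that] by (simp add: mconst_mult mult.assoc)
  have km: "keys (mom \<kappa> k ?P) \<subseteq> Cs (xp l) \<inter> {k. deg k = ?N}"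
    by (rule keys_mom[OF hclosed_level ks])
  have "D2p \<kappa> (mom \<kappa> k ?P) = mom \<kappa> k (mom \<kappa> 2 ?P) + mconst (?c * real ?N) * mom \<kappa> k ?P"
    using km by (subst D) (auto simp: D2p_mom_commute[OF s] sym_mom s)
  also have "\<dots> = mom \<kappa> k (D2p \<kappa> ?P)"
    by (simp only: D[OF s kd] mlin_add[OF mlin_mom] mlin_scale[OF mlin_mom])
  also have "\<dots> = mconst (d_eig \<kappa> l) * mom \<kappa> k ?P"
    by (simp only: D2p_Pp[OF l(1)] mlin_scale[OF mlin_mom])
  finally have "mom \<kappa> k ?P = mconst (lookup (mom \<kappa> k ?P) (xp l)) * ?P"
    by (rule eigen_unique[OF l sym_mom[OF s] km])
  moreover have "lookup (mom \<kappa> k ?P) (xp l) = mom_eig \<kappa> k l"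
  proof -
    have "keys ?P \<subseteq> {k. qn k \<le> qn (xp l)}" using ks Cs_qn by blast
    from tri_lead[OF tri_mom s l(1) this] show ?thesis by (simp add: lookup_Pp[OF l])
  qed
  ultimately show ?thesis by simp
qed

lemma keys_Emp_degree:
  assumes "keys f \<subseteq> {k. deg k = N}"
  shows "keys (Emp f) \<subseteq> {k. deg k + 1 = N}"
  unfolding Emp_def
proof (rule keys_sum_subset, rule mlin_keys[OF mlin_mderiv])
  fix i k assume k: "k \<in> keys f"
  show "keys (mderiv i (single k 1)) \<subseteq> {k. deg k + 1 = N}"
  proof (cases "lookup k i = 0")
    case False
    then have "deg (k - single i 1) + 1 = deg k"
      by (simp add: deg_def lookup_minus lookup_single sum.remove[of UNIV i])
    then show ?thesis
      using k assms unfolding mderiv_single' by (intro keys_scale_subset) auto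
  qed (simp add: mderiv_single')
qed

text \<open>The eigenvalue is \<open>qn\<close> minus \<open>deg\<close> plus an integer multiple of
  2 \<kappa>. Within a support the degree is fixed and \<open>qn\<close> differs from that of
  \<open>l\<close>.\<close>

lemma irrational_regular:
  fixes l :: "'n::{finite,linorder} \<Rightarrow> nat"
  assumes "is_partition l" "\<kappa> \<notin> \<rat>"
  shows "regular \<kappa> l"
  unfolding regular_def
proof (intro ballI notI)
  fix m assume m: "m \<in> jack_support l - {l}" and e: "d_eig \<kappa> m = d_eig \<kappa> l"
  have d: "d_eig \<kappa> l = real (qn (xp l)) - real (deg (xp l)) + 2 * \<kappa> * real (\<Sum>i\<in>UNIV. l i * card {i<..})" for l :: "'n \<Rightarrow> nat"
    by (simp add: d_eig_def qn_def deg_def sum_subtractf[symmetric] sum_distrib_left sum.distrib[symmetric])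
      (simp add: algebra_simps power2_eq_square)
  have q: "qn (xp m) < qn (xp l)" using Lam_qn[OF assms(1)] m by auto
  have dg: "deg (xp m) = deg (xp l)" using m by (auto simp: jack_support_def)
  define s where "s = real (\<Sum>i\<in>UNIV. m i * card {i<..}) - real (\<Sum>i\<in>UNIV. l i * card {i<..})"
  have "2 * \<kappa> * s = real (qn (xp l)) - real (qn (xp m))"
    using e unfolding d dg s_def by (simp add: algebra_simps)
  moreover have "s \<noteq> 0"
    using q \<open>2 * \<kappa> * s = _\<close> by auto
  ultimately have "\<kappa> = (real (qn (xp l)) - real (qn (xp m))) / (2 * s)"
    by (simp add: field_simps)
  also have "\<dots> \<in> \<rat>"
    unfolding s_def by (intro Rats_divide Rats_diff Rats_mult Rats_of_nat Rats_number_of)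
  finally show False using assms(2) by simp
qed

definition below1 :: "('n::{finite,linorder} \<Rightarrow> nat) \<Rightarrow> ('n \<Rightarrow> nat) set" where
  "below1 l = {m. is_partition m \<and> m < l \<and> deg (xp m) + 1 = deg (xp l)}"

lemma finite_below1: "finite (below1 l)"
  by (rule finite_subset[OF _ finite_deg_le[of "deg (xp l)"]]) (auto simp: below1_def)

text \<open>By degree, E P_l is a combination of Jack polynomials of degree one less. A nonzero
  coefficient at \<open>x\<close> yields the hypothesis of \<open>spectral_shift\<close> for all
  moments, and this forces \<open>x\<close> to lie inside \<open>l\<close>.\<close>

lemma Emp_Pp_irrational:
  fixes l :: "'n::{finite,linorder} \<Rightarrow> nat"
  assumes l: "is_partition l" and \<kappa>: "\<kappa> \<notin> \<rat>"
  shows "Emp (Pp \<kappa> l) \<in> mspan (Pp \<kappa>) (below1 l)"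
proof -
  let ?f = "Pp \<kappa> l" and ?n = "real (card (UNIV :: 'n set))"
  define A where "A = {m :: 'n \<Rightarrow> nat. is_partition m \<and> deg (xp m) + 1 = deg (xp l)}"
  have fA: "finite A"
    by (rule finite_subset[OF _ finite_deg_le[of "deg (xp l)"]]) (auto simp: A_def)
  have reg: "regular \<kappa> m" if "is_partition m" for m :: "'n \<Rightarrow> nat"
    by (rule irrational_regular[OF that \<kappa>])
  have pA: "is_partition m" if "m \<in> A" for m using that by (simp add: A_def)
  note s = sym_Pp[OF l, of \<kappa>]
  have "Emp ?f \<in> mspan (Pp \<kappa>) (set (qsort A))"
  proof (rule Pp_basis[OF _ sorted_qsort])
    show "jack_closed (set (qsort A))"
      unfolding set_qsort[OF fA] by (auto simp: jack_closed_def A_def jack_support_def)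
    show "supp_in (set (qsort A)) (Emp ?f)"
      unfolding set_qsort[OF fA] supp_in_def
    proof (intro conjI allI impI sym_Emp s)
      fix m assume "is_partition m \<and> xp m \<in> keys (Emp ?f)"
      moreover have "keys (Emp ?f) \<subseteq> {k. deg k + 1 = deg (xp l)}"
        using keys_Pp[OF l, of \<kappa>] by (intro keys_Emp_degree) blast
      ultimately show "m \<in> A" by (auto simp: A_def)
    qed
    show "regular \<kappa> m" if "m \<in> set (qsort A)" for m
      using that reg pA by (simp add: set_qsort[OF fA])
  qed
  then obtain b where b: "Emp ?f = (\<Sum>m\<in>A. mconst (b m) * Pp \<kappa> m)"
    unfolding set_qsort[OF fA] by (rule mspanE)
  \<comment> \<open>By \<open>mom2_Mp\<close>, the passage from \<open>Mp \<kappa> 0 m ?f\<close> to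
    \<open>Mp \<kappa> 0 (Suc m) ?f\<close> multiplies the coefficient of
    \<open>Pp \<kappa> x\<close> by \<open>al x\<close>.\<close>
  define al where "al m = (1 + \<kappa> * (?n - 1) - mom_eig \<kappa> 2 m + mom_eig \<kappa> 2 l) / 2" for m :: "'n \<Rightarrow> nat"
  have momA: "mom \<kappa> k (\<Sum>m\<in>A. mconst (c m) * Pp \<kappa> m) = (\<Sum>m\<in>A. mconst (c m * mom_eig \<kappa> k m) * Pp \<kappa> m)" for c k
    unfolding mlin_sum[OF mlin_mom] mlin_scale[OF mlin_mom]
    by (intro sum.cong refl) (simp add: mom_Pp pA reg mconst_mult mult.assoc)
  have M0: "Mp \<kappa> 0 m ?f = (\<Sum>x\<in>A. mconst (b x * al x ^ m) * Pp \<kappa> x)" for m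
  proof (induction m)
    case 0
    then show ?case using b Emp_Mp[OF s, of \<kappa>] by simp
  next
    case (Suc m)
    have "mconst 2 * Mp \<kappa> 0 (Suc m) ?f = Mp \<kappa> 0 m (mom \<kappa> 2 ?f) + mconst (1 + \<kappa> * (?n - 1)) * Mp \<kappa> 0 m ?f - mom \<kappa> 2 (Mp \<kappa> 0 m ?f)"
      unfolding mom2_Mp[OF s] by simp
    also have "Mp \<kappa> 0 m (mom \<kappa> 2 ?f) = mconst (mom_eig \<kappa> 2 l) * Mp \<kappa> 0 m ?f"
      by (simp only: mom_Pp[OF l reg[OF l]] mlin_scale[OF mlin_Mp])
    also have "mconst (mom_eig \<kappa> 2 l) * Mp \<kappa> 0 m ?f + mconst (1 + \<kappa> * (?n - 1)) * Mp \<kappa> 0 m ?f - mom \<kappa> 2 (Mp \<kappa> 0 m ?f)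
       = (\<Sum>x\<in>A. mconst (2 * (b x * al x ^ Suc m)) * Pp \<kappa> x)"
      unfolding Suc momA sum_distrib_left sum.distrib[symmetric] sum_subtractf[symmetric] mult.assoc[symmetric] mconst_mult[symmetric]
        distrib_right[symmetric] left_diff_distrib[symmetric] mconst_add[symmetric] mconst_diff[symmetric]
      by (intro sum.cong refl arg_cong2[where f = "(*)"] arg_cong[where f = mconst]) (simp add: al_def field_simps)
    finally have "mconst (1/2) * (mconst 2 * Mp \<kappa> 0 (Suc m) ?f) = mconst (1/2) * (\<Sum>x\<in>A. mconst (2 * (b x * al x ^ Suc m)) * Pp \<kappa> x)"
      by simp
    then show ?case
      unfolding mult.assoc[symmetric] mconst_mult[symmetric] sum_distrib_left by simp
  qed
  have M: "Mp \<kappa> k m ?f = (\<Sum>x\<in>A. mconst (b x * (gam \<kappa> (al x) x k * al x ^ m)) * Pp \<kappa> x)" for k m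
  proof (induction k arbitrary: m)
    case 0
    then show ?case by (simp add: M0)
  next
    case (Suc k)
    show ?case
      unfolding Mp_Suc[OF s] Suc.IH M0 momA
      unfolding sum_distrib_left sum.distrib[symmetric] sum_subtractf[symmetric] mult.assoc[symmetric] mconst_mult[symmetric]
        distrib_right[symmetric] left_diff_distrib[symmetric] mconst_add[symmetric] mconst_diff[symmetric]
      by (intro sum.cong refl arg_cong2[where f = "(*)"] arg_cong[where f = mconst]) (simp add: algebra_simps)
  qed
  \<comment> \<open>The coefficient of \<open>Pp \<kappa> x\<close> in \<open>Emp_mom\<close> for
    the common eigenfunction \<open>?f\<close> of the moments.\<close>
  have rel: "b x * (mom_eig \<kappa> k x + (\<Sum>j<k. gam \<kappa> (al x) x j * al x ^ (k - 1 - j)) - mom_eig \<kappa> k l) = 0" if "x \<in> A" for k x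
  proof (rule Pp_independent[OF fA pA _ _ that])
    show "regular \<kappa> m" if "m \<in> A" for m using reg pA that by simp
    have "Emp (mom \<kappa> k ?f) = mconst (mom_eig \<kappa> k l) * Emp ?f"
      by (simp only: mom_Pp[OF l reg[OF l]] mlin_scale[OF mlin_Emp])
    then have e: "mconst (mom_eig \<kappa> k l) * Emp ?f = mom \<kappa> k (Emp ?f) + (\<Sum>j<k. Mp \<kappa> j (k - 1 - j) ?f)"
      unfolding Emp_mom[OF s] by simp
    have "(\<Sum>j<k. Mp \<kappa> j (k - 1 - j) ?f) = (\<Sum>x\<in>A. mconst (b x * (\<Sum>j<k. gam \<kappa> (al x) x j * al x ^ (k - 1 - j))) * Pp \<kappa> x)"
    proof -
      have "(\<Sum>j<k. Mp \<kappa> j (k - 1 - j) ?f) = (\<Sum>x\<in>A. \<Sum>j<k. mconst (b x * (gam \<kappa> (al x) x j * al x ^ (k - 1 - j))) * Pp \<kappa> x)"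
        unfolding M by (rule sum.swap)
      also have "\<dots> = (\<Sum>x\<in>A. mconst (b x * (\<Sum>j<k. gam \<kappa> (al x) x j * al x ^ (k - 1 - j))) * Pp \<kappa> x)"
      proof (intro sum.cong refl)
        fix x
        have "(\<Sum>j\<in>J. mconst (h j)) = (mconst (sum h J) :: 'n mpoly)" if "finite J" for J :: "nat set" and h
          using that by (induction J rule: finite_induct) (simp_all add: mconst_add)
        then show "(\<Sum>j<k. mconst (b x * (gam \<kappa> (al x) x j * al x ^ (k - 1 - j))) * Pp \<kappa> x) =
            mconst (b x * (\<Sum>j<k. gam \<kappa> (al x) x j * al x ^ (k - 1 - j))) * Pp \<kappa> x"
          by (simp add: sum_distrib_right[symmetric] sum_distrib_left)
      qed
      finally show ?thesis .
    qed
    then have "0 = mom \<kappa> k (Emp ?f) + (\<Sum>x\<in>A. mconst (b x * (\<Sum>j<k. gam \<kappa> (al x) x j * al x ^ (k - 1 - j))) * Pp \<kappa> x) - mconst (mom_eig \<kappa> k l) * Emp ?f"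
      using e by simp
    also have "\<dots> = (\<Sum>x\<in>A. mconst (b x * (mom_eig \<kappa> k x + (\<Sum>j<k. gam \<kappa> (al x) x j * al x ^ (k - 1 - j)) - mom_eig \<kappa> k l)) * Pp \<kappa> x)"
      unfolding b momA
      unfolding sum_distrib_left[where r = "mconst _"] sum.distrib[symmetric] sum_subtractf[symmetric] mult.assoc[symmetric] mconst_mult[symmetric]
        distrib_right[symmetric] left_diff_distrib[symmetric] mconst_add[symmetric] mconst_diff[symmetric]
      by (intro sum.cong refl arg_cong2[where f = "(*)"] arg_cong[where f = mconst]) (simp add: algebra_simps)
    finally show "(\<Sum>m\<in>A. mconst (b m * (mom_eig \<kappa> k m + (\<Sum>j<k. gam \<kappa> (al m) m j * al m ^ (k - 1 - j)) - mom_eig \<kappa> k l)) * Pp \<kappa> m) = 0"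
      by simp
  qed
  have "x \<in> below1 l" if "x \<in> A" "b x \<noteq> 0" for x
  proof -
    have "mom_eig \<kappa> k l = mom_eig \<kappa> k x + (\<Sum>j<k. gam \<kappa> (al x) x j * al x ^ (k - 1 - j))" for k
      using rel[OF that(1), of k] that(2) by simp
    moreover have "\<kappa> \<noteq> 0" using \<kappa> by auto
    ultimately have "add_mset (al x - 1) (mspec \<kappa> l) = add_mset (al x) (mspec \<kappa> x)"
      by (intro spectral_shift)
    then have "x < l"
      using that(1) by (intro shift_remove_box[OF \<kappa>]) (auto simp: A_def)
    then show ?thesis using that(1) by (simp add: below1_def A_def)
  qed
  then have "Emp ?f = (\<Sum>m\<in>below1 l. mconst (b m) * Pp \<kappa> m)"
    unfolding b by (intro sum.mono_neutral_right[OF fA]) (auto simp: below1_def A_def)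
  then show ?thesis by (rule mspanI)
qed

section \<open>Polynomials depending continuously on a parameter\<close>

definition cont_family :: "(real \<Rightarrow> 'n mpoly) \<Rightarrow> bool" where
  "cont_family f \<longleftrightarrow> (\<exists>S. finite S \<and> (\<forall>t. keys (f t) \<subseteq> S)) \<and> (\<forall>k. continuous_on UNIV (\<lambda>t. lookup (f t) k))"

lemma cfam_const: "cont_family (\<lambda>_. p)"
  unfolding cont_family_def by (intro conjI exI[of _ "keys p"]) auto

lemma cfamD: "cont_family f \<Longrightarrow> \<exists>S. finite S \<and> (\<forall>t. keys (f t) \<subseteq> S)"
  unfolding cont_family_def by (rule conjunct1)

lemma cfam_continuous: "cont_family f \<Longrightarrow> continuous_on UNIV (\<lambda>t. lookup (f t) k)"
  by (simp add: cont_family_def)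

lemma cfamI:
  "finite S \<Longrightarrow> (\<And>t. keys (f t) \<subseteq> S) \<Longrightarrow> (\<And>k. continuous_on UNIV (\<lambda>t. lookup (f t) k)) \<Longrightarrow> cont_family f"
  unfolding cont_family_def by (intro conjI exI[of _ S] allI)

lemma cfam_add:
  assumes "cont_family f" "cont_family g"
  shows "cont_family (\<lambda>t. f t + g t)"
proof -
  obtain S where S: "finite S" "\<And>t. keys (f t) \<subseteq> S"
    using cfamD[OF assms(1)] by blast
  obtain T where T: "finite T" "\<And>t. keys (g t) \<subseteq> T"
    using cfamD[OF assms(2)] by blast
  show ?thesis
  proof (rule cfamI)
    show "finite (S \<union> T)" using S T by simp
    show "keys (f t + g t) \<subseteq> S \<union> T" for t
      by (rule keys_add_subset[OF order.trans[OF S(2) Un_upper1] order.trans[OF T(2) Un_upper2]])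
    show "continuous_on UNIV (\<lambda>t. lookup (f t + g t) k)" for k
      unfolding lookup_add by (intro continuous_intros cfam_continuous assms)
  qed
qed

lemma cfam_scale:
  assumes "continuous_on UNIV c" "cont_family f"
  shows "cont_family (\<lambda>t. mconst (c t) * f t)"
proof -
  obtain S where S: "finite S" "\<And>t. keys (f t) \<subseteq> S"
    using cfamD[OF assms(2)] by blast
  show ?thesis
  proof (rule cfamI[OF S(1)])
    show "keys (mconst (c t) * f t) \<subseteq> S" for t
      by (rule keys_scale_subset[OF S(2)])
    show "continuous_on UNIV (\<lambda>t. lookup (mconst (c t) * f t) k)" for k
      unfolding lookup_mconst_mult by (intro continuous_intros cfam_continuous assms)
  qed
qed

lemma cfam_sum: "(\<And>i. i \<in> I \<Longrightarrow> cont_family (\<lambda>t. f t i)) \<Longrightarrow> cont_family (\<lambda>t. \<Sum>i\<in>I. f t i)"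
  by (induction I rule: infinite_finite_induct) (auto intro: cfam_const cfam_add)

text \<open>The common finite support turns \<open>A (f t)\<close> into a combination of fixed
  polynomials with continuous coefficients.\<close>

lemma cfam_mlin:
  assumes A: "mlin A" and f: "cont_family f"
  shows "cont_family (\<lambda>t. A (f t))"
proof -
  obtain S where S: "finite S" "\<And>t. keys (f t) \<subseteq> S"
    using cfamD[OF f] by blast
  have "cont_family (\<lambda>t. \<Sum>k\<in>S. mconst (lookup (f t) k) * A (single k 1))"
    by (intro cfam_sum cfam_scale[OF cfam_continuous[OF f] cfam_const])
  then show ?thesis
    using mlin_expand[OF A S(1) S(2)] by simp
qed

lemma cfam_diff: "cont_family f \<Longrightarrow> cont_family g \<Longrightarrow> cont_family (\<lambda>t. f t - g t)"
proof -
  assume "cont_family f" "cont_family g"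
  then have "cont_family (\<lambda>t. f t + mconst (- 1) * g t)"
    by (intro cfam_add cfam_scale) auto
  moreover have "f t + mconst (- 1) * g t = f t - g t" for t
    by (rule poly_mapping_eqI) (simp add: lookup_add lookup_minus)
  ultimately show ?thesis by simp
qed

text \<open>Open intervals are uncountable, so the complement of \<open>B\<close> is dense. The
  lemma serves for rational \<kappa> and for the exceptional values of \<open>a\<close>.\<close>

lemma continuous_zero:
  fixes f :: "real \<Rightarrow> real"
  assumes "continuous_on UNIV f" "countable B" "\<And>t. t \<notin> B \<Longrightarrow> f t = 0"
  shows "f t = 0"
proof (rule ccontr)
  assume "f t \<noteq> 0"
  have "isCont f t" using assms(1) by (simp add: continuous_on_eq_continuous_at)
  then obtain d where d: "0 < d" "\<And>s. \<bar>s - t\<bar> < d \<Longrightarrow> \<bar>f s - f t\<bar> < \<bar>f t\<bar>"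
  proof -
    have "0 < \<bar>f t\<bar>" using \<open>f t \<noteq> 0\<close> by simp
    then obtain d where "0 < d" "\<forall>s. s \<noteq> t \<and> norm (s - t) < d \<longrightarrow> norm (f s - f t) < \<bar>f t\<bar>"
      using \<open>isCont f t\<close> unfolding isCont_def LIM_eq by blast
    then show thesis
      using that[of d] \<open>0 < \<bar>f t\<bar>\<close> by (metis abs_zero diff_self real_norm_def)
  qed
  have "{t - d<..<t + d} \<subseteq> B"
  proof
    fix s assume "s \<in> {t - d<..<t + d}"
    then have "\<bar>f s - f t\<bar> < \<bar>f t\<bar>" by (intro d(2)) auto
    then have "f s \<noteq> 0" by auto
    then show "s \<in> B" using assms(3) by blast
  qed
  then have "countable {t - d<..<t + d}" using assms(2) countable_subset by blast
  then show False using d(1) uncountable_open_interval[of "t - d" "t + d"] by simp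
qed

lemma cfam_zero:
  assumes "cont_family f" "countable B" "\<And>t. t \<notin> B \<Longrightarrow> f t = 0"
  shows "f t = 0"
proof (rule poly_mapping_eqI)
  fix k
  have "lookup (f t) k = 0"
    by (rule continuous_zero[OF cfam_continuous[OF assms(1)] assms(2)]) (simp add: assms(3))
  then show "lookup (f t) k = lookup 0 k" by simp
qed

lemma cfam_Dp:
  assumes "\<And>i. cont_family (\<lambda>t. g t i)" "continuous_on UNIV \<kappa>"
  shows "cont_family (\<lambda>t. Dp (\<kappa> t) (g t) i)"
  unfolding Dp_def by (intro cfam_add cfam_scale cfam_sum cfam_mlin[OF mlin_mderiv] cfam_mlin[OF mlin_ddiff] assms)

lemma cfam_Lp:
  assumes "\<And>i. cont_family (\<lambda>t. g t i)" "continuous_on UNIV \<kappa>"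
  shows "cont_family (\<lambda>t. Lp (\<kappa> t) (g t) i)"
  unfolding Lp_def by (intro cfam_mlin[OF mlin_mult] cfam_Dp assms)

lemma cfam_Lp_pow:
  assumes "\<And>i. cont_family (\<lambda>t. g t i)" "continuous_on UNIV \<kappa>"
  shows "cont_family (\<lambda>t. (Lp (\<kappa> t) ^^ k) (g t) i)"
proof (induction k arbitrary: i)
  case (Suc k)
  then show ?case unfolding funpow.simps o_apply by (intro cfam_Lp assms(2))
qed (use assms in simp)

lemma cfam_Kp:
  assumes "\<And>i. cont_family (\<lambda>t. g t i)" "continuous_on UNIV \<kappa>" "continuous_on UNIV b"
  shows "cont_family (\<lambda>t. Kp (\<kappa> t) (b t) (g t) i)"
  unfolding Kp_def by (intro cfam_add cfam_scale cfam_sum cfam_Dp cfam_Lp assms continuous_on_const)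

lemma cfam_Kp_pow:
  assumes "\<And>i. cont_family (\<lambda>t. g t i)" "continuous_on UNIV \<kappa>" "continuous_on UNIV b"
  shows "cont_family (\<lambda>t. (Kp (\<kappa> t) (b t) ^^ k) (g t) i)"
proof (induction k arbitrary: i)
  case (Suc k)
  then show ?case unfolding funpow.simps o_apply by (intro cfam_Kp assms(2,3))
qed (use assms in simp)

lemma cfam_mom: "cont_family f \<Longrightarrow> continuous_on UNIV \<kappa> \<Longrightarrow> cont_family (\<lambda>t. mom (\<kappa> t) k (f t))"
  unfolding mom_def by (intro cfam_sum cfam_Lp_pow)

lemma cfam_D2p: "cont_family f \<Longrightarrow> continuous_on UNIV \<kappa> \<Longrightarrow> cont_family (\<lambda>t. D2p (\<kappa> t) (f t))"
  unfolding D2p_def by (intro cfam_add cfam_scale cfam_mom continuous_intros)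

lemma cfam_DBp: "cont_family f \<Longrightarrow> cont_family (\<lambda>a. DBp a \<kappa> (f a))"
  unfolding DBp_def by (intro cfam_add cfam_scale cfam_mom cfam_D2p cfam_mlin[OF mlin_Emp] continuous_intros)

lemma cfam_BDp: "cont_family f \<Longrightarrow> cont_family (\<lambda>a. BDp a \<kappa> d (f a))"
  unfolding BDp_def b_par_def by (intro cfam_sum cfam_Kp_pow continuous_intros)

lemma cfam_prodop:
  assumes "\<And>f. cont_family f \<Longrightarrow> cont_family (\<lambda>t. D t (f t))" "\<And>x. continuous_on UNIV (\<lambda>t. e t x)" "cont_family f"
  shows "cont_family (\<lambda>t. prodop (D t) (e t) xs (f t))"
  using assms(3)
proof (induction xs arbitrary: f)
  case (Cons x xs)
  have "cont_family (\<lambda>t. D t (f t) - mconst (e t x) * f t)"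
    by (intro cfam_diff cfam_scale assms(1,2) Cons.prems)
  from Cons.IH[OF this] show ?case by simp
qed simp

lemma continuous_d_eig: "continuous_on UNIV (\<lambda>\<kappa>. d_eig \<kappa> l)"
  unfolding d_eig_def by (intro continuous_intros)

lemma continuous_prod_list: "(\<And>x. x \<in> set xs \<Longrightarrow> continuous_on A (\<lambda>t. f t x)) \<Longrightarrow> continuous_on A (\<lambda>t. \<Prod>x\<leftarrow>xs. f t x :: real)"
  by (induction xs) (auto intro!: continuous_intros)

lemma continuous_Jlead: "continuous_on UNIV (\<lambda>\<kappa>. Jlead \<kappa> l)"
  unfolding Jlead_def by (intro continuous_prod_list continuous_intros continuous_d_eig)

lemma cfam_Jp: "cont_family (\<lambda>\<kappa>. Jp \<kappa> l)"
  unfolding Jp_def by (intro cfam_prodop cfam_D2p cfam_const continuous_d_eig continuous_on_id)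

lemma Jp_eq: "regular \<kappa> l \<Longrightarrow> Jp \<kappa> l = mconst (Jlead \<kappa> l) * Pp \<kappa> l"
  using Jlead_nz[of \<kappa> l] by (simp add: Pp_def mult.assoc[symmetric] mconst_mult[symmetric])

text \<open>Membership in the span of the \<open>Jp\<close> passes to limits in \<open>\<kappa>\<close>, since these polynomials
  stay triangular with nonvanishing leading coefficients.\<close>

lemma mspan_Jp_limit:
  fixes u :: "real \<Rightarrow> 'n::{finite,linorder} mpoly"
  assumes "cont_family u" "\<And>\<kappa>. \<kappa> \<notin> \<rat> \<Longrightarrow> u \<kappa> \<in> mspan (Jp \<kappa>) (set xs)" "qdesc xs" "distinct xs"
    "\<And>m. m \<in> set xs \<Longrightarrow> is_partition m" "\<And>m. m \<in> set xs \<Longrightarrow> regular \<kappa>0 m"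
  shows "u \<kappa>0 \<in> mspan (Jp \<kappa>0) (set xs)"
  using assms
proof (induction xs arbitrary: u)
  case Nil
  have "u \<kappa> = 0" if "\<kappa> \<notin> \<rat>" for \<kappa>
    using Nil.prems(2)[OF that] by (auto simp: mspan_def)
  then have "u \<kappa>0 = 0"
    using cfam_zero[OF Nil.prems(1) countable_rat] by blast
  then show ?case by (simp add: mspan_0)
next
  case (Cons x xs)
  \<comment> \<open>The leading term at \<open>x\<close> is eliminated by cross-multiplication, so
    that \<open>w\<close> stays continuous also where \<open>Jlead\<close> vanishes.\<close>
  define w where "w \<kappa> = mconst (Jlead \<kappa> x) * u \<kappa> - mconst (lookup (u \<kappa>) (xp x)) * Jp \<kappa> x" for \<kappa>
  have x: "is_partition x" using Cons.prems(5) by simp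
  have "cont_family w"
    unfolding w_def by (intro cfam_diff cfam_scale[OF continuous_Jlead Cons.prems(1)] cfam_scale[OF cfam_continuous[OF Cons.prems(1)] cfam_Jp])
  moreover have "w \<kappa> \<in> mspan (Jp \<kappa>) (set xs)" if \<kappa>: "\<kappa> \<notin> \<rat>" for \<kappa>
  proof -
    obtain b where b: "u \<kappa> = (\<Sum>m\<in>set (x # xs). mconst (b m) * Jp \<kappa> m)"
      using Cons.prems(2)[OF \<kappa>] by (rule mspanE)
    define v where "v = (\<Sum>m\<in>set xs. mconst (b m) * Jp \<kappa> m)"
    have u: "u \<kappa> = mconst (b x) * Jp \<kappa> x + v"
      using b Cons.prems(4) by (simp add: v_def)
    have "lookup (Jp \<kappa> m) (xp x) = 0" if "m \<in> set xs" for m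
      using that Cons.prems by (intro lookup_Jp_other) auto
    then have "lookup v (xp x) = 0"
      by (simp add: v_def lookup_sum)
    then have "lookup (u \<kappa>) (xp x) = b x * Jlead \<kappa> x"
      by (simp add: u lookup_add lookup_Jp[OF x])
    then have "w \<kappa> = mconst (Jlead \<kappa> x) * v"
      by (simp add: w_def u mconst_mult algebra_simps)
    then show ?thesis
      by (auto simp: v_def intro: mspan_scale mspanI)
  qed
  ultimately have "w \<kappa>0 \<in> mspan (Jp \<kappa>0) (set xs)"
    using Cons.prems by (intro Cons.IH) auto
  then have "w \<kappa>0 \<in> mspan (Jp \<kappa>0) (set (x # xs))"
    by (rule mspan_mono[rotated 2]) auto
  then have "w \<kappa>0 + mconst (lookup (u \<kappa>0) (xp x)) * Jp \<kappa>0 x \<in> mspan (Jp \<kappa>0) (set (x # xs))"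
    by (intro mspan_add mspan_scale mspan_base) auto
  then have "mconst (Jlead \<kappa>0 x) * u \<kappa>0 \<in> mspan (Jp \<kappa>0) (set (x # xs))"
    unfolding w_def diff_add_cancel .
  then have "mconst (inverse (Jlead \<kappa>0 x)) * (mconst (Jlead \<kappa>0 x) * u \<kappa>0) \<in> mspan (Jp \<kappa>0) (set (x # xs))"
    by (rule mspan_scale)
  moreover have "Jlead \<kappa>0 x \<noteq> 0"
    using Cons.prems(6)[of x] by (simp add: Jlead_nz)
  then have "mconst (inverse (Jlead \<kappa>0 x)) * (mconst (Jlead \<kappa>0 x) * u \<kappa>0) = u \<kappa>0"
    by (simp add: mult.assoc[symmetric] mconst_mult[symmetric])
  ultimately show ?case by (simp only:)
qed

lemma Emp_Pp:
  fixes l :: "'n::{finite,linorder} \<Rightarrow> nat"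
  assumes l: "is_partition l" and reg: "\<And>m. m \<in> below1 l \<Longrightarrow> regular \<kappa> m"
  shows "Emp (Pp \<kappa> l) \<in> mspan (Pp \<kappa>) (below1 l)"
proof -
  \<comment> \<open>\<open>mspan_Jp_limit\<close> peels off the partitions one by one and wants each
    of them once, which \<open>qsort\<close> does not guarantee.\<close>
  obtain xs where xs: "set xs = below1 l" "distinct xs" "qdesc xs"
  proof -
    obtain ys where ys: "set ys = below1 l" "distinct ys"
      using finite_distinct_list[OF finite_below1] by blast
    let ?xs = "sort_key (\<lambda>m. - int (qn (xp m))) ys"
    have "sorted (map (\<lambda>m. - int (qn (xp m))) ?xs)" by simp
    then have "qdesc ?xs" by (simp add: sorted_map)
    then show thesis using ys that[of ?xs] by simp
  qed
  have E: "Emp (Jp \<kappa> l) \<in> mspan (Jp \<kappa>) (set xs)"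
  proof (rule mspan_Jp_limit[OF _ _ xs(3,2)])
    show "cont_family (\<lambda>\<kappa>. Emp (Jp \<kappa> l))"
      by (intro cfam_mlin[OF mlin_Emp] cfam_Jp)
    show "is_partition m" if "m \<in> set xs" for m using that by (auto simp: xs(1) below1_def)
    show "regular \<kappa> m" if "m \<in> set xs" for m using that reg by (auto simp: xs(1))
    fix k :: real assume k: "k \<notin> \<rat>"
    have "Emp (Pp k l) \<in> mspan (Jp k) (below1 l)"
      by (rule mspan_rescale[where c = "\<lambda>m. inverse (Jlead k m)", OF _ Emp_Pp_irrational[OF l k]]) (simp add: Pp_def)
    then have "mconst (Jlead k l) * Emp (Pp k l) \<in> mspan (Jp k) (set xs)"
      unfolding xs(1) by (rule mspan_scale)
    then show "Emp (Jp k l) \<in> mspan (Jp k) (set xs)"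
      by (simp only: Jp_eq[OF irrational_regular[OF l k]] mlin_scale[OF mlin_Emp])
  qed
  have "Emp (Jp \<kappa> l) \<in> mspan (Pp \<kappa>) (below1 l)"
    by (rule mspan_rescale[OF _ E[unfolded xs(1)]]) (rule Jp_eq[OF reg])
  then show ?thesis
    unfolding Pp_def[of \<kappa> l] mlin_scale[OF mlin_Emp] by (rule mspan_scale)
qed

lemma DBp_Pp:
  fixes l :: "'n::{finite,linorder} \<Rightarrow> nat"
  assumes l: "is_partition l"
  shows "DBp a \<kappa> (Pp \<kappa> l) = mconst (e_eig a \<kappa> l) * Pp \<kappa> l + mconst 2 * Emp (Pp \<kappa> l)"
proof -
  have "mom \<kappa> 1 (Pp \<kappa> l) = mconst (real (deg (xp l))) * Pp \<kappa> l"
    using keys_Pp[OF l, of \<kappa>] by (intro mom1_homogeneous sym_Pp[OF l]) blast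
  then show ?thesis
    by (simp add: DBp_def D2p_Pp[OF l] e_eig_def deg_def mconst_add mconst_mult algebra_simps)
qed

section \<open>Bessel polynomials\<close>

definition strictly_below :: "('n::{finite,linorder} \<Rightarrow> nat) \<Rightarrow> ('n \<Rightarrow> nat) set" where
  "strictly_below l = {m. is_partition m \<and> m < l}"

lemma less_sums:
  assumes "m < (l :: 'n::finite \<Rightarrow> nat)"
  shows "qn (xp m) < qn (xp l)" "deg (xp m) < deg (xp l)"
proof -
  have le: "m i \<le> l i" for i using assms by (auto simp: less_le le_fun_def)
  obtain i where i: "m i < l i"
    using assms le by (metis less_le le_fun_def order.not_eq_order_implies_strict ext)
  show "qn (xp m) < qn (xp l)" "deg (xp m) < deg (xp l)"
    unfolding qn_def deg_def lookup_xp using le i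
    by (auto intro!: sum_strict_mono_ex1 power_mono bexI[of _ i] power_strict_mono)
qed

lemma finite_strictly_below: "finite (strictly_below l)"
  by (rule finite_subset[OF _ finite_deg_le[of "deg (xp l)"]])
    (auto simp: strictly_below_def less_imp_le dest: less_sums(2))

lemma below1_subset: "below1 l \<subseteq> strictly_below l"
  by (auto simp: below1_def strictly_below_def)

definition downset :: "real \<Rightarrow> ('n::{finite,linorder} \<Rightarrow> nat) set \<Rightarrow> bool" where
  "downset \<kappa> A \<longleftrightarrow> finite A \<and> (\<forall>m\<in>A. is_partition m \<and> regular \<kappa> m \<and> strictly_below m \<subseteq> A)"

lemma downset_tl:
  assumes "downset \<kappa> (set (x # xs))" "qdesc (x # xs)"
  shows "downset \<kappa> (set xs)"
  unfolding downset_def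
proof (intro conjI ballI subsetI)
  fix m y assume m: "m \<in> set xs"
  then show "is_partition m" "regular \<kappa> m" using assms(1) by (auto simp: downset_def)
  assume y: "y \<in> strictly_below m"
  then have "y \<in> set (x # xs)" using m assms(1) by (auto simp: downset_def)
  moreover have "qn (xp y) < qn (xp m)" using y less_sums(1) by (auto simp: strictly_below_def)
  then have "y \<noteq> x" using assms(2) m by auto
  ultimately show "y \<in> set xs" by simp
qed simp

lemma Emp_downset:
  assumes "downset \<kappa> A" "m \<in> A \<or> is_partition m \<and> strictly_below m \<subseteq> A"
  shows "Emp (Pp \<kappa> m) \<in> mspan (Pp \<kappa>) A"
proof -
  have sb: "is_partition m" "strictly_below m \<subseteq> A" using assms by (auto simp: downset_def)
  have "below1 m \<subseteq> A" using sb below1_subset by blast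
  moreover have "Emp (Pp \<kappa> m) \<in> mspan (Pp \<kappa>) (below1 m)"
    using assms(1) \<open>below1 m \<subseteq> A\<close> by (intro Emp_Pp sb(1)) (auto simp: downset_def)
  ultimately show ?thesis
    using assms(1) by (intro mspan_mono[of A "below1 m"]) (auto simp: downset_def)
qed

text \<open>A partition of \<open>B\<close> outside \<open>A\<close> has eigenvalue
  \<open>c\<close>: its own term cancels and only its image under E remains, which lies in the span
  over \<open>A\<close>.\<close>

lemma DBp_mspan:
  assumes A: "downset \<kappa> A" "\<And>m. m \<in> B \<Longrightarrow> m \<in> A \<or> is_partition m \<and> strictly_below m \<subseteq> A \<and> e_eig a \<kappa> m = c"
    and f: "f \<in> mspan (Pp \<kappa>) B"
  shows "DBp a \<kappa> f - mconst c * f \<in> mspan (Pp \<kappa>) A"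
proof -
  obtain b where b: "f = (\<Sum>m\<in>B. mconst (b m) * Pp \<kappa> m)"
    using f by (rule mspanE)
  have p: "is_partition m" if "m \<in> B" for m
    using A(2)[OF that] A(1) by (auto simp: downset_def)
  have "DBp a \<kappa> f - mconst c * f = (\<Sum>m\<in>B. mconst (b m) * (mconst (e_eig a \<kappa> m - c) * Pp \<kappa> m + mconst 2 * Emp (Pp \<kappa> m)))"
    unfolding b mlin_sum[OF mlin_DBp] mlin_scale[OF mlin_DBp] sum_distrib_left sum_subtractf[symmetric]
    by (intro sum.cong refl) (simp add: DBp_Pp p mconst_diff algebra_simps)
  also have "\<dots> \<in> mspan (Pp \<kappa>) A"
  proof (rule mspan_sum)
    fix m assume m: "m \<in> B"
    have h1: "Emp (Pp \<kappa> m) \<in> mspan (Pp \<kappa>) A"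
      using A(2)[OF m] by (intro Emp_downset A(1)) auto
    have h2: "mconst (e_eig a \<kappa> m - c) * Pp \<kappa> m \<in> mspan (Pp \<kappa>) A"
    proof (cases "m \<in> A")
      case True
      then show ?thesis using A(1) by (intro mspan_scale mspan_base) (auto simp: downset_def)
    next
      case False
      then show ?thesis using A(2)[OF m] by (simp add: mspan_0)
    qed
    show "mconst (b m) * (mconst (e_eig a \<kappa> m - c) * Pp \<kappa> m + mconst 2 * Emp (Pp \<kappa> m)) \<in> mspan (Pp \<kappa>) A"
      by (rule mspan_scale[OF mspan_add[OF h2 mspan_scale[OF h1]]])
  qed
  finally show ?thesis .
qed

lemma prodop_DBp_annihilates:
  "downset \<kappa> (set xs) \<Longrightarrow> qdesc xs \<Longrightarrow> f \<in> mspan (Pp \<kappa>) (set xs) \<Longrightarrow> prodop (DBp a \<kappa>) (e_eig a \<kappa>) xs f = 0"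
proof (induction xs arbitrary: f)
  case Nil
  then show ?case by (simp add: mspan_def)
next
  case (Cons x xs)
  note d = downset_tl[OF Cons.prems(1,2)]
  have "strictly_below x \<subseteq> set xs"
    using Cons.prems(1) less_sums(1) by (fastforce simp: downset_def strictly_below_def)
  then have "DBp a \<kappa> f - mconst (e_eig a \<kappa> x) * f \<in> mspan (Pp \<kappa>) (set xs)"
    using Cons.prems(1) by (intro DBp_mspan[OF d _ Cons.prems(3)]) (auto simp: downset_def)
  then show ?case
    using Cons.IH[OF d] Cons.prems(2) by simp
qed

text \<open>A multiple of the Bessel polynomial that makes sense for every \<open>a\<close>.
  Division by \<open>Zlead\<close> is possible exactly when no partition strictly below
  \<open>l\<close> has the same eigenvalue.\<close>

definition Zp :: "real \<Rightarrow> real \<Rightarrow> ('n::{finite,linorder} \<Rightarrow> nat) \<Rightarrow> 'n mpoly" where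
  "Zp a \<kappa> l = prodop (DBp a \<kappa>) (e_eig a \<kappa>) (qsort (strictly_below l)) (Pp \<kappa> l)"

definition Zlead :: "real \<Rightarrow> real \<Rightarrow> ('n::{finite,linorder} \<Rightarrow> nat) \<Rightarrow> real" where
  "Zlead a \<kappa> l = (\<Prod>x\<leftarrow>qsort (strictly_below l). e_eig a \<kappa> l - e_eig a \<kappa> x)"

definition all_regular :: "real \<Rightarrow> ('n::{finite,linorder} \<Rightarrow> nat) \<Rightarrow> bool" where
  "all_regular \<kappa> l \<longleftrightarrow> is_partition l \<and> (\<forall>m. is_partition m \<and> m \<le> l \<longrightarrow> regular \<kappa> m)"

lemma downset_strictly_below: "all_regular \<kappa> l \<Longrightarrow> downset \<kappa> (strictly_below l)"
  by (auto simp: all_regular_def downset_def strictly_below_def finite_strictly_below[unfolded strictly_below_def] less_imp_le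
      intro: less_trans)

lemma keys_Pp_Cs: "is_partition l \<Longrightarrow> keys (Pp \<kappa> l) \<subseteq> Cs (xp l)"
  using keys_Pp[of l \<kappa>] by blast

lemma Zp_props:
  assumes r: "all_regular \<kappa> l"
  shows sym_Zp: "is_sym (Zp a \<kappa> l)"
    and keys_Zp: "keys (Zp a \<kappa> l) \<subseteq> Cs (xp l)"
    and DBp_Zp: "DBp a \<kappa> (Zp a \<kappa> l) = mconst (e_eig a \<kappa> l) * Zp a \<kappa> l"
    and Zp_form: "Zp a \<kappa> l - mconst (Zlead a \<kappa> l) * Pp \<kappa> l \<in> mspan (Pp \<kappa>) (strictly_below l)"
proof -
  let ?S = "strictly_below l" and ?xs = "qsort (strictly_below l)"
  have l: "is_partition l" "regular \<kappa> l" using r by (auto simp: all_regular_def)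
  note d = downset_strictly_below[OF r]
  note p = prodop_tri[OF tri_DBp[of a \<kappa>] sym_Pp[OF l(1), of \<kappa>] l(1) keys_Pp_Cs[OF l(1)], where g = "e_eig a \<kappa>" and xs = ?xs]
  show "is_sym (Zp a \<kappa> l)" "keys (Zp a \<kappa> l) \<subseteq> Cs (xp l)"
    unfolding Zp_def by (rule p)+
  have s: "set ?xs = ?S" by (rule set_qsort[OF finite_strictly_below])
  have dl: "downset \<kappa> (set (l # ?xs))"
    using d l s by (auto simp: downset_def)
  \<comment> \<open>The argument for \<open>Jp\<close> again, with the span over a downset in place
    of a support.\<close>
  have "prodop (DBp a \<kappa>) (e_eig a \<kappa>) (l # ?xs) (Pp \<kappa> l) = 0"
  proof (rule prodop_DBp_annihilates[OF dl])
    show "qdesc (l # ?xs)"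
      using sorted_qsort[of ?S] s by (auto simp: strictly_below_def intro: less_imp_le[OF less_sums(1)])
    show "Pp \<kappa> l \<in> mspan (Pp \<kappa>) (set (l # ?xs))"
      by (rule mspan_base) auto
  qed
  then have "DBp a \<kappa> (Zp a \<kappa> l) - mconst (e_eig a \<kappa> l) * Zp a \<kappa> l = 0"
    unfolding Zp_def prodop_commute[OF mlin_DBp] by simp
  then show "DBp a \<kappa> (Zp a \<kappa> l) = mconst (e_eig a \<kappa> l) * Zp a \<kappa> l" by simp
  have "f - mconst c * Pp \<kappa> l \<in> mspan (Pp \<kappa>) ?S \<Longrightarrow>
     prodop (DBp a \<kappa>) (e_eig a \<kappa>) xs f - mconst ((\<Prod>x\<leftarrow>xs. e_eig a \<kappa> l - e_eig a \<kappa> x) * c) * Pp \<kappa> l \<in> mspan (Pp \<kappa>) ?S" for f c xs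
  proof (induction xs arbitrary: f c)
    case (Cons x xs)
    let ?e = "e_eig a \<kappa> x"
    let ?g = "f - mconst c * Pp \<kappa> l"
    \<comment> \<open>The constant 0 turns \<open>DBp_mspan\<close> into the invariance of the span
      over \<open>?S\<close> under \<open>DBp\<close>.\<close>
    have 0: "DBp a \<kappa> ?g - mconst 0 * ?g \<in> mspan (Pp \<kappa>) ?S"
      by (rule DBp_mspan[OF d _ Cons.prems]) auto
    have "(DBp a \<kappa> f - mconst ?e * f) - mconst ((e_eig a \<kappa> l - ?e) * c) * Pp \<kappa> l
       = (DBp a \<kappa> ?g - mconst 0 * ?g) - mconst ?e * ?g + mconst c * (mconst 2 * Emp (Pp \<kappa> l))"
      unfolding mlin_diff[OF mlin_DBp] mlin_scale[OF mlin_DBp] DBp_Pp[OF l(1)]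
      by (simp add: mconst_mult mconst_diff algebra_simps)
    also have "\<dots> \<in> mspan (Pp \<kappa>) ?S"
      using l by (intro mspan_add mspan_diff[OF 0] mspan_scale Cons.prems Emp_downset[OF d]) auto
    finally show ?case
      using Cons.IH[of "DBp a \<kappa> f - mconst ?e * f" "(e_eig a \<kappa> l - ?e) * c"] by (simp add: mult_ac)
  qed simp
  from this[of "Pp \<kappa> l" 1 ?xs] show "Zp a \<kappa> l - mconst (Zlead a \<kappa> l) * Pp \<kappa> l \<in> mspan (Pp \<kappa>) ?S"
    by (simp add: Zp_def Zlead_def mspan_0)
qed

lemma continuous_e_eig: "continuous_on UNIV (\<lambda>a. e_eig a \<kappa> l)"
  unfolding e_eig_def by (intro continuous_intros)

lemma continuous_BD_eig: "continuous_on UNIV (\<lambda>a. BD_eig a \<kappa> d l)"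
proof -
  have T: "continuous_on UNIV (\<lambda>a. Tm \<kappa> l (v a) i)" if "\<And>i. continuous_on UNIV (\<lambda>a. v a i)" for v :: "real \<Rightarrow> 'a \<Rightarrow> real" and i
    unfolding Tm_def by (intro continuous_intros that)
  have K: "continuous_on UNIV (\<lambda>a. Km \<kappa> (b_par a \<kappa>) l (v a) i)" if "\<And>i. continuous_on UNIV (\<lambda>a. v a i)" for v :: "real \<Rightarrow> 'a \<Rightarrow> real" and i
    unfolding Km_def b_par_def by (intro continuous_intros T that)
  have "continuous_on UNIV (\<lambda>a. (Km \<kappa> (b_par a \<kappa>) l ^^ d) (\<lambda>_. 1) i)" for i
    by (induction d arbitrary: i) (auto intro: K)
  then show ?thesis unfolding BD_eig_def by (intro continuous_intros)
qed

lemma cfam_Zp: "cont_family (\<lambda>a. Zp a \<kappa> l)"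
  unfolding Zp_def by (intro cfam_prodop cfam_DBp cfam_const continuous_e_eig)

text \<open>For all but finitely many \<open>a\<close>, no partition of smaller degree in the support shares the
  eigenvalue of \<open>l\<close>; the remaining values of \<open>a\<close> follow by continuity.\<close>

lemma BDp_Zp:
  assumes r: "all_regular \<kappa> l"
  shows "BDp a \<kappa> d (Zp a \<kappa> l) = mconst (BD_eig a \<kappa> d l) * Zp a \<kappa> l"
proof -
  have l: "is_partition l" "regular \<kappa> l" using r by (auto simp: all_regular_def)
  define R where "R a = BDp a \<kappa> d (Zp a \<kappa> l) - mconst (BD_eig a \<kappa> d l) * Zp a \<kappa> l" for a
  define M where "M = {m :: 'a \<Rightarrow> nat. qn (xp m) \<le> qn (xp l) \<and> deg (xp m) < deg (xp l)}"
  define Bad where "Bad = (\<Union>m\<in>M. {a. e_eig a \<kappa> m = e_eig a \<kappa> l})"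
  have "cont_family R"
    unfolding R_def by (intro cfam_diff cfam_scale cfam_BDp cfam_Zp continuous_BD_eig)
  moreover have "countable Bad"
    unfolding Bad_def
  proof (intro countable_UN countable_finite)
    show "finite M" by (rule finite_subset[OF _ finite_qn_le[of "qn (xp l)"]]) (auto simp: M_def)
    fix m assume "m \<in> M"
    then have ne: "real (deg (xp m)) \<noteq> real (deg (xp l))" by (simp add: M_def)
    \<comment> \<open>The two eigenvalues are affine in \<open>a\<close> with different slopes, so
      they meet at a single value.\<close>
    have "{a. e_eig a \<kappa> m = e_eig a \<kappa> l} \<subseteq> {(d_eig \<kappa> l - d_eig \<kappa> m) / (real (deg (xp m)) - real (deg (xp l)))}"
      using ne by (auto simp: e_eig_def deg_def field_simps)
    then show "finite {a. e_eig a \<kappa> m = e_eig a \<kappa> l}" by (rule finite_subset) simp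
  qed
  moreover have "R a = 0" if a: "a \<notin> Bad" for a
  proof (rule ccontr)
    assume nz: "R a \<noteq> 0"
    note s = sym_Zp[OF r, of a] and ks = keys_Zp[OF r, of a]
    have sR: "is_sym (R a)" unfolding R_def by (intro sym_diff sym_scale sym_BDp s)
    have kR: "keys (R a) \<subseteq> Cs (xp l)"
      unfolding R_def by (intro keys_diff_subset keys_scale_subset keys_BDp closed_Cs ks)
    have "DBp a \<kappa> (BDp a \<kappa> d (Zp a \<kappa> l)) = mconst (e_eig a \<kappa> l) * BDp a \<kappa> d (Zp a \<kappa> l)"
      by (simp only: DBp_BDp_commute[OF s] DBp_Zp[OF r] mlin_scale[OF mlin_BDp])
    then have "DBp a \<kappa> (R a) = mconst (e_eig a \<kappa> l) * R a"
      unfolding R_def mlin_diff[OF mlin_DBp] mlin_scale[OF mlin_DBp] DBp_Zp[OF r] by (simp add: algebra_simps)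
    from eigen_top[OF tri_DBp sR nz this] obtain m where m: "is_partition m" "xp m \<in> keys (R a)" "e_eig a \<kappa> m = e_eig a \<kappa> l"
      by blast
    have mC: "xp m \<in> Cs (xp l)" using m kR by blast
    have "keys (Zp a \<kappa> l) \<subseteq> {k. qn k \<le> qn (xp l)}" using ks Cs_qn by blast
    from tri_lead[OF tri_BDp s l(1) this] have "lookup (R a) (xp l) = 0"
      by (simp add: R_def lookup_minus)
    then have ml: "m \<noteq> l" using m(2) by (auto simp: in_keys_iff)
    show False
    proof (cases "deg (xp m) = deg (xp l)")
      case True
      then have "m \<in> jack_support l - {l}" using m(1) mC ml by (simp add: jack_support_def)
      moreover have "d_eig \<kappa> m = d_eig \<kappa> l" using m(3) True by (simp add: e_eig_def deg_def del: of_nat_sum)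
      ultimately show False using l(2) by (auto simp: regular_def)
    next
      case False
      then have "m \<in> M" using deg_Cs[OF mC] Cs_qn[OF mC] by (simp add: M_def)
      then show False using a m(3) by (auto simp: Bad_def)
    qed
  qed
  ultimately have "R a = 0" by (rule cfam_zero)
  then show ?thesis by (simp add: R_def)
qed

section \<open>Identification of the Bessel polynomial\<close>

lemma bessel_defined_regular:
  assumes "is_partition l" "bessel_defined a \<kappa> l"
  shows "all_regular \<kappa> l" "\<And>m. is_partition m \<Longrightarrow> m \<le> l \<Longrightarrow> jack \<kappa> m = Pp \<kappa> m" "Zlead a \<kappa> l \<noteq> 0"
proof -
  have u: "is_partition m \<Longrightarrow> m \<le> l \<Longrightarrow> \<exists>!p. is_jack \<kappa> m p" for m
    using assms(2) unfolding bessel_defined_def by blast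
  show "all_regular \<kappa> l"
    unfolding all_regular_def using assms(1) unique_jack_regular u by blast
  show "jack \<kappa> m = Pp \<kappa> m" if "is_partition m" "m \<le> l" for m
    by (rule jack_eq[OF that(1) u[OF that]])
  have "\<forall>m\<in>strictly_below l. e_eig a \<kappa> m \<noteq> e_eig a \<kappa> l"
    using assms(2) unfolding bessel_defined_def strictly_below_def by blast
  then show "Zlead a \<kappa> l \<noteq> 0"
    by (auto simp: Zlead_def prod_list_zero_iff set_qsort finite_strictly_below)
qed

text \<open>In contrast to \<open>eigen_top\<close>, the top exponent is found in the index set
  \<open>A\<close> itself. For Bessel polynomials eigenvalues are then compared only at partitions
  contained in \<open>l\<close>.\<close>

lemma mspan_Pp_top:
  assumes A: "finite A" "\<And>m. m \<in> A \<Longrightarrow> is_partition m" "\<And>m. m \<in> A \<Longrightarrow> regular \<kappa> m"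
    and f: "f \<in> mspan (Pp \<kappa>) A" "f \<noteq> 0"
  obtains m where "m \<in> A" "lookup f (xp m) \<noteq> 0" "keys f \<subseteq> {k. qn k \<le> qn (xp m)}"
proof -
  obtain b where b: "f = (\<Sum>m\<in>A. mconst (b m) * Pp \<kappa> m)"
    using f(1) by (rule mspanE)
  let ?B = "{m \<in> A. b m \<noteq> 0}"
  have fB: "f = (\<Sum>m\<in>?B. mconst (b m) * Pp \<kappa> m)"
    unfolding b using A(1) by (intro sum.mono_neutral_right) auto
  have "?B \<noteq> {}"
  proof
    assume "?B = {}"
    then have "f = 0" using fB by (simp only: sum.empty)
    then show False using f(2) by simp
  qed
  then have "Max ((\<lambda>m. qn (xp m)) ` ?B) \<in> (\<lambda>m. qn (xp m)) ` ?B"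
    using A(1) by (intro Max_in) auto
  then obtain m where m: "m \<in> ?B" "qn (xp m) = Max ((\<lambda>m. qn (xp m)) ` ?B)" by auto
  have mx: "qn (xp y) \<le> qn (xp m)" if "y \<in> ?B" for y
    unfolding m(2) using A(1) that by (intro Max_ge) auto
  show thesis
  proof (rule that)
    show "m \<in> A" using m by simp
    have "lookup f (xp m) = (\<Sum>y\<in>?B. if y = m then b m else 0)"
      unfolding fB lookup_sum lookup_mconst_mult
    proof (intro sum.cong refl)
      fix y assume y: "y \<in> ?B"
      show "b y * lookup (Pp \<kappa> y) (xp m) = (if y = m then b m else 0)"
        using y m(1) A(2)[of y] A(2)[of m] A(3)[of m] lookup_Pp_other[OF _ _ mx[OF y], of \<kappa>] lookup_Pp[of m \<kappa>] by auto
    qed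
    also have "\<dots> = b m" using A(1) m(1) by simp
    finally show "lookup f (xp m) \<noteq> 0" using m(1) by simp
    show "keys f \<subseteq> {k. qn k \<le> qn (xp m)}"
      unfolding fB
    proof (intro keys_sum_subset keys_scale_subset subsetI)
      fix y k assume "y \<in> ?B" "k \<in> keys (Pp \<kappa> y)"
      then show "k \<in> {k. qn k \<le> qn (xp m)}"
        using keys_Pp_Cs[OF A(2), of y \<kappa>] Cs_qn[of k "xp y"] mx[of y] by fastforce
    qed
  qed
qed

lemma mspan_sym: "(\<And>m. m \<in> A \<Longrightarrow> is_sym (v m)) \<Longrightarrow> f \<in> mspan v A \<Longrightarrow> is_sym f"
  unfolding mspan_def by (auto intro!: sym_Sum sym_scale)

text \<open>Two candidates differ by an eigenfunction in the span of the smaller Jack polynomials.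
  If it were nonzero, its top partition would lie strictly below \<open>l\<close> and share the
  eigenvalue of \<open>l\<close>.\<close>

lemma is_bessel_iff:
  fixes l :: "'n::{finite,linorder} \<Rightarrow> nat"
  assumes l: "is_partition l" and bd: "bessel_defined a \<kappa> l"
  shows "is_bessel a \<kappa> l p \<longleftrightarrow> p = mconst (inverse (Zlead a \<kappa> l)) * Zp a \<kappa> l"
proof -
  let ?S = "strictly_below l"
  note R = bessel_defined_regular[OF l bd]
  have reg: "regular \<kappa> l" using R(1) l by (simp add: all_regular_def)
  let ?c = "Zlead a \<kappa> l"
  define Y where "Y = mconst (inverse ?c) * Zp a \<kappa> l"
  have j: "(\<Sum>m\<in>?S. mconst (u m) * jack \<kappa> m) = (\<Sum>m\<in>?S. mconst (u m) * Pp \<kappa> m)" for u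
    by (intro sum.cong refl arg_cong[where f = "(*) _"] R(2)) (auto simp: strictly_below_def less_imp_le)
  have jl: "jack \<kappa> l = Pp \<kappa> l" by (rule R(2)[OF l order.refl])
  have form: "(\<exists>u. p = jack \<kappa> l + (\<Sum>m\<in>?S. mconst (u m) * jack \<kappa> m)) \<longleftrightarrow> p - Pp \<kappa> l \<in> mspan (Pp \<kappa>) ?S" for p
    unfolding jl j mspan_def by (auto simp: algebra_simps)
  have symS: "is_sym f" if "f \<in> mspan (Pp \<kappa>) ?S" for f
    using that by (rule mspan_sym[rotated]) (auto simp: strictly_below_def intro: sym_Pp)
  have symp: "is_sym p" if "p - Pp \<kappa> l \<in> mspan (Pp \<kappa>) ?S" for p
    using sym_add[OF symS[OF that] sym_Pp[OF l, of \<kappa>]] by simp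
  have YS: "Y - Pp \<kappa> l \<in> mspan (Pp \<kappa>) ?S"
  proof -
    have "Y - Pp \<kappa> l = mconst (inverse ?c) * (Zp a \<kappa> l - mconst ?c * Pp \<kappa> l)"
      using R(3) by (simp add: Y_def right_diff_distrib mult.assoc[symmetric] mconst_mult[symmetric])
    then show ?thesis using Zp_form[OF R(1)] by (simp add: mspan_scale)
  qed
  have DY: "DBp a \<kappa> Y = mconst (e_eig a \<kappa> l) * Y"
    unfolding Y_def mlin_scale[OF mlin_DBp] DBp_Zp[OF R(1)] by (simp add: mult.left_commute)
  have regS: "finite ?S" "\<And>m. m \<in> ?S \<Longrightarrow> is_partition m" "\<And>m. m \<in> ?S \<Longrightarrow> regular \<kappa> m"
    using downset_strictly_below[OF R(1)] by (auto simp: downset_def)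
  have lead: "lookup p (xp l) = 1" "keys p \<subseteq> {k. qn k \<le> qn (xp l)}" if S: "p - Pp \<kappa> l \<in> mspan (Pp \<kappa>) ?S" for p
  proof -
    obtain u where "p - Pp \<kappa> l = (\<Sum>m\<in>?S. mconst (u m) * Pp \<kappa> m)"
      using S by (rule mspanE)
    then have p: "p = Pp \<kappa> l + (\<Sum>m\<in>?S. mconst (u m) * Pp \<kappa> m)" by (simp add: algebra_simps)
    have "(\<Sum>m\<in>?S. u m * lookup (Pp \<kappa> m) (xp l)) = 0"
      by (intro sum.neutral ballI, subst lookup_Pp_other) (use l in \<open>auto simp: strictly_below_def intro: less_imp_le[OF less_sums(1)]\<close>)
    then show "lookup p (xp l) = 1"
      by (simp add: p lookup_add lookup_sum lookup_Pp[OF l reg])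
    have "keys (Pp \<kappa> m) \<subseteq> {k. qn k \<le> qn (xp l)}" if "m = l \<or> m \<in> ?S" for m
    proof
      fix k assume "k \<in> keys (Pp \<kappa> m)"
      then have "qn k \<le> qn (xp m)"
        using that l keys_Pp_Cs[of m \<kappa>] Cs_qn[of k "xp m"] by (auto simp: strictly_below_def)
      moreover have "qn (xp m) \<le> qn (xp l)"
        using that less_sums(1)[of m l] by (auto simp: strictly_below_def less_imp_le)
      ultimately show "k \<in> {k. qn k \<le> qn (xp l)}" by simp
    qed
    then show "keys p \<subseteq> {k. qn k \<le> qn (xp l)}"
      unfolding p by (intro keys_add_subset keys_sum_subset keys_scale_subset) auto
  qed
  have eig: "eigenfunction (DB_op a \<kappa>) p \<longleftrightarrow> DBp a \<kappa> p = mconst (e_eig a \<kappa> l) * p" if S: "p - Pp \<kappa> l \<in> mspan (Pp \<kappa>) ?S" for p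
  proof -
    note s = symp[OF S]
    have "p \<noteq> 0" using lead(1)[OF S] by auto
    then have "eigenfunction (DB_op a \<kappa>) p \<longleftrightarrow> (\<exists>c. DBp a \<kappa> p = mconst c * p)"
      using s by (simp add: eigenfunction_def DB_op_rpoly rconst_rpoly)
    also have "\<dots> \<longleftrightarrow> DBp a \<kappa> p = mconst (e_eig a \<kappa> l) * p"
    proof
      assume "\<exists>c. DBp a \<kappa> p = mconst c * p"
      then obtain c where c: "DBp a \<kappa> p = mconst c * p" by blast
      then have "c = e_eig a \<kappa> l"
        using tri_lead[OF tri_DBp s l lead(2)[OF S], of a \<kappa>] lead(1)[OF S] by simp
      then show "DBp a \<kappa> p = mconst (e_eig a \<kappa> l) * p" using c by simp
    qed blast
    finally show ?thesis .
  qed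
  have "is_bessel a \<kappa> l p \<longleftrightarrow> p - Pp \<kappa> l \<in> mspan (Pp \<kappa>) ?S \<and> DBp a \<kappa> p = mconst (e_eig a \<kappa> l) * p"
    unfolding is_bessel_def strictly_below_def[symmetric] form using eig by blast
  also have "\<dots> \<longleftrightarrow> p = Y"
  proof
    assume p: "p - Pp \<kappa> l \<in> mspan (Pp \<kappa>) ?S \<and> DBp a \<kappa> p = mconst (e_eig a \<kappa> l) * p"
    show "p = Y"
    proof (rule ccontr)
      assume "p \<noteq> Y"
      have rS: "p - Y \<in> mspan (Pp \<kappa>) ?S"
        using mspan_diff[OF conjunct1[OF p] YS] by simp
      have rz: "p - Y \<noteq> 0" using \<open>p \<noteq> Y\<close> by simp
      obtain m where m: "m \<in> ?S" "lookup (p - Y) (xp m) \<noteq> 0" "keys (p - Y) \<subseteq> {k. qn k \<le> qn (xp m)}"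
        by (rule mspan_Pp_top[OF regS rS rz])
      have "DBp a \<kappa> (p - Y) = mconst (e_eig a \<kappa> l) * (p - Y)"
        using p DY by (simp add: mlin_diff[OF mlin_DBp] right_diff_distrib)
      then have "e_eig a \<kappa> m = e_eig a \<kappa> l"
        using tri_lead[OF tri_DBp symS[OF rS] regS(2)[OF m(1)] m(3), of a \<kappa>] m(2) by simp
      then show False
        using bd m(1) unfolding bessel_defined_def strictly_below_def by blast
    qed
  qed (use YS DY in simp)
  finally show ?thesis by (simp add: Y_def)
qed

lemma DB_higher_bessel:
  fixes l :: "'n::{finite,linorder} \<Rightarrow> nat"
  assumes l: "is_partition l" and bd: "bessel_defined a \<kappa> l"
  shows "DB_higher a \<kappa> d (rpoly (bessel a \<kappa> l)) = rconst (BD_eig a \<kappa> d l) * rpoly (bessel a \<kappa> l)"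
proof -
  note R = bessel_defined_regular(1)[OF l bd]
  have b: "bessel a \<kappa> l = mconst (inverse (Zlead a \<kappa> l)) * Zp a \<kappa> l"
    unfolding bessel_def is_bessel_iff[OF l bd] by simp
  have s: "is_sym (bessel a \<kappa> l)"
    unfolding b by (intro sym_scale sym_Zp R)
  have "BDp a \<kappa> d (bessel a \<kappa> l) = mconst (BD_eig a \<kappa> d l) * bessel a \<kappa> l"
    unfolding b mlin_scale[OF mlin_BDp] BDp_Zp[OF R] by (simp add: mult.left_commute)
  then show ?thesis
    by (simp add: DB_higher_rpoly[OF s] rconst_rpoly)
qed

section \<open>Leading symbols and algebraic independence\<close>

text \<open>The explicit index set serves relations in indeterminates indexed by all natural
  numbers. For \<open>UNIV\<close> over a finite type this is \<open>meval\<close>.\<close>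

definition geval :: "'b set \<Rightarrow> ('b \<Rightarrow> real) \<Rightarrow> 'b mpoly \<Rightarrow> real" where
  "geval I v p = (\<Sum>k\<in>keys p. lookup p k * (\<Prod>i\<in>I. v i ^ lookup k i))"

lemma geval_superset:
  assumes "finite S" "keys p \<subseteq> S"
  shows "geval I v p = (\<Sum>k\<in>S. lookup p k * (\<Prod>i\<in>I. v i ^ lookup k i))"
  unfolding geval_def using assms by (intro sum.mono_neutral_left) (auto simp: in_keys_iff)

lemma geval_add: "geval I v (p + q) = geval I v p + geval I v q"
proof -
  let ?S = "keys p \<union> keys q"
  have "finite ?S" "keys p \<subseteq> ?S" "keys q \<subseteq> ?S" "keys (p + q) \<subseteq> ?S"
    using keys_add[of p q] by auto
  then show ?thesis
    by (simp add: geval_superset[of ?S] lookup_add distrib_right sum.distrib)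
qed

lemma geval_0 [simp]: "geval I v 0 = 0"
  by (simp add: geval_def)

lemma geval_sum: "geval I v (sum f A) = (\<Sum>x\<in>A. geval I v (f x))"
  by (induction A rule: infinite_finite_induct) (auto simp: geval_add)

lemma geval_single: "geval I v (single k c) = c * (\<Prod>i\<in>I. v i ^ lookup k i)"
  by (subst geval_superset[of "{k}"]) auto

lemma geval_diff: "geval I v (p - q) = geval I v p - geval I v q"
  using geval_add[of I v "p - q" q] by simp

lemma geval_mult: "geval I v (p * q) = geval I v p * geval I v q"
proof -
  have 1: "geval I v (single k c * single l d) = geval I v (single k c) * geval I v (single l d)" for k l c d
    by (simp add: mult_single geval_single lookup_add power_add prod.distrib)
  have 2: "geval I v (sum (\<lambda>k. single k (f k)) A * sum (\<lambda>k. single k (g k)) B)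
      = geval I v (sum (\<lambda>k. single k (f k)) A) * geval I v (sum (\<lambda>k. single k (g k)) B)" for f g A B
    by (simp only: sum_product geval_sum 1)
  show ?thesis
    using 2[of "lookup p" "keys p" "lookup q" "keys q"]
    by (simp only: mpoly_sum_monomials[symmetric])
qed

lemma geval_mconst: "geval I v (mconst c) = c"
  by (simp add: mconst_def geval_single)

lemma geval_mvar:
  assumes "finite I" "i \<in> I"
  shows "geval I v (mvar i) = v i"
proof -
  have "(\<Prod>j\<in>I. v j ^ lookup (single i 1) j) = (\<Prod>j\<in>I. if j = i then v i else 1)"
    by (intro prod.cong refl) (auto simp: lookup_single when_def)
  then show ?thesis
    using assms by (simp add: mvar_def geval_single)
qed

lemma meval_geval: "meval v p = geval UNIV v p"
  by (simp add: meval_def geval_def)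

section \<open>The eigenvalue as a polynomial in the parts of the partition\<close>

definition Tmp :: "real \<Rightarrow> ('n::{finite,linorder} \<Rightarrow> 'n mpoly) \<Rightarrow> 'n \<Rightarrow> 'n mpoly" where
  "Tmp \<kappa> v i = (mvar i + mconst (\<kappa> * real (card {i<..}))) * v i - mconst \<kappa> * (\<Sum>j\<in>{i<..}. v j)"

definition Kmp :: "real \<Rightarrow> real \<Rightarrow> ('n::{finite,linorder} \<Rightarrow> 'n mpoly) \<Rightarrow> 'n \<Rightarrow> 'n mpoly" where
  "Kmp \<kappa> b v i = Tmp \<kappa> (Tmp \<kappa> v) i + mconst b * Tmp \<kappa> v i + mconst \<kappa> * (\<Sum>j\<in>UNIV. Tmp \<kappa> v j)"

definition BD_poly :: "real \<Rightarrow> real \<Rightarrow> nat \<Rightarrow> 'n::{finite,linorder} mpoly" where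
  "BD_poly a \<kappa> d = (\<Sum>i\<in>UNIV. (Kmp \<kappa> (b_par a \<kappa>) ^^ d) (\<lambda>_. 1) i)"

lemma meval_Tmp: "meval (\<lambda>i. real (l i)) (Tmp \<kappa> v i) = Tm \<kappa> l (\<lambda>j. meval (\<lambda>i. real (l i)) (v j)) i"
  by (simp add: meval_geval Tmp_def Tm_def geval_diff geval_mult geval_add geval_mconst geval_mvar geval_sum)

lemma meval_Kmp: "meval (\<lambda>i. real (l i)) (Kmp \<kappa> b v i) = Km \<kappa> b l (\<lambda>j. meval (\<lambda>i. real (l i)) (v j)) i"
  using meval_Tmp[of l \<kappa>, unfolded meval_geval]
  by (simp add: Kmp_def Km_def meval_geval geval_mult geval_add geval_mconst geval_sum)

lemma meval_BD_poly: "meval (\<lambda>i. real (l i)) (BD_poly a \<kappa> d) = BD_eig a \<kappa> d l"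
proof -
  have "(\<lambda>i. meval (\<lambda>i. real (l i)) ((Kmp \<kappa> (b_par a \<kappa>) ^^ d) (\<lambda>_. 1) i)) = (Km \<kappa> (b_par a \<kappa>) l ^^ d) (\<lambda>_. 1)"
  proof (induction d)
    case 0
    then show ?case using geval_mconst[of UNIV "\<lambda>i. real (l i)" 1] by (simp add: meval_geval)
  next
    case (Suc d)
    then show ?case by (simp add: meval_Kmp)
  qed
  from fun_cong[OF this] show ?thesis
    unfolding BD_poly_def BD_eig_def meval_geval geval_sum by (simp add: meval_geval)
qed

text \<open>\<open>deg_less 0 p\<close> means that \<open>p\<close> is 0, which is the form of the
  induction start for \<open>BD_poly_top\<close>.\<close>

definition deg_less :: "nat \<Rightarrow> 'n::finite mpoly \<Rightarrow> bool" where
  "deg_less m p \<longleftrightarrow> keys p \<subseteq> {k. deg k < m}"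

lemma dlt_add: "deg_less m p \<Longrightarrow> deg_less m q \<Longrightarrow> deg_less m (p + q)"
  unfolding deg_less_def by (rule keys_add_subset)

lemma dlt_diff: "deg_less m p \<Longrightarrow> deg_less m q \<Longrightarrow> deg_less m (p - q)"
  unfolding deg_less_def by (rule keys_diff_subset)

lemma dlt_scale: "deg_less m p \<Longrightarrow> deg_less m (mconst c * p)"
  unfolding deg_less_def by (rule keys_scale_subset)

lemma dlt_sum: "(\<And>x. x \<in> A \<Longrightarrow> deg_less m (f x)) \<Longrightarrow> deg_less m (sum f A)"
  unfolding deg_less_def by (rule keys_sum_subset)

lemma dlt_mono: "deg_less m p \<Longrightarrow> m \<le> n \<Longrightarrow> deg_less n p"
  unfolding deg_less_def by auto

lemma dlt_mvar: "deg_less m p \<Longrightarrow> deg_less (Suc m) (mvar i * p)"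
  unfolding deg_less_def
proof (rule mlin_keys[of "\<lambda>p. mvar i * p"])
  fix k assume "keys p \<subseteq> {k. deg k < m}" "k \<in> keys p"
  then have "deg k < m" by auto
  moreover have "deg (single i 1 + k) = Suc (deg k)"
    by (simp add: deg_def lookup_add lookup_single sum.distrib when_def)
  ultimately show "keys (mvar i * single k 1) \<subseteq> {k. deg k < Suc m}"
    by (simp add: mvar_def mult_single)
qed simp

lemma dlt_mvar_power: "deg_less (Suc m) (mvar i ^ m)"
proof (induction m)
  case 0
  then show ?case by (auto simp: deg_less_def deg_def)
qed (use dlt_mvar in simp)

lemma Tmp_top:
  assumes "\<And>i. deg_less m (v i - mvar i ^ m)"
  shows "deg_less (Suc m) (Tmp \<kappa> v i - mvar i ^ Suc m)"
proof -
  have v: "deg_less (Suc m) (v j)" for j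
    using dlt_add[OF dlt_mono[OF assms[of j], of "Suc m"] dlt_mvar_power[of m j]] by simp
  have "Tmp \<kappa> v i - mvar i ^ Suc m = mvar i * (v i - mvar i ^ m) + mconst (\<kappa> * real (card {i<..})) * v i - mconst \<kappa> * (\<Sum>j\<in>{i<..}. v j)"
    by (simp add: Tmp_def algebra_simps)
  also have "deg_less (Suc m) \<dots>"
    by (intro dlt_diff dlt_add dlt_scale dlt_sum v dlt_mvar assms)
  finally show ?thesis .
qed

lemma Kmp_top:
  assumes "\<And>i. deg_less m (v i - mvar i ^ m)"
  shows "deg_less (m + 2) (Kmp \<kappa> b v i - mvar i ^ (m + 2))"
proof -
  note T = Tmp_top[of m v \<kappa>, OF assms]
  have w: "deg_less (m + 2) (Tmp \<kappa> v j)" for j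
    using dlt_add[OF dlt_mono[OF T[of j], of "Suc (Suc m)"] dlt_mvar_power[of "Suc m" j]] by simp
  have "Kmp \<kappa> b v i - mvar i ^ (m + 2) = (Tmp \<kappa> (Tmp \<kappa> v) i - mvar i ^ Suc (Suc m)) + mconst b * Tmp \<kappa> v i + mconst \<kappa> * (\<Sum>j\<in>UNIV. Tmp \<kappa> v j)"
    by (simp add: Kmp_def)
  also have "deg_less (m + 2) \<dots>"
    using Tmp_top[of "Suc m" "Tmp \<kappa> v" \<kappa> i, OF T] by (intro dlt_add dlt_scale dlt_sum w) simp
  finally show ?thesis .
qed

lemma BD_poly_top: "deg_less (2 * d) (BD_poly a \<kappa> d - (\<Sum>i\<in>UNIV. mvar i ^ (2 * d)))"
proof -
  have "deg_less (2 * d) ((Kmp \<kappa> (b_par a \<kappa>) ^^ d) (\<lambda>_. 1) i - mvar i ^ (2 * d))" for i :: 'a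
  proof (induction d arbitrary: i)
    case (Suc d)
    show ?case
      using Kmp_top[of "2 * d" "(Kmp \<kappa> (b_par a \<kappa>) ^^ d) (\<lambda>_. 1)" \<kappa> "b_par a \<kappa>" i, OF Suc] by simp
  qed (simp add: deg_less_def)
  then show ?thesis
    unfolding BD_poly_def sum_subtractf[symmetric] by (intro dlt_sum)
qed

section \<open>From relations between operators to relations between eigenvalues\<close>

lemma tri_id: "triangular (\<lambda>p. p) (\<lambda>_. 1)"
  by (simp add: triangular_def)

lemma tri_comp:
  assumes "triangular T e" "triangular U f"
  shows "triangular (\<lambda>p. T (U p)) (\<lambda>l. e l * f l)"
  unfolding triangular_def
proof (intro conjI allI impI)
  fix p :: "'a mpoly" and l :: "'a \<Rightarrow> nat"
  assume p: "is_sym p" "is_partition l" "keys p \<subseteq> {k. qn k \<le> qn (xp l)}"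
  show "lookup (T (U p)) (xp l) = e l * f l * lookup p (xp l)"
    by (simp add: tri_lead[OF assms(1) tri_sym[OF assms(2) p(1)] p(2) tri_keys[OF assms(2) closed_qn p(3)]] tri_lead[OF assms(2) p])
next
  fix S and p :: "'a mpoly"
  assume "closed_exps S" "keys p \<subseteq> S"
  then show "keys (T (U p)) \<subseteq> S"
    using tri_keys[OF assms(1)] tri_keys[OF assms(2)] by blast
qed (simp_all add: mlin_compose[OF tri_mlin[OF assms(1)] tri_mlin[OF assms(2)]] tri_sym[OF assms(1)] tri_sym[OF assms(2)])

lemma tri_word: "triangular (op_word (BDp a \<kappa>) ws) (\<lambda>l. \<Prod>d\<leftarrow>ws. BD_eig a \<kappa> d l)"
proof (induction ws)
  case Nil
  have "op_word (BDp a \<kappa>) [] = (\<lambda>p :: 'a mpoly. p)" by auto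
  then show ?case using tri_id by simp
next
  case (Cons d ws)
  have "op_word (BDp a \<kappa>) (d # ws) = (\<lambda>p :: 'a mpoly. BDp a \<kappa> d (op_word (BDp a \<kappa>) ws p))" by auto
  then show ?case using tri_comp[OF tri_BDp Cons] by simp
qed

lemma op_word_rpoly:
  fixes f :: "'n::{finite,linorder} mpoly"
  shows "is_sym f \<Longrightarrow> op_word (DB_higher a \<kappa>) ws (rpoly f) = rpoly (op_word (BDp a \<kappa>) ws f)"
  by (induction ws) (simp_all add: DB_higher_rpoly tri_sym[OF tri_word])

lemma prod_list_count:
  fixes e :: "'b \<Rightarrow> real"
  assumes "finite I" "set ws \<subseteq> I"
  shows "(\<Prod>d\<leftarrow>ws. e d) = (\<Prod>d\<in>I. e d ^ count_list ws d)"
  using assms(2)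
proof (induction ws)
  case (Cons x ws)
  have "(\<Prod>d\<in>I. e d ^ count_list (x # ws) d) = (\<Prod>d\<in>I. (if d = x then e x else 1) * e d ^ count_list ws d)"
    by (intro prod.cong refl) (auto simp: power_add)
  then show ?case
    using Cons assms(1) by (simp add: prod.distrib)
qed simp

text \<open>The relation is applied to \<open>monomial_sym l\<close> and read off at x^l. The
  diagonal entries are numbers, so the order of the letters in \<open>w k\<close> does not matter
  there.\<close>

lemma op_relation_eigenvalues:
  fixes a \<kappa> :: real and l :: "'n::{finite,linorder} \<Rightarrow> nat"
  assumes I: "finite I" and l: "is_partition l"
    and p: "\<And>k. k \<in> keys p \<Longrightarrow> keys k \<subseteq> I"
    and w: "\<And>k d. k \<in> keys p \<Longrightarrow> count_list (w k) d = lookup k d"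
    and z: "(\<lambda>f :: 'n ratfun. \<Sum>k\<in>keys p. rconst (lookup p k) * op_word (DB_higher a \<kappa>) (w k) f) = (\<lambda>f. 0)"
  shows "geval I (\<lambda>d. BD_eig a \<kappa> d l) p = 0"
proof -
  let ?m = "monomial_sym l"
  have k: "keys ?m \<subseteq> {k. qn k \<le> qn (xp l)}"
    using mkeys_level[of l] Cs_qn by blast
  have "rpoly (\<Sum>k\<in>keys p. mconst (lookup p k) * op_word (BDp a \<kappa>) (w k) ?m) = 0"
    using fun_cong[OF z, of "rpoly ?m"] by (simp add: op_word_rpoly[OF sym_monomial_sym] rconst_rpoly rpoly_sum)
  then have "lookup (\<Sum>k\<in>keys p. mconst (lookup p k) * op_word (BDp a \<kappa>) (w k) ?m) (xp l) = 0"
    by simp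
  then have "(\<Sum>k\<in>keys p. lookup p k * (\<Prod>d\<leftarrow>w k. BD_eig a \<kappa> d l)) = 0"
    by (simp add: lookup_sum tri_lead[OF tri_word sym_monomial_sym l k] lookup_monomial_sym_partition[OF l l])
  moreover have "(\<Prod>d\<leftarrow>w k. BD_eig a \<kappa> d l) = (\<Prod>d\<in>I. BD_eig a \<kappa> d l ^ lookup k d)" if "k \<in> keys p" for k
  proof -
    have "set (w k) \<subseteq> I"
    proof
      fix d assume "d \<in> set (w k)"
      then have "lookup k d \<noteq> 0"
        using w[OF that, of d] by (metis count_list_0_iff)
      then show "d \<in> I" using p[OF that] by (auto simp: in_keys_iff)
    qed
    then show ?thesis
      by (simp add: prod_list_count[OF I] w[OF that])
  qed
  ultimately show ?thesis
    by (simp add: geval_def)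
qed

lemma power_ratio_tendsto_0:
  assumes "j < m"
  shows "(\<lambda>t. real t ^ j / real t ^ m) \<longlonglongrightarrow> 0"
proof (rule Lim_transform_eventually)
  show "(\<lambda>t. inverse (real t) ^ (m - j)) \<longlonglongrightarrow> 0"
    using tendsto_power[OF lim_inverse_n[where 'a = real], of "m - j"] assms by (simp add: zero_power)
  show "\<forall>\<^sub>F t in sequentially. inverse (real t) ^ (m - j) = real t ^ j / real t ^ m"
    using eventually_gt_at_top[of 0]
  proof eventually_elim
    case (elim t)
    have "real t ^ m = real t ^ j * real t ^ (m - j)"
      using assms by (simp flip: power_add)
    then show ?case using elim by (simp add: field_simps power_inverse)
  qed
qed

lemma dlt_scaling_limit:
  fixes p :: "'n::finite mpoly"
  assumes "deg_less m p"
  shows "(\<lambda>t. meval (\<lambda>i. real t * y i) p / real t ^ m) \<longlonglongrightarrow> 0"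
proof -
  have "meval (\<lambda>i. real t * y i) p / real t ^ m =
      (\<Sum>k\<in>keys p. lookup p k * (\<Prod>i\<in>UNIV. y i ^ lookup k i) * (real t ^ deg k / real t ^ m))" for t
    by (simp add: meval_def power_mult_distrib prod.distrib deg_def power_sum[symmetric] sum_divide_distrib mult_ac)
  moreover have "(\<lambda>t. \<Sum>k\<in>keys p. lookup p k * (\<Prod>i\<in>UNIV. y i ^ lookup k i) * (real t ^ deg k / real t ^ m)) \<longlonglongrightarrow>
      (\<Sum>k\<in>keys p. lookup p k * (\<Prod>i\<in>UNIV. y i ^ lookup k i) * 0)"
    using assms unfolding deg_less_def by (intro tendsto_sum tendsto_mult tendsto_const power_ratio_tendsto_0) auto
  ultimately show ?thesis by simp
qed

lemma BD_eig_scaling_limit: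
  fixes l :: "'n::{finite,linorder} \<Rightarrow> nat"
  shows "(\<lambda>t. BD_eig a \<kappa> d (\<lambda>i. t * l i) / real t ^ (2 * d)) \<longlonglongrightarrow> (\<Sum>i\<in>UNIV. real (l i) ^ (2 * d))"
proof (rule Lim_transform_eventually)
  let ?r = "BD_poly a \<kappa> d - (\<Sum>i\<in>UNIV. mvar i ^ (2 * d)) :: 'n mpoly"
  show "(\<lambda>t. meval (\<lambda>i. real t * real (l i)) ?r / real t ^ (2 * d) + (\<Sum>i\<in>UNIV. real (l i) ^ (2 * d))) \<longlonglongrightarrow> (\<Sum>i\<in>UNIV. real (l i) ^ (2 * d))"
    using tendsto_add[OF dlt_scaling_limit[OF BD_poly_top[of d a \<kappa>], of "\<lambda>i. real (l i)"] tendsto_const, of "\<Sum>i\<in>UNIV. real (l i) ^ (2 * d)"] by simp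
  show "\<forall>\<^sub>F t in sequentially. meval (\<lambda>i. real t * real (l i)) ?r / real t ^ (2 * d) + (\<Sum>i\<in>UNIV. real (l i) ^ (2 * d)) = BD_eig a \<kappa> d (\<lambda>i. t * l i) / real t ^ (2 * d)"
    using eventually_gt_at_top[of 0]
  proof eventually_elim
    case (elim t)
    have pw: "geval UNIV v (mvar i ^ m) = v i ^ m" for v :: "'n \<Rightarrow> real" and i m
      by (induction m) (simp_all add: geval_mult geval_mvar geval_mconst[of UNIV v 1, simplified])
    have "meval (\<lambda>i. real t * real (l i)) ?r = BD_eig a \<kappa> d (\<lambda>i. t * l i) - (\<Sum>i\<in>UNIV. (real t * real (l i)) ^ (2 * d))"
      using meval_BD_poly[of "\<lambda>i. t * l i" a \<kappa> d] by (simp add: meval_geval geval_diff geval_sum pw)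
    moreover have "(\<Sum>i\<in>UNIV. (real t * real (l i)) ^ (2 * d)) = real t ^ (2 * d) * (\<Sum>i\<in>UNIV. real (l i) ^ (2 * d))"
      by (simp add: power_mult_distrib sum_distrib_left)
    ultimately show ?case
      using elim by (simp add: diff_divide_distrib)
  qed
qed

text \<open>Let the indeterminate t_d have weight d. When \<open>l\<close> is scaled by t, a
  monomial of weight m grows at most like t^(2m); after division by t^(2M) only those of weight M
  survive in the limit.\<close>

lemma BD_relation_top_part:
  fixes l :: "'n::{finite,linorder} \<Rightarrow> nat" and p :: "nat mpoly"
  assumes I: "finite I"
    and z: "\<And>l :: 'n \<Rightarrow> nat. is_partition l \<Longrightarrow> geval I (\<lambda>d. BD_eig a \<kappa> d l) p = 0"
    and wt: "\<And>k. k \<in> keys p \<Longrightarrow> (\<Sum>d\<in>I. d * lookup k d) \<le> M"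
    and l: "is_partition l"
  shows "(\<Sum>k\<in>keys p. if (\<Sum>d\<in>I. d * lookup k d) = M
     then lookup p k * (\<Prod>d\<in>I. (\<Sum>i\<in>UNIV. real (l i) ^ (2 * d)) ^ lookup k d) else 0) = 0"
proof (rule LIMSEQ_unique)
  let ?wt = "\<lambda>k. \<Sum>d\<in>I. d * lookup k d"
  let ?E = "\<lambda>t d. BD_eig a \<kappa> d (\<lambda>i. t * l i)"
  let ?F = "\<lambda>t d. ?E t d / real t ^ (2 * d)"
  let ?P = "\<lambda>d. \<Sum>i\<in>UNIV. real (l i) ^ (2 * d)"
  let ?f = "\<lambda>t k. lookup p k * (\<Prod>d\<in>I. ?F t d ^ lookup k d) * (real t ^ (2 * ?wt k) / real t ^ (2 * M))"
  show "(\<lambda>t. \<Sum>k\<in>keys p. ?f t k) \<longlonglongrightarrow> (\<Sum>k\<in>keys p. if ?wt k = M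
     then lookup p k * (\<Prod>d\<in>I. ?P d ^ lookup k d) else 0)"
  proof (rule tendsto_sum)
    fix k assume k: "k \<in> keys p"
    have F: "(\<lambda>t. lookup p k * (\<Prod>d\<in>I. ?F t d ^ lookup k d)) \<longlonglongrightarrow> lookup p k * (\<Prod>d\<in>I. ?P d ^ lookup k d)"
      by (intro tendsto_mult tendsto_const tendsto_prod tendsto_power BD_eig_scaling_limit)
    show "(\<lambda>t. ?f t k) \<longlonglongrightarrow> (if ?wt k = M then lookup p k * (\<Prod>d\<in>I. ?P d ^ lookup k d) else 0)"
    proof (cases "?wt k = M")
      case True
      have "\<forall>\<^sub>F t in sequentially. lookup p k * (\<Prod>d\<in>I. ?F t d ^ lookup k d) = ?f t k"
        using eventually_gt_at_top[of 0] by eventually_elim (simp add: True)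
      from Lim_transform_eventually[OF F this] show ?thesis using True by simp
    next
      case False
      then have "2 * ?wt k < 2 * M" using wt[OF k] by simp
      from tendsto_mult[OF F power_ratio_tendsto_0[OF this]] show ?thesis
        using False by simp
    qed
  qed
  show "(\<lambda>t. \<Sum>k\<in>keys p. ?f t k) \<longlonglongrightarrow> 0"
  proof (rule Lim_transform_eventually[OF tendsto_const])
    show "\<forall>\<^sub>F t in sequentially. 0 = (\<Sum>k\<in>keys p. ?f t k)"
      using eventually_gt_at_top[of 0]
    proof eventually_elim
      case (elim t)
      have "is_partition (\<lambda>i. t * l i)" using l by (simp add: is_partition_def antimono_def)
      then have 0: "geval I (?E t) p = 0" by (rule z)
      have ft: "?f t k = lookup p k * (\<Prod>d\<in>I. ?E t d ^ lookup k d) / real t ^ (2 * M)" for k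
      proof -
        have "(\<Prod>d\<in>I. ?F t d ^ lookup k d) * real t ^ (2 * ?wt k) = (\<Prod>d\<in>I. ?F t d ^ lookup k d * real t ^ (2 * (d * lookup k d)))"
          by (simp add: prod.distrib power_sum[symmetric] sum_distrib_left)
        also have "\<dots> = (\<Prod>d\<in>I. ?E t d ^ lookup k d)"
        proof (intro prod.cong refl)
          fix d
          have "?F t d ^ lookup k d * real t ^ (2 * (d * lookup k d)) = (?F t d * real t ^ (2 * d)) ^ lookup k d"
            by (simp only: power_mult_distrib power_mult[symmetric] mult.assoc)
          also have "?F t d * real t ^ (2 * d) = ?E t d" using elim by simp
          finally show "?F t d ^ lookup k d * real t ^ (2 * (d * lookup k d)) = ?E t d ^ lookup k d" .
        qed
        finally have e: "(\<Prod>d\<in>I. ?F t d ^ lookup k d) * real t ^ (2 * ?wt k) = (\<Prod>d\<in>I. ?E t d ^ lookup k d)" .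
        show ?thesis unfolding e[symmetric] by simp
      qed
      have "(\<Sum>k\<in>keys p. ?f t k) = geval I (?E t) p / real t ^ (2 * M)"
        unfolding geval_def sum_divide_distrib by (rule sum.cong[OF refl ft])
      then show ?case using 0 by simp
    qed
  qed
qed

text \<open>The Vandermonde argument: the numbers \<open>c d\<close> are the coefficients of a
  polynomial of degree less than \<open>card A\<close> with \<open>card A\<close> distinct
  roots.\<close>

lemma poly_zero_of_distinct_roots:
  fixes c :: "nat \<Rightarrow> real"
  assumes "inj_on y A" "finite A" "\<And>i. i \<in> A \<Longrightarrow> (\<Sum>d = 1..card A. c d * y i ^ (d - 1)) = 0" "d \<in> {1..card A}"
  shows "c d = 0"
proof -
  define P where "P = (\<Sum>d = 1..card A. monom (c d) (d - 1))"
  have co: "coeff P m = (if m < card A then c (Suc m) else 0)" for m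
  proof -
    have "coeff P m = (\<Sum>d = 1..card A. if d = Suc m then c (Suc m) else 0)"
      unfolding P_def coeff_sum by (intro sum.cong refl) auto
    then show ?thesis by auto
  qed
  have "P = 0"
  proof (rule ccontr)
    assume nz: "P \<noteq> 0"
    have r: "y ` A \<subseteq> {x. poly P x = 0}"
      using assms(3) by (auto simp: P_def poly_sum poly_monom)
    have "card A = card (y ` A)"
      using assms(1) by (simp add: card_image)
    also have "\<dots> \<le> card {x. poly P x = 0}"
      using r nz by (intro card_mono poly_roots_finite)
    also have "\<dots> \<le> degree P"
      by (rule card_poly_roots_bound[OF nz])
    also have "degree P < card A"
    proof (rule ccontr)
      assume "\<not> degree P < card A"
      then have "coeff P (degree P) = 0" by (simp add: co)
      then show False using nz by simp
    qed
    finally show False by simp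
  qed
  then have "coeff P (d - 1) = 0" by simp
  then show ?thesis using assms(4) by (auto simp: co split: if_splits)
qed

lemma geval_mderiv:
  assumes I: "finite I" and d: "d \<in> I"
  shows "geval I v (mderiv d G) = (\<Sum>k\<in>keys G. lookup G k *
    (real (lookup k d) * v d ^ (lookup k d - 1) * (\<Prod>i\<in>I - {d}. v i ^ lookup k i)))"
proof -
  have "(\<Prod>i\<in>I. v i ^ lookup (k - single d 1) i) = v d ^ (lookup k d - 1) * (\<Prod>i\<in>I - {d}. v i ^ lookup k i)" for k
  proof -
    have "(\<Prod>i\<in>I - {d}. v i ^ lookup (k - single d 1) i) = (\<Prod>i\<in>I - {d}. v i ^ lookup k i)"
      by (intro prod.cong refl) (auto simp: lookup_minus lookup_single when_def)
    then show ?thesis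
      using prod.remove[OF I d, of "\<lambda>i. v i ^ lookup (k - single d 1) i"] by (simp add: lookup_minus)
  qed
  then show ?thesis
    unfolding mderiv_def geval_sum geval_single by (simp add: mult_ac)
qed

lemma pderiv_sum_poly: "pderiv (sum f A) = (\<Sum>x\<in>A. pderiv (f x :: real poly))"
  by (induction A rule: infinite_finite_induct) (simp_all add: pderiv_add)

text \<open>The chain rule for \<open>G\<close> with the polynomials \<open>q d\<close> substituted
  for its indeterminates.\<close>

lemma pderiv_substitution:
  fixes q :: "'b \<Rightarrow> real poly"
  assumes I: "finite I"
  shows "poly (pderiv (\<Sum>k\<in>keys G. smult (lookup G k) (\<Prod>d\<in>I. q d ^ lookup k d))) x
     = (\<Sum>d\<in>I. geval I (\<lambda>d. poly (q d) x) (mderiv d G) * poly (pderiv (q d)) x)"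
proof -
  have "poly (pderiv (\<Prod>d\<in>I. q d ^ lookup k d)) x =
     (\<Sum>d\<in>I. real (lookup k d) * poly (q d) x ^ (lookup k d - 1) * (\<Prod>i\<in>I - {d}. poly (q i) x ^ lookup k i) * poly (pderiv (q d)) x)" for k
    by (simp add: pderiv_prod poly_sum poly_prod pderiv_power mult_ac)
  then have "poly (pderiv (\<Sum>k\<in>keys G. smult (lookup G k) (\<Prod>d\<in>I. q d ^ lookup k d))) x
     = (\<Sum>k\<in>keys G. \<Sum>d\<in>I. lookup G k * (real (lookup k d) * poly (q d) x ^ (lookup k d - 1) * (\<Prod>i\<in>I - {d}. poly (q i) x ^ lookup k i) * poly (pderiv (q d)) x))"
    by (simp add: pderiv_sum_poly pderiv_smult poly_sum sum_distrib_left)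
  also have "\<dots> = (\<Sum>d\<in>I. geval I (\<lambda>d. poly (q d) x) (mderiv d G) * poly (pderiv (q d)) x)"
    by (subst sum.swap) (simp add: geval_mderiv[OF I] sum_distrib_right mult.assoc)
  finally show ?thesis .
qed

text \<open>Algebraic independence of the power sums of \<open>\<nu>\<^sub>i\<^sup>2\<close>: by the chain rule the partial derivatives
  of a relation satisfy a Vandermonde system, hence are again relations, of smaller degree.\<close>

lemma power_sums_independent:
  fixes G :: "nat mpoly"
  defines "I \<equiv> {1..card (UNIV :: 'n::{finite,linorder} set)}"
  assumes "\<And>k. k \<in> keys G \<Longrightarrow> keys k \<subseteq> I \<and> (\<Sum>d\<in>I. lookup k d) \<le> N"
    and "\<And>v :: 'n \<Rightarrow> nat. inj v \<Longrightarrow> geval I (\<lambda>d. \<Sum>i\<in>UNIV. real (v i) ^ (2 * d)) G = 0"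
  shows "G = 0"
  using assms(2,3)
proof (induction N arbitrary: G)
  have fI: "finite I" by (simp add: I_def)
  have const0: "G = 0" if "keys G \<subseteq> {0}"
      and "\<And>v :: 'n \<Rightarrow> nat. inj v \<Longrightarrow> geval I (\<lambda>d. \<Sum>i\<in>UNIV. real (v i) ^ (2 * d)) G = 0" for G :: "nat mpoly"
  proof (rule poly_mapping_eqI)
    fix k
    \<comment> \<open>Counting the larger indices provides one injective point, which is enough for
      a constant.\<close>
    have "geval I (\<lambda>d. \<Sum>i\<in>UNIV. real (card {i :: 'n<..}) ^ (2 * d)) G = 0"
      using inj_card_greater by (rule that(2))
    then have "lookup G 0 = 0"
      using that(1) by (subst (asm) geval_superset[of "{0}"]) auto
    then show "lookup G k = lookup 0 k"
      using that(1) by (cases "k = 0") (auto simp: in_keys_iff subset_iff)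
  qed
  {
    case 0
    have "keys G \<subseteq> {0}"
    proof
      fix k assume k: "k \<in> keys G"
      have "lookup k d = 0" for d
        using 0(1)[OF k] fI by (cases "d \<in> I") (auto simp: in_keys_iff)
      then have "k = 0" by (intro poly_mapping_eqI) simp
      then show "k \<in> {0}" by simp
    qed
    then show ?case using const0 0(2) by blast
  next
    case (Suc N)
    have der: "mderiv d G = 0" if d: "d \<in> I" for d
    proof (rule Suc.IH)
      fix k assume k: "k \<in> keys (mderiv d G)"
      have "keys (mderiv d G) \<subseteq> {k. keys k \<subseteq> I \<and> (\<Sum>d\<in>I. lookup k d) \<le> N}"
      proof (rule mlin_keys[OF mlin_mderiv])
        fix k assume k: "k \<in> keys G"
        show "keys (mderiv d (single k 1)) \<subseteq> {k. keys k \<subseteq> I \<and> (\<Sum>d\<in>I. lookup k d) \<le> N}"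
        proof (cases "lookup k d = 0")
          case False
          let ?k = "k - single d 1"
          have "keys ?k \<subseteq> keys k"
            by (auto simp: in_keys_iff lookup_minus)
          moreover have "(\<Sum>d\<in>I. lookup k d) = Suc (\<Sum>d\<in>I. lookup ?k d)"
          proof -
            have "(\<Sum>i\<in>I - {d}. lookup ?k i) = (\<Sum>i\<in>I - {d}. lookup k i)"
              by (intro sum.cong refl) (auto simp: lookup_minus lookup_single when_def)
            then show ?thesis
              using False by (simp add: sum.remove[OF fI d] lookup_minus)
          qed
          ultimately have "?k \<in> {k. keys k \<subseteq> I \<and> (\<Sum>d\<in>I. lookup k d) \<le> N}"
            using Suc.prems(1)[OF k] by auto
          then show ?thesis
            unfolding mderiv_single' by (intro keys_scale_subset) auto
        qed (simp add: mderiv_single')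
      qed
      then show "keys k \<subseteq> I \<and> (\<Sum>d\<in>I. lookup k d) \<le> N"
        using k by auto
    next
      fix v :: "'n \<Rightarrow> nat"
      assume v: "inj v"
      let ?P = "\<lambda>d. \<Sum>i\<in>UNIV. real (v i) ^ (2 * d)"
      define y where "y i = (real (v i))\<^sup>2" for i
      have row: "(\<Sum>d\<in>I. (geval I ?P (mderiv d G) * real d) * y i ^ (d - 1)) = 0" for i
      proof -
        \<comment> \<open>Only entry \<open>i\<close> varies: \<open>q d\<close> is the power sum as
          a polynomial in the square of this entry, and \<open>h\<close> is \<open>G\<close> at
          these power sums. It vanishes at the squares of all numbers that the other entries avoid,
          hence identically.\<close>
        define q where "q d = [:\<Sum>j\<in>UNIV - {i}. real (v j) ^ (2 * d):] + monom 1 d" for d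
        define h where "h = (\<Sum>k\<in>keys G. smult (lookup G k) (\<Prod>d\<in>I. q d ^ lookup k d))"
        have q: "poly (q d) ((real s)\<^sup>2) = (\<Sum>j\<in>UNIV. real ((v(i := s)) j) ^ (2 * d))" for d s
        proof -
          have "(\<Sum>j\<in>UNIV - {i}. real ((v(i := s)) j) ^ (2 * d)) = (\<Sum>j\<in>UNIV - {i}. real (v j) ^ (2 * d))"
            by (intro sum.cong refl) auto
          then have "(\<Sum>j\<in>UNIV. real ((v(i := s)) j) ^ (2 * d)) = real s ^ (2 * d) + (\<Sum>j\<in>UNIV - {i}. real (v j) ^ (2 * d))"
            by (subst sum.remove[of UNIV i]) simp_all
          moreover have "real s ^ (2 * d) = ((real s)\<^sup>2) ^ d"
            by (rule power_mult)
          ultimately show ?thesis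
            by (simp only: q_def poly_add poly_monom) simp
        qed
        have h: "poly h ((real s)\<^sup>2) = geval I (\<lambda>d. \<Sum>j\<in>UNIV. real ((v(i := s)) j) ^ (2 * d)) G" for s
          by (simp add: h_def poly_sum poly_prod q geval_def del: fun_upd_apply)
        have "poly h ((real s)\<^sup>2) = 0" if "s \<notin> v ` (UNIV - {i})" for s
        proof -
          have "inj (v(i := s))"
            using v that by (auto simp: inj_def)
          then show ?thesis unfolding h by (rule Suc.prems(2))
        qed
        then have "(\<lambda>s. (real s)\<^sup>2) ` (UNIV - v ` (UNIV - {i})) \<subseteq> {x. poly h x = 0}"
          by auto
        moreover have "infinite ((\<lambda>s. (real s)\<^sup>2) ` (UNIV - v ` (UNIV - {i})))"
        proof -
          have "inj_on (\<lambda>s. (real s)\<^sup>2) (UNIV - v ` (UNIV - {i}))"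
            by (auto simp: inj_on_def power2_eq_iff)
          moreover have "infinite (UNIV - v ` (UNIV - {i}))"
            by (intro Diff_infinite_finite) auto
          ultimately show ?thesis by (simp add: finite_image_iff)
        qed
        ultimately have "infinite {x. poly h x = 0}"
          using finite_subset by blast
        then have "h = 0" using poly_roots_finite by blast
        then have "0 = poly (pderiv h) (y i)" by simp
        also have "\<dots> = (\<Sum>d\<in>I. geval I (\<lambda>d. poly (q d) (y i)) (mderiv d G) * poly (pderiv (q d)) (y i))"
          unfolding h_def by (rule pderiv_substitution[OF fI])
        also have "(\<lambda>d. poly (q d) (y i)) = ?P"
          using q[of _ "v i"] by (simp add: y_def fun_eq_iff)
        also have "(\<Sum>d\<in>I. geval I ?P (mderiv d G) * poly (pderiv (q d)) (y i)) = (\<Sum>d\<in>I. (geval I ?P (mderiv d G) * real d) * y i ^ (d - 1))"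
          by (intro sum.cong refl) (simp add: q_def pderiv_add pderiv_pCons pderiv_monom poly_monom)
        finally show ?thesis by simp
      qed
      \<comment> \<open>The nodes of the Vandermonde system are distinct, since the entries are
        nonnegative and distinct.\<close>
      have "inj y"
        using v by (auto simp: inj_def y_def power2_eq_iff)
      then have "geval I ?P (mderiv d G) * real d = 0"
        using row d by (intro poly_zero_of_distinct_roots[of y UNIV "\<lambda>d. geval I ?P (mderiv d G) * real d" d]) (auto simp: I_def)
      then show "geval I ?P (mderiv d G) = 0"
        using d by (simp add: I_def)
    qed
    have "keys G \<subseteq> {0}"
    proof
      fix k assume k: "k \<in> keys G"
      show "k \<in> {0}"
      proof (rule ccontr)
        assume "k \<notin> {0}"
        then obtain d where d: "d \<in> keys k" by fastforce
        let ?e = "single d (1::nat)"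
        have dI: "d \<in> I" using d Suc.prems(1)[OF k] by auto
        have pos: "lookup k d \<noteq> 0" using d by (simp add: in_keys_iff)
        \<comment> \<open>Lowering at \<open>d\<close> is injective on exponents that are positive
          there, and the remaining exponents enter with coefficient 0.\<close>
        have "lookup (mderiv d G) (k - ?e) = (\<Sum>k'\<in>keys G. if k' = k then real (lookup k d) * lookup G k else 0)"
          unfolding mderiv_def lookup_sum
        proof (intro sum.cong refl)
          fix k'
          show "lookup (single (k' - ?e) (of_nat (lookup k' d) * lookup G k')) (k - ?e) =
            (if k' = k then real (lookup k d) * lookup G k else 0)"
          proof (cases "lookup k' d = 0 \<or> k' = k")
            case False
            have "k' - ?e \<noteq> k - ?e"
            proof
              assume e: "k' - ?e = k - ?e"
              have "k' = k"
              proof (rule poly_mapping_eqI)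
                fix i
                show "lookup k' i = lookup k i"
                  using arg_cong[OF e, of "\<lambda>k. lookup k i"] False pos
                  by (auto simp: lookup_minus lookup_single when_def split: if_splits)
              qed
              then show False using False by simp
            qed
            then show ?thesis using False by (simp add: lookup_single)
          qed (use pos in \<open>auto simp: lookup_single\<close>)
        qed
        also have "\<dots> = real (lookup k d) * lookup G k"
          using k by simp
        finally show False
          using der[OF dI] pos k by (simp add: in_keys_iff)
      qed
    qed
    then show ?case using const0 Suc.prems(2) by blast
  }
qed

lemma DB_higher_independent:
  "alg_independent_ops {1..card (UNIV :: 'n set)} (DB_higher a \<kappa> :: nat \<Rightarrow> 'n::{finite,linorder} ratfun \<Rightarrow> 'n ratfun)"
  unfolding alg_independent_ops_def
proof (intro allI impI notI, elim conjE)
  fix p :: "nat mpoly" and w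
  let ?I = "{1..card (UNIV :: 'n set)}"
  let ?wt = "\<lambda>k. \<Sum>d\<in>?I. d * lookup k d"
  assume z: "(\<lambda>f :: 'n ratfun. \<Sum>k\<in>keys p. rconst (lookup p k) * op_word (DB_higher a \<kappa>) (w k) f) = (\<lambda>f. 0)"
    and nz: "p \<noteq> 0" and supp: "\<forall>k\<in>keys p. keys k \<subseteq> ?I"
    and w: "\<forall>k\<in>keys p. \<forall>d. count_list (w k) d = lookup k d"
  have ev: "geval ?I (\<lambda>d. BD_eig a \<kappa> d l) p = 0" if "is_partition l" for l :: "'n \<Rightarrow> nat"
    using supp w by (intro op_relation_eigenvalues[OF _ that _ _ z]) auto
  define M where "M = Max (?wt ` keys p)"
  have ne: "keys p \<noteq> {}" using nz by simp
  have le: "?wt k \<le> M" if "k \<in> keys p" for k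
    unfolding M_def using that by (intro Max_ge) auto
  \<comment> \<open>The part of \<open>p\<close> of top weight.\<close>
  define G where "G = (\<Sum>k\<in>keys p. single k (if ?wt k = M then lookup p k else 0))"
  have lG: "lookup G k = (if ?wt k = M then lookup p k else 0)" for k
  proof -
    have "lookup G k = (\<Sum>k'\<in>keys p. if k' = k then (if ?wt k = M then lookup p k else 0) else 0)"
      unfolding G_def lookup_sum by (intro sum.cong refl) (auto simp: lookup_single when_def)
    then show ?thesis by (auto simp: in_keys_iff)
  qed
  have kG: "keys G \<subseteq> keys p"
    by (auto simp: in_keys_iff lG split: if_splits)
  have part: "geval ?I (\<lambda>d. \<Sum>i\<in>UNIV. real (l i) ^ (2 * d)) G = 0" if l: "is_partition l" for l :: "'n \<Rightarrow> nat"
  proof -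
    have "geval ?I (\<lambda>d. \<Sum>i\<in>UNIV. real (l i) ^ (2 * d)) G = (\<Sum>k\<in>keys p. if ?wt k = M
       then lookup p k * (\<Prod>d\<in>?I. (\<Sum>i\<in>UNIV. real (l i) ^ (2 * d)) ^ lookup k d) else 0)"
      unfolding geval_superset[OF finite_keys kG] by (intro sum.cong refl) (simp add: lG)
    also have "\<dots> = 0"
      by (rule BD_relation_top_part[OF _ ev le l]) simp_all
    finally show ?thesis .
  qed
  \<comment> \<open>Power sums are symmetric, so the relation extends from partitions to arbitrary
    tuples, as is needed for varying a single entry.\<close>
  have all: "geval ?I (\<lambda>d. \<Sum>i\<in>UNIV. real (v i) ^ (2 * d)) G = 0" for v :: "'n \<Rightarrow> nat"
  proof -
    obtain \<sigma> where s: "bij \<sigma>" "is_partition (lookup (kperm \<sigma> (xp v)))"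
      using exists_sorting by blast
    have "(\<Sum>i\<in>UNIV. real (v (\<sigma> i)) ^ (2 * d)) = (\<Sum>i\<in>UNIV. real (v i) ^ (2 * d))" for d
      by (rule sum.reindex_bij_betw[OF s(1)])
    then show ?thesis using part[OF s(2)] by simp
  qed
  have "G = 0"
  proof (rule power_sums_independent)
    fix k assume k: "k \<in> keys G"
    \<comment> \<open>All indices are at least 1, so the weight bounds the total degree and
      \<open>M\<close> can serve as the bound of the induction.\<close>
    then have "(\<Sum>d\<in>?I. lookup k d) \<le> ?wt k"
      by (intro sum_mono) auto
    then show "keys k \<subseteq> ?I \<and> (\<Sum>d\<in>?I. lookup k d) \<le> M"
      using le[of k] k kG supp by auto
  qed (rule all)
  have "M \<in> ?wt ` keys p"
    unfolding M_def using ne by (intro Max_in) auto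
  then obtain k where "k \<in> keys p" "?wt k = M" by auto
  then have "lookup G k \<noteq> 0" by (simp add: lG in_keys_iff)
  then show False using \<open>G = 0\<close> by simp
qed

theorem theorem5p1:
  fixes a \<kappa> :: real
  shows
    "(\<exists>e :: nat \<Rightarrow> ('n::{finite,linorder}) mpoly.
        \<forall>d\<ge>1.
          (\<forall>k\<in>Poly_Mapping.keys (e d - (\<Sum>i\<in>UNIV. mvar i ^ (2 * d))).
             (\<Sum>i\<in>UNIV. Poly_Mapping.lookup k i) < 2 * d) \<and>
          (\<forall>l :: 'n \<Rightarrow> nat. is_partition l \<and> bessel_defined a \<kappa> l \<longrightarrow>
             DB_higher a \<kappa> d (rpoly (bessel a \<kappa> l)) =
               rconst (meval (\<lambda>i. real (l i)) (e d)) * rpoly (bessel a \<kappa> l)))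
     \<and> alg_independent_ops {1..card (UNIV :: 'n set)}
         (DB_higher a \<kappa> :: nat \<Rightarrow> 'n ratfun \<Rightarrow> 'n ratfun)"
proof (intro conjI exI[of _ "BD_poly a \<kappa>"] allI impI ballI)
  fix d :: nat and k :: "'n \<Rightarrow>\<^sub>0 nat"
  assume "k \<in> keys (BD_poly a \<kappa> d - (\<Sum>i\<in>UNIV. mvar i ^ (2 * d)))"
  then show "(\<Sum>i\<in>UNIV. lookup k i) < 2 * d"
    using BD_poly_top[of d a \<kappa>] by (auto simp: deg_less_def deg_def)
next
  fix d and l :: "'n \<Rightarrow> nat"
  assume "is_partition l \<and> bessel_defined a \<kappa> l"
  then show "DB_higher a \<kappa> d (rpoly (bessel a \<kappa> l)) =
      rconst (meval (\<lambda>i. real (l i)) (BD_poly a \<kappa> d)) * rpoly (bessel a \<kappa> l)"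
    by (simp add: meval_BD_poly DB_higher_bessel)
qed (rule DB_higher_independent)

end
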